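(* Let $(N,\Pi)$ be a generalized number system satisfying the PNT $\psi(x)\sim x$. Let $a>0$ and define $E$ by $N(x)=ax+xE(\log x)$ for $x\ge1$ and $E(y)=0$ for $y<0$. Let $K_1,K_2$ be kernels with $\hat K_j(0)\neq0$ and $\int_{-\infty}^\infty(1+|y|)^{1+\varepsilon}|K_j(y)|\,\mathrm{d}y<\infty$ for some $\varepsilon>0$ ($j=1,2$). If $$(E*K_1)(y)=o\left(\frac1y\right),\ y\to\infty,\qquad\text{and}\qquad E*K_2\in L^1(\mathbb{R}),$$ then $$\psi_1(x)=\int_1^x\frac{\mathrm{d}\psi(t)}{t}=\log x+c+o(1),\quad x\to\infty,$$ with $c=-b/a-1$, where $b=(\hat K_2(0))^{-1}\int_{-\infty}^\infty(E*K_2)(y)\,\mathrm{d}y$.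
   Context: A generalized number system is a pair of non-decreasing right-continuous functions $N,\Pi$, both supported in $[1,\infty)$, with $N(1)=1$, $\Pi(1)=0$, linked by $\zeta(s)=\int_{1^-}^\infty x^{-s}\mathrm{d}N(x)=\exp\left(\int_1^\infty x^{-s}\mathrm{d}\Pi(x)\right)$ with both integrals convergent on some half-plane. $\psi(x)=\int_1^x\log t\,\mathrm{d}\Pi(t)$. Convolution is additive: $(E*K)(y)=\int_{-\infty}^\infty E(y-u)K(u)\,\mathrm{d}u$. Fourier transform: $\hat K(t)=\int_{-\infty}^\infty e^{-ity}K(y)\,\mathrm{d}y$. *)

theory Defs
  imports "HOL-Analysis.Analysis" "HOL-Library.Landau_Symbols"
begin

(* All Stieltjes integrals are Lebesgue integrals against interval_measure F.
   The lower limit 1^- is rendered by the domain {1..}, the lower limit 1 by {1<..}. *)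

definition zeta_integrand :: "complex \<Rightarrow> real \<Rightarrow> complex" where
  "zeta_integrand s x = complex_of_real x powr (- s)"

(* dN and dPi are positive measures, so convergence of the two integrals on an open
   half-plane (which contains real points) is the same as absolute convergence there. *)
definition generalized_number_system :: "(real \<Rightarrow> real) \<Rightarrow> (real \<Rightarrow> real) \<Rightarrow> bool" where
  "generalized_number_system N P \<longleftrightarrow>
     mono N \<and> (\<forall>x. continuous (at_right x) N) \<and> (\<forall>x<1. N x = 0) \<and> N 1 = 1 \<and>
     mono P \<and> (\<forall>x. continuous (at_right x) P) \<and> (\<forall>x<1. P x = 0) \<and> P 1 = 0 \<and>
     (\<exists>\<sigma>. \<forall>s. Re s > \<sigma> \<longrightarrow>
        set_integrable (interval_measure N) {1..} (zeta_integrand s) \<and>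
        set_integrable (interval_measure P) {1<..} (zeta_integrand s) \<and>
        (LINT x:{1..}|interval_measure N. zeta_integrand s x) =
          exp (LINT x:{1<..}|interval_measure P. zeta_integrand s x))"

definition psi :: "(real \<Rightarrow> real) \<Rightarrow> real \<Rightarrow> real" where
  "psi P x = (LINT t:{1<..x}|interval_measure P. ln t)"

definition psi1 :: "(real \<Rightarrow> real) \<Rightarrow> real \<Rightarrow> real" where
  "psi1 P x = (LINT t:{1<..x}|interval_measure (psi P). 1 / t)"

definition fourier :: "(real \<Rightarrow> complex) \<Rightarrow> real \<Rightarrow> complex" where
  "fourier K t = (LINT y|lebesgue. exp (- (\<i> * of_real (t * y))) * K y)"

definition conv_exists :: "(real \<Rightarrow> real) \<Rightarrow> (real \<Rightarrow> complex) \<Rightarrow> real \<Rightarrow> bool" where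
  "conv_exists E K y \<longleftrightarrow> integrable lebesgue (\<lambda>u. complex_of_real (E (y - u)) * K u)"

(* Meaningful only where conv_exists holds: the Bochner integral of a non-integrable
   function is 0 by convention. *)
definition conv :: "(real \<Rightarrow> real) \<Rightarrow> (real \<Rightarrow> complex) \<Rightarrow> real \<Rightarrow> complex" where
  "conv E K y = (LINT u|lebesgue. complex_of_real (E (y - u)) * K u)"

definition admissible_kernel :: "(real \<Rightarrow> complex) \<Rightarrow> bool" where
  "admissible_kernel K \<longleftrightarrow>
     K \<in> borel_measurable lebesgue \<and> fourier K 0 \<noteq> 0 \<and>
     (\<exists>\<epsilon>>0. integrable lebesgue (\<lambda>y. (1 + \<bar>y\<bar>) powr (1 + \<epsilon>) * norm (K y)))"

end

theory Submission
  imports Defs "HOL-Probability.Probability" "HOL-Real_Asymp.Real_Asymp"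
begin

text \<open>
  In the variable \<open>y = ln x\<close> put \<open>G y = exp (- y) * N (exp y)\<close>, so that \<open>G = a + E\<close> on the half-line, and
  \<open>\<mu> y = psi1 P (exp y)\<close>. Logarithmic differentiation of zeta gives Chebyshev's identity
  \<open>dN * d\<psi> = log dN\<close>. Combined with the prime number theorem it shows that \<open>G\<close> is slowly varying with
  \<open>G (y - u) / G y\<close> bounded by a multiple of \<open>1 + \<bar>u\<bar>\<close>; hence \<open>E * K1 \<longlongrightarrow> 0\<close> already forces \<open>G \<longlongrightarrow> a\<close>.
  Chebyshev's identity then reads
  \<open>a (\<mu> y - y + 1) = y E y - (E * d\<mu>) y + o(1)\<close>. The left-hand side is slowly oscillating, so
  averaging it against kernels with a finite first moment changes it only by a constant factor and \<open>o(1)\<close>.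
  Averaging over a unit interval turns \<open>d\<mu>\<close> into a bounded function tending to 1; averaging against
  \<open>K2\<close> sends \<open>E * d\<mu>\<close> to the integral of \<open>E * K2\<close>, and averaging against \<open>K1\<close> kills \<open>y E y\<close>.
\<close>

section \<open>Convolution on the real line\<close>

text \<open>Two obstacles shape the argument. \<open>E\<close> is not assumed bounded, not even N(x)
  = O(x), so no convolution with \<open>E\<close> can be estimated at the outset; and the transforms
  of the kernels are known to be non-zero at 0 only, which rules out Wiener's theorem. Both are met
  by regular variation in the sense of Karamata: if I(y) is the integral of \<open>G\<close> over
  [0, y], Chebyshev's identity and the PNT give y G(y) / I(y) -> 1, so \<open>I\<close> varies
  regularly with index 1 and \<open>G\<close> slowly. The two hypotheses on \<open>E\<close> concern
  different kernels, and neither \<open>y E y\<close> nor \<open>E * d\<mu>\<close> is controlled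
  before smoothing. So all three averages are applied to the whole identity at once, and the triple
  average of the left-hand side is evaluated in two ways. The unit interval enters because d\<mu>
  may have atoms, whereas integrability of \<open>E * K2\<close> controls only convolutions with
  bounded functions. The -1 in c comes from integrating log t dN(t) by parts: the remaining
  integral, divided by x, tends to a.\<close>

definition lconv :: "(real \<Rightarrow> complex) \<Rightarrow> (real \<Rightarrow> complex) \<Rightarrow> real \<Rightarrow> complex" where
  "lconv h K y = (LINT u|lborel. h (y - u) * K u)"

text \<open>The bound holds on the whole line and not only near infinity, since
  \<open>h (y - u)\<close> is sampled at every argument under the integral; it supplies the majorant
  for dominated convergence.\<close>

definition bounded_tendsto :: "(real \<Rightarrow> complex) \<Rightarrow> complex \<Rightarrow> bool" where
  "bounded_tendsto h l \<longleftrightarrow>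
     h \<in> borel_measurable borel \<and> (\<exists>C. \<forall>y. norm (h y) \<le> C) \<and> (h \<longlongrightarrow> l) at_top"

text \<open>Dual to \<open>finite_moment\<close>: the weight 1 + |y| is submultiplicative, so such a
  function has an everywhere defined convolution with a kernel of finite first moment, again of
  linear growth. The class has to accommodate \<open>y * E y\<close> and
  \<open>\<mu> y\<close>.\<close>

definition linear_growth :: "(real \<Rightarrow> complex) \<Rightarrow> bool" where
  "linear_growth h \<longleftrightarrow>
     h \<in> borel_measurable borel \<and> (\<exists>C\<ge>0. \<forall>y. norm (h y) \<le> C * (1 + \<bar>y\<bar>))"

definition finite_moment :: "(real \<Rightarrow> complex) \<Rightarrow> bool" where
  "finite_moment K \<longleftrightarrow>
     K \<in> borel_measurable borel \<and> integrable lborel (\<lambda>u. (1 + \<bar>u\<bar>) * norm (K u))"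

lemma one_plus_abs_diff_le: "1 + \<bar>y - u\<bar> \<le> (1 + \<bar>y\<bar>) * (1 + \<bar>u\<bar>)" for y u :: real
proof -
  have "0 \<le> \<bar>y\<bar> * \<bar>u\<bar>" by simp
  moreover have "(1 + \<bar>y\<bar>) * (1 + \<bar>u\<bar>) = 1 + \<bar>y\<bar> + \<bar>u\<bar> + \<bar>y\<bar> * \<bar>u\<bar>" by (simp add: algebra_simps)
  ultimately show ?thesis by linarith
qed

lemma finite_moment_measurable: "finite_moment K \<Longrightarrow> K \<in> borel_measurable borel"
  by (simp add: finite_moment_def)

lemma finite_moment_integrable:
  assumes "finite_moment K"
  shows "integrable lborel K"
proof -
  have [measurable]: "K \<in> borel_measurable borel"
    and *: "integrable lborel (\<lambda>u. (1 + \<bar>u\<bar>) * norm (K u))"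
    using assms by (auto simp: finite_moment_def)
  show ?thesis
    by (rule Bochner_Integration.integrable_bound[OF *])
       (auto simp: abs_mult mult_le_cancel_right1)
qed

lemma measurable_lconv:
  assumes [measurable]: "h \<in> borel_measurable borel" "K \<in> borel_measurable borel"
  shows "lconv h K \<in> borel_measurable borel"
  unfolding lconv_def by measurable

lemma bounded_tendsto_imp_linear_growth:
  assumes "bounded_tendsto h l"
  shows "linear_growth h"
proof -
  obtain C where C: "\<And>y. norm (h y) \<le> C" using assms by (auto simp: bounded_tendsto_def)
  have C0: "C \<ge> 0" using C[of 0] norm_ge_zero order_trans by blast
  have "norm (h y) \<le> C * (1 + \<bar>y\<bar>)" for y
    using C[of y] mult_left_mono[OF _ C0, of 1 "1 + \<bar>y\<bar>"] by simp
  thus ?thesis using assms C0 by (auto simp: linear_growth_def bounded_tendsto_def)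
qed

lemma linear_growth_integrable:
  assumes "linear_growth h" "finite_moment K"
  shows "integrable lborel (\<lambda>u. h (y - u) * K u)"
proof -
  obtain C where C: "C \<ge> 0" "\<And>y. norm (h y) \<le> C * (1 + \<bar>y\<bar>)"
    using assms(1) by (auto simp: linear_growth_def)
  have [measurable]: "h \<in> borel_measurable borel" "K \<in> borel_measurable borel"
    using assms by (auto simp: linear_growth_def finite_moment_def)
  have i: "integrable lborel (\<lambda>u. C * (1 + \<bar>y\<bar>) * ((1 + \<bar>u\<bar>) * norm (K u)))"
    using assms(2) by (auto simp: finite_moment_def)
  have "norm (h (y - u) * K u) \<le> C * (1 + \<bar>y\<bar>) * ((1 + \<bar>u\<bar>) * norm (K u))" for u
  proof -
    have "norm (h (y - u)) \<le> C * (1 + \<bar>y - u\<bar>)" by (rule C)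
    also have "\<dots> \<le> C * ((1 + \<bar>y\<bar>) * (1 + \<bar>u\<bar>))"
      by (rule mult_left_mono[OF one_plus_abs_diff_le C(1)])
    finally have "norm (h (y - u)) * norm (K u) \<le> C * ((1 + \<bar>y\<bar>) * (1 + \<bar>u\<bar>)) * norm (K u)"
      by (rule mult_right_mono) simp
    thus ?thesis by (simp add: norm_mult mult.assoc)
  qed
  thus ?thesis
    by (intro Bochner_Integration.integrable_bound[OF i])
       (auto simp: abs_mult C intro!: AE_I2)
qed

lemma linear_growth_add:
  assumes "linear_growth h" "linear_growth k"
  shows "linear_growth (\<lambda>y. h y + k y)"
proof -
  obtain C D where "C \<ge> 0" "D \<ge> 0" and CD: "\<And>y. norm (h y) \<le> C * (1 + \<bar>y\<bar>)" "\<And>y. norm (k y) \<le> D * (1 + \<bar>y\<bar>)"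
    and [measurable]: "h \<in> borel_measurable borel" "k \<in> borel_measurable borel"
    using assms by (auto simp: linear_growth_def)
  have "norm (h y + k y) \<le> (C + D) * (1 + \<bar>y\<bar>)" for y
    using norm_triangle_ineq[of "h y" "k y"] CD[of y] by (simp add: algebra_simps)
  thus ?thesis using \<open>C \<ge> 0\<close> \<open>D \<ge> 0\<close> unfolding linear_growth_def
    by (intro conjI exI[of _ "C + D"]) auto
qed

lemma linear_growth_cmult:
  assumes "linear_growth h"
  shows "linear_growth (\<lambda>y. c * h y)"
proof -
  obtain C where "C \<ge> 0" and C: "\<And>y. norm (h y) \<le> C * (1 + \<bar>y\<bar>)"
    and [measurable]: "h \<in> borel_measurable borel"
    using assms by (auto simp: linear_growth_def)
  have "norm (c * h y) \<le> (norm c * C) * (1 + \<bar>y\<bar>)" for y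
    using mult_left_mono[OF C[of y], of "norm c"] by (simp add: norm_mult mult.assoc)
  thus ?thesis using \<open>C \<ge> 0\<close> unfolding linear_growth_def
    by (intro conjI exI[of _ "norm c * C"]) auto
qed

lemma linear_growth_diff:
  assumes "linear_growth h" "linear_growth k"
  shows "linear_growth (\<lambda>y. h y - k y)"
  using linear_growth_add[OF assms(1) linear_growth_cmult[OF assms(2), of "-1"]] by simp

lemma linear_growth_lconv:
  assumes h: "linear_growth h" and K: "finite_moment K"
  shows "linear_growth (lconv h K)"
proof -
  obtain C where C: "C \<ge> 0" "\<And>y. norm (h y) \<le> C * (1 + \<bar>y\<bar>)"
    using assms(1) by (auto simp: linear_growth_def)
  have [measurable]: "h \<in> borel_measurable borel" "K \<in> borel_measurable borel"
    using assms by (auto simp: linear_growth_def finite_moment_def)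
  define D where "D = (LINT u|lborel. (1 + \<bar>u\<bar>) * norm (K u))"
  have i: "integrable lborel (\<lambda>u. C * (1 + \<bar>y\<bar>) * ((1 + \<bar>u\<bar>) * norm (K u)))" for y
    using assms(2) by (auto simp: finite_moment_def)
  have *: "norm (h (y - u) * K u) \<le> C * (1 + \<bar>y\<bar>) * ((1 + \<bar>u\<bar>) * norm (K u))" for u y
  proof -
    have "norm (h (y - u)) \<le> C * (1 + \<bar>y - u\<bar>)" by (rule C)
    also have "\<dots> \<le> C * ((1 + \<bar>y\<bar>) * (1 + \<bar>u\<bar>))"
      by (rule mult_left_mono[OF one_plus_abs_diff_le C(1)])
    finally have "norm (h (y - u)) * norm (K u) \<le> C * ((1 + \<bar>y\<bar>) * (1 + \<bar>u\<bar>)) * norm (K u)"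
      by (rule mult_right_mono) simp
    thus ?thesis by (simp add: norm_mult mult.assoc)
  qed
  have "norm (lconv h K y) \<le> (C * D) * (1 + \<bar>y\<bar>)" for y
  proof -
    have "norm (lconv h K y) \<le> (LINT u|lborel. C * (1 + \<bar>y\<bar>) * ((1 + \<bar>u\<bar>) * norm (K u)))"
      unfolding lconv_def
      by (rule Bochner_Integration.integral_norm_bound_integral[OF linear_growth_integrable[OF h K] i *])
    also have "\<dots> = (C * D) * (1 + \<bar>y\<bar>)" by (simp add: D_def)
    finally show ?thesis .
  qed
  moreover have "D \<ge> 0" unfolding D_def by (auto intro!: integral_nonneg_AE)
  ultimately show ?thesis using C(1) measurable_lconv[of h K] unfolding linear_growth_def
    by (intro conjI exI[of _ "C * D"]) auto
qed

lemma lconv_diff: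
  assumes "linear_growth h" "linear_growth k" "finite_moment K"
  shows "lconv (\<lambda>y. h y - k y) K y = lconv h K y - lconv k K y"
  unfolding lconv_def left_diff_distrib
  by (rule Bochner_Integration.integral_diff) (auto intro!: linear_growth_integrable assms)

lemma lconv_add:
  assumes "linear_growth h" "linear_growth k" "finite_moment K"
  shows "lconv (\<lambda>y. h y + k y) K y = lconv h K y + lconv k K y"
  unfolding lconv_def distrib_right
  by (rule Bochner_Integration.integral_add) (auto intro!: linear_growth_integrable assms)

lemma lconv_cmult: "lconv (\<lambda>y. c * h y) K y = c * lconv h K y"
  unfolding lconv_def mult.assoc by simp

section \<open>Limits at infinity under convolution\<close>

lemma tendsto_shift_at_top:
  fixes h :: "real \<Rightarrow> 'a::topological_space"
  assumes "(h \<longlongrightarrow> l) at_top"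
  shows "((\<lambda>y. h (y - u)) \<longlongrightarrow> l) at_top"
proof -
  have "filterlim (\<lambda>y. y - u) at_top (at_top :: real filter)"
    using filterlim_tendsto_add_at_top[OF tendsto_const[of "-u"] filterlim_ident] by (simp add: algebra_simps)
  thus ?thesis using assms by (rule filterlim_compose[rotated])
qed

lemma bounded_tendsto_lconv:
  assumes h: "bounded_tendsto h l" and K: "integrable lborel K"
  shows "bounded_tendsto (lconv h K) (l * (LINT u|lborel. K u))"
proof -
  obtain C where C: "\<And>y. norm (h y) \<le> C" using h by (auto simp: bounded_tendsto_def)
  have [measurable]: "h \<in> borel_measurable borel" using h by (auto simp: bounded_tendsto_def)
  have [measurable]: "K \<in> borel_measurable borel" using K by auto
  have lim: "(h \<longlongrightarrow> l) at_top" using h by (auto simp: bounded_tendsto_def)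
  have i: "integrable lborel (\<lambda>u. C * norm (K u))" using K by auto
  have *: "norm (h (y - u) * K u) \<le> C * norm (K u)" for y u
    using mult_right_mono[OF C[of "y-u"], of "norm (K u)"] by (simp add: norm_mult)
  have int: "integrable lborel (\<lambda>u. h (y - u) * K u)" for y
  proof (rule Bochner_Integration.integrable_bound[OF i])
    show "AE u in lborel. norm (h (y - u) * K u) \<le> norm (C * norm (K u))"
      using order_trans[OF * abs_ge_self] by (intro AE_I2) simp
  qed measurable
  have "norm (lconv h K y) \<le> (LINT u|lborel. C * norm (K u))" for y
    unfolding lconv_def
    by (rule Bochner_Integration.integral_norm_bound_integral[OF int i *])
  moreover have "(lconv h K \<longlongrightarrow> (LINT u|lborel. l * K u)) at_top"
    unfolding lconv_def
  proof (rule integral_dominated_convergence_at_top[where w = "\<lambda>u. C * norm (K u)"])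
    show "AE u in lborel. ((\<lambda>y. h (y - u) * K u) \<longlongrightarrow> l * K u) at_top"
      by (rule AE_I2) (rule tendsto_mult[OF tendsto_shift_at_top[OF lim] tendsto_const])
  qed (use * i in \<open>auto intro!: always_eventually\<close>)
  ultimately show ?thesis using measurable_lconv[of h K] by (auto simp: bounded_tendsto_def)
qed

text \<open>The difference is the integral of \<open>(h (y - u) - h y) * K u\<close>, which tends to
  0 for each fixed \<open>u\<close> and is dominated through the first moment of \<open>K\<close>.
  Averaging a slowly oscillating function therefore loses nothing, provided that the integral of
  \<open>K\<close> is non-zero.\<close>

lemma bounded_tendsto_slow_lconv:
  assumes h[measurable]: "h \<in> borel_measurable borel"
    and C: "\<And>y u. norm (h y - h (y - u)) \<le> C * (1 + \<bar>u\<bar>)"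
    and lim: "\<And>u. ((\<lambda>y. h y - h (y - u)) \<longlongrightarrow> 0) at_top"
    and K: "finite_moment K"
  shows "bounded_tendsto (\<lambda>y. lconv h K y - (LINT u|lborel. K u) * h y) 0"
proof -
  have C0: "C \<ge> 0" using C[of 0 0] by simp
  have Km[measurable]: "K \<in> borel_measurable borel" using K by (rule finite_moment_measurable)
  have i: "integrable lborel (\<lambda>u. C * ((1 + \<bar>u\<bar>) * norm (K u)))"
    using K by (auto simp: finite_moment_def)
  have lg: "linear_growth h"
  proof -
    have "norm (h y) \<le> (C + norm (h 0)) * (1 + \<bar>y\<bar>)" for y
    proof -
      have "norm (h y) \<le> norm (h y - h 0) + norm (h 0)" by norm
      also have "\<dots> \<le> C * (1 + \<bar>y\<bar>) + norm (h 0) * (1 + \<bar>y\<bar>)"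
        using C[of y y] by (intro add_mono) (auto simp: mult_le_cancel_left1)
      finally show ?thesis by (simp add: algebra_simps)
    qed
    thus ?thesis using C0 unfolding linear_growth_def
      by (intro conjI exI[of _ "C + norm (h 0)"]) auto
  qed
  have *: "norm ((h (y - u) - h y) * K u) \<le> C * ((1 + \<bar>u\<bar>) * norm (K u))" for y u
    using mult_right_mono[OF C[of y u], of "norm (K u)"] by (simp add: norm_mult norm_minus_commute mult.assoc)
  have int: "integrable lborel (\<lambda>u. (h (y - u) - h y) * K u)" for y
    unfolding left_diff_distrib
    by (intro Bochner_Integration.integrable_diff linear_growth_integrable lg K
        integrable_mult_right finite_moment_integrable)
  have eq: "lconv h K y - (LINT u|lborel. K u) * h y = (LINT u|lborel. (h (y - u) - h y) * K u)" for y
    unfolding left_diff_distrib lconv_def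
    using linear_growth_integrable[OF lg K, of y] finite_moment_integrable[OF K]
    by (subst Bochner_Integration.integral_diff) (simp_all add: mult.commute[of "h y"])
  have "norm (lconv h K y - (LINT u|lborel. K u) * h y) \<le> (LINT u|lborel. C * ((1 + \<bar>u\<bar>) * norm (K u)))" for y
    unfolding eq by (rule Bochner_Integration.integral_norm_bound_integral[OF int i *])
  moreover have "((\<lambda>y. LINT u|lborel. (h (y - u) - h y) * K u) \<longlongrightarrow> (LINT u|lborel. 0 * K u)) at_top"
  proof (rule integral_dominated_convergence_at_top[where w = "\<lambda>u. C * ((1 + \<bar>u\<bar>) * norm (K u))"])
    show "AE u in lborel. ((\<lambda>y. (h (y - u) - h y) * K u) \<longlongrightarrow> 0 * K u) at_top"
      using tendsto_minus[OF lim] by (intro AE_I2 tendsto_mult tendsto_const) simp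
  qed (use * i in \<open>auto intro!: always_eventually\<close>)
  moreover have "(\<lambda>y. lconv h K y - (LINT u|lborel. K u) * h y) \<in> borel_measurable borel"
    using measurable_lconv[OF h Km] by measurable
  ultimately show ?thesis unfolding eq[symmetric] by (auto simp: bounded_tendsto_def)
qed

text \<open>Fubini, with the weights of \<open>h\<close>, \<open>K\<close> and \<open>L\<close>
  multiplying to an integrable majorant on the plane. The exchange lets a kernel that is applied
  last act directly on \<open>y * E y\<close>.\<close>

lemma lconv_commute:
  assumes h: "linear_growth h" and K: "finite_moment K" and L: "finite_moment L"
  shows "lconv (lconv h K) L y = lconv (lconv h L) K y"
proof -
  obtain C where C: "C \<ge> 0" "\<And>y. norm (h y) \<le> C * (1 + \<bar>y\<bar>)"
    using h by (auto simp: linear_growth_def)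
  have [measurable]: "h \<in> borel_measurable borel" "K \<in> borel_measurable borel" "L \<in> borel_measurable borel"
    using assms by (auto simp: linear_growth_def finite_moment_def)
  have iK: "integrable lborel (\<lambda>u. (1 + \<bar>u\<bar>) * norm (K u))"
    and iL: "integrable lborel (\<lambda>u. (1 + \<bar>u\<bar>) * norm (L u))"
    using K L by (auto simp: finite_moment_def)
  let ?w = "\<lambda>(v, u). (C * (1 + \<bar>y\<bar>)) * (((1 + \<bar>v\<bar>) * norm (L v)) * ((1 + \<bar>u\<bar>) * norm (K u)))"
  let ?F = "\<lambda>(v, u). h (y - v - u) * K u * L v"
  have iw: "integrable (lborel \<Otimes>\<^sub>M lborel) ?w"
  proof (rule lborel_pair.Fubini_integrable)
    have "integrable lborel (\<lambda>v. C * (1 + \<bar>y\<bar>) * (LINT u|lborel. (1 + \<bar>u\<bar>) * norm (K u)) * ((1 + \<bar>v\<bar>) * norm (L v)))"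
      by (intro integrable_mult_right iL)
    moreover have "(\<lambda>v. LINT u|lborel. norm (?w (v, u))) =
        (\<lambda>v. C * (1 + \<bar>y\<bar>) * (LINT u|lborel. (1 + \<bar>u\<bar>) * norm (K u)) * ((1 + \<bar>v\<bar>) * norm (L v)))"
    proof
      fix v
      have "norm (?w (v, u)) = (C * (1 + \<bar>y\<bar>) * ((1 + \<bar>v\<bar>) * norm (L v))) * ((1 + \<bar>u\<bar>) * norm (K u))" for u
        using C(1) by (simp add: abs_mult)
      hence "(LINT u|lborel. norm (?w (v, u))) =
          (LINT u|lborel. (C * (1 + \<bar>y\<bar>) * ((1 + \<bar>v\<bar>) * norm (L v))) * ((1 + \<bar>u\<bar>) * norm (K u)))"
        by (rule Bochner_Integration.integral_cong[OF refl])
      also have "\<dots> = (C * (1 + \<bar>y\<bar>) * ((1 + \<bar>v\<bar>) * norm (L v))) * (LINT u|lborel. (1 + \<bar>u\<bar>) * norm (K u))"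
        by (rule Bochner_Integration.integral_mult_right_zero)
      finally show "(LINT u|lborel. norm (?w (v, u))) =
          C * (1 + \<bar>y\<bar>) * (LINT u|lborel. (1 + \<bar>u\<bar>) * norm (K u)) * ((1 + \<bar>v\<bar>) * norm (L v))"
        by (simp only: mult.assoc mult.commute mult.left_commute)
    qed
    ultimately show "integrable lborel (\<lambda>v. LINT u|lborel. norm (?w (v, u)))" by (simp only:)
    show "AE v in lborel. integrable lborel (\<lambda>u. ?w (v, u))"
      using iK by auto
  qed auto
  have "integrable (lborel \<Otimes>\<^sub>M lborel) ?F"
  proof (rule Bochner_Integration.integrable_bound[OF iw], measurable, intro AE_I2, clarify)
    fix v u :: real
    have "norm (h (y - v - u)) \<le> C * (1 + \<bar>y - v - u\<bar>)" by (rule C)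
    also have "\<dots> \<le> C * ((1 + \<bar>y\<bar>) * ((1 + \<bar>v\<bar>) * (1 + \<bar>u\<bar>)))"
    proof (rule mult_left_mono[OF _ C(1)])
      have "0 \<le> \<bar>v\<bar> * \<bar>u\<bar>" "0 \<le> \<bar>y\<bar> * (\<bar>v\<bar> + \<bar>u\<bar> + \<bar>v\<bar> * \<bar>u\<bar>)" by simp_all
      moreover have "(1 + \<bar>y\<bar>) * ((1 + \<bar>v\<bar>) * (1 + \<bar>u\<bar>)) =
          1 + \<bar>y\<bar> + \<bar>u\<bar> + \<bar>v\<bar> + \<bar>v\<bar> * \<bar>u\<bar> + \<bar>y\<bar> * (\<bar>v\<bar> + \<bar>u\<bar> + \<bar>v\<bar> * \<bar>u\<bar>)" by (simp add: algebra_simps)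
      ultimately show "1 + \<bar>y - v - u\<bar> \<le> (1 + \<bar>y\<bar>) * ((1 + \<bar>v\<bar>) * (1 + \<bar>u\<bar>))" by linarith
    qed
    finally have "norm (h (y - v - u)) * (norm (K u) * norm (L v)) \<le>
        C * ((1 + \<bar>y\<bar>) * ((1 + \<bar>v\<bar>) * (1 + \<bar>u\<bar>))) * (norm (K u) * norm (L v))"
      by (rule mult_right_mono) simp
    thus "norm (h (y - v - u) * K u * L v) \<le> norm ((C * (1 + \<bar>y\<bar>)) * (((1 + \<bar>v\<bar>) * norm (L v)) * ((1 + \<bar>u\<bar>) * norm (K u))))"
      using C(1) by (simp add: norm_mult abs_mult ac_simps)
  qed
  hence "(LINT u|lborel. LINT v|lborel. h (y - v - u) * K u * L v) = (LINT v|lborel. LINT u|lborel. h (y - v - u) * K u * L v)"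
    by (rule lborel_pair.Fubini_integral[of "\<lambda>v u. h (y - v - u) * K u * L v"])
  moreover have "(LINT u|lborel. LINT v|lborel. h (y - v - u) * K u * L v) = lconv (lconv h L) K y"
  proof -
    have "h (y - v - u) * K u * L v = h (y - u - v) * L v * K u" for u v
      by (simp add: algebra_simps)
    thus ?thesis unfolding lconv_def by (simp only: integral_mult_left_zero)
  qed
  moreover have "(LINT v|lborel. LINT u|lborel. h (y - v - u) * K u * L v) = lconv (lconv h K) L y"
    unfolding lconv_def by (simp flip: integral_mult_left_zero)
  ultimately show ?thesis by simp
qed

lemma bounded_tendstoD:
  assumes "bounded_tendsto h l"
  shows "h \<in> borel_measurable borel" "(h \<longlongrightarrow> l) at_top" "\<exists>C\<ge>0. \<forall>y. norm (h y) \<le> C"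
proof -
  show "h \<in> borel_measurable borel" "(h \<longlongrightarrow> l) at_top"
    using assms by (auto simp: bounded_tendsto_def)
  obtain C where C: "\<And>y. norm (h y) \<le> C" using assms by (auto simp: bounded_tendsto_def)
  moreover have "C \<ge> 0" using norm_ge_zero[of "h 0"] C[of 0] by linarith
  ultimately show "\<exists>C\<ge>0. \<forall>y. norm (h y) \<le> C" by blast
qed

lemma linear_growth_times_bounded:
  assumes "bounded_tendsto h l"
  shows "linear_growth (\<lambda>y. of_real y * h y)"
proof -
  obtain C where C: "C \<ge> 0" "\<And>y. norm (h y) \<le> C" using bounded_tendstoD[OF assms] by auto
  have [measurable]: "h \<in> borel_measurable borel" by (rule bounded_tendstoD[OF assms])
  have "norm (of_real y * h y) \<le> C * (1 + \<bar>y\<bar>)" for y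
  proof -
    have "norm (of_real y * h y) \<le> \<bar>y\<bar> * C"
      using mult_left_mono[OF C(2)[of y], of "\<bar>y\<bar>"] by (simp add: norm_mult)
    also have "\<dots> \<le> C * (1 + \<bar>y\<bar>)" using C(1) by (simp add: algebra_simps)
    finally show ?thesis .
  qed
  thus ?thesis using C(1) unfolding linear_growth_def by (intro conjI exI[of _ C]) auto
qed

lemma bounded_tendsto_add:
  assumes "bounded_tendsto h l" "bounded_tendsto k m"
  shows "bounded_tendsto (\<lambda>y. h y + k y) (l + m)"
proof -
  obtain C D where C: "\<And>y. norm (h y) \<le> C" and D: "\<And>y. norm (k y) \<le> D"
    using assms by (auto simp: bounded_tendsto_def)
  have "norm (h y + k y) \<le> C + D" for y by (rule norm_triangle_mono[OF C D])
  moreover have [measurable]: "h \<in> borel_measurable borel" "k \<in> borel_measurable borel"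
    using assms by (auto simp: bounded_tendsto_def)
  ultimately show ?thesis
    using assms unfolding bounded_tendsto_def by (auto intro!: tendsto_add)
qed

lemma bounded_tendsto_cmult:
  assumes "bounded_tendsto h l"
  shows "bounded_tendsto (\<lambda>y. c * h y) (c * l)"
proof -
  obtain C where C: "\<And>y. norm (h y) \<le> C"
    using assms by (auto simp: bounded_tendsto_def)
  have "norm (c * h y) \<le> norm c * C" for y using mult_left_mono[OF C] by (simp add: norm_mult)
  moreover have [measurable]: "h \<in> borel_measurable borel"
    using assms by (auto simp: bounded_tendsto_def)
  ultimately show ?thesis
    using assms unfolding bounded_tendsto_def by (auto intro!: tendsto_mult_left)
qed

text \<open>The weight \<open>y\<close> splits as \<open>(y - u) + u\<close>, which is where the first moment of the kernel enters.\<close>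

lemma bounded_tendsto_lconv_times:
  assumes E: "bounded_tendsto E 0" and E0: "\<And>y. y < 0 \<Longrightarrow> E y = 0"
    and K: "finite_moment K"
    and lim: "((\<lambda>y. of_real y * lconv E K y) \<longlongrightarrow> 0) at_top"
  shows "bounded_tendsto (lconv (\<lambda>y. of_real y * E y) K) 0"
proof -
  obtain C where C: "C \<ge> 0" "\<And>y. norm (E y) \<le> C" using bounded_tendstoD[OF E] by auto
  have [measurable]: "E \<in> borel_measurable borel" by (rule bounded_tendstoD[OF E])
  have [measurable]: "K \<in> borel_measurable borel" by (rule finite_moment_measurable[OF K])
  have i1: "integrable lborel (\<lambda>u. (1 + \<bar>u\<bar>) * norm (K u))" using K by (simp add: finite_moment_def)
  have iK: "integrable lborel (\<lambda>u. of_real u * K u)"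
    by (rule Bochner_Integration.integrable_bound[OF i1])
       (auto simp: norm_mult intro!: mult_right_mono)
  have iEK: "integrable lborel (\<lambda>u. E (y - u) * K u)" for y
    by (rule linear_growth_integrable[OF bounded_tendsto_imp_linear_growth[OF E] K])
  \<comment> \<open>The correction left by the split: \<open>E\<close> tends to 0 and
    \<open>u * K u\<close> is integrable, so this convolution tends to 0 without any hypothesis on
    \<open>lconv E K\<close>.\<close>
  have T: "bounded_tendsto (lconv E (\<lambda>u. of_real u * K u)) 0"
    using bounded_tendsto_lconv[OF E iK] by simp
  have iEuK: "integrable lborel (\<lambda>u. E (y - u) * (of_real u * K u))" for y
  proof (rule Bochner_Integration.integrable_bound[OF integrable_mult_right[OF integrable_norm[OF iK], of C]])
    show "AE u in lborel. norm (E (y - u) * (of_real u * K u)) \<le> norm (C * norm (of_real u * K u))"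
      using C by (auto simp: norm_mult abs_mult intro!: mult_right_mono)
  qed measurable
  have eq: "lconv (\<lambda>y. of_real y * E y) K y = of_real y * lconv E K y - lconv E (\<lambda>u. of_real u * K u) y" for y
  proof -
    have "(of_real (y - u) * E (y - u)) * K u = of_real y * (E (y - u) * K u) - E (y - u) * (of_real u * K u)" for u
      by (simp add: algebra_simps)
    thus ?thesis unfolding lconv_def
      using iEK[of y] iEuK[of y] by (simp add: Bochner_Integration.integral_diff)
  qed
  have "eventually (\<lambda>y. norm (of_real y * lconv E K y) < 1) at_top"
    using tendsto_norm[OF lim] by (rule order_tendstoD) simp
  then obtain Y0 where Y0: "\<And>y. y \<ge> Y0 \<Longrightarrow> norm (of_real y * lconv E K y) < 1"
    by (auto simp: eventually_at_top_linorder)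
  define Y where "Y = max 1 Y0"
  have iD: "integrable lborel (\<lambda>u. (C * Y) * ((1 + \<bar>u\<bar>) * norm (K u)))"
    by (rule integrable_mult_right[OF i1])
  define D where "D = (LINT u|lborel. (C * Y) * ((1 + \<bar>u\<bar>) * norm (K u)))"
  have "norm (of_real y * lconv E K y) \<le> max 1 D" for y
  proof (cases "y \<ge> Y")
    case True
    thus ?thesis using Y0[of y] by (auto simp: Y_def)
  next
    case False
    \<comment> \<open>This range contains all negative \<open>y\<close>, so |y| itself is unbounded
      here. As \<open>E\<close> vanishes on the negatives, only \<open>u \<le> y\<close>
      contributes, and there |y| is at most \<open>Y * (1 + \<bar>u\<bar>)\<close>, which the first
      moment absorbs.\<close>
    have "norm (of_real y * (E (y - u) * K u)) \<le> (C * Y) * ((1 + \<bar>u\<bar>) * norm (K u))" for u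
    proof (cases "u \<le> y")
      case True
      have "\<bar>y\<bar> \<le> Y * (1 + \<bar>u\<bar>)"
      proof -
        have "Y * \<bar>u\<bar> \<ge> 1 * \<bar>u\<bar>" by (rule mult_right_mono) (auto simp: Y_def)
        moreover have "\<bar>y\<bar> \<le> Y + \<bar>u\<bar>" using True False by (auto simp: Y_def)
        ultimately show ?thesis by (simp add: algebra_simps)
      qed
      hence "\<bar>y\<bar> * (norm (E (y - u)) * norm (K u)) \<le> (Y * (1 + \<bar>u\<bar>)) * (C * norm (K u))"
        using C by (intro mult_mono mult_right_mono) (auto simp: Y_def)
      thus ?thesis by (simp add: norm_mult ac_simps)
    next
      case False
      thus ?thesis using C(1) by (simp add: E0 Y_def)
    qed
    hence "norm (LINT u|lborel. of_real y * (E (y - u) * K u)) \<le> D"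
      unfolding D_def
      by (intro Bochner_Integration.integral_norm_bound_integral integrable_mult_right iEK iD)
    thus ?thesis unfolding lconv_def by (simp del: norm_mult)
  qed
  moreover have "(\<lambda>y. of_real y * lconv E K y) \<in> borel_measurable borel"
    using measurable_lconv[of E K] by measurable
  ultimately have "bounded_tendsto (\<lambda>y. of_real y * lconv E K y) 0"
    using lim by (auto simp: bounded_tendsto_def simp del: norm_mult)
  from bounded_tendsto_add[OF this bounded_tendsto_cmult[OF T, of "-1"]]
  show ?thesis unfolding eq by simp
qed

text \<open>Neither factor of \<open>lconv E p\<close> is integrable; the support condition makes it exist.\<close>

lemma
  assumes E: "bounded_tendsto E 0" and E0: "\<And>y. y < 0 \<Longrightarrow> E y = 0"
    and p: "bounded_tendsto p l" and p0: "\<And>y. y < 0 \<Longrightarrow> p y = 0"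
    and K: "finite_moment K"
  shows lconv_half_line_assoc: "lconv (lconv E p) K y = lconv p (lconv E K) y"
    and linear_growth_lconv_half_line: "linear_growth (lconv E p)"
proof -
  obtain C where C: "C \<ge> 0" "\<And>y. norm (E y) \<le> C" using bounded_tendstoD[OF E] by auto
  obtain D where D: "D \<ge> 0" "\<And>y. norm (p y) \<le> D" using bounded_tendstoD[OF p] by auto
  have [measurable]: "E \<in> borel_measurable borel" by (rule bounded_tendstoD[OF E])
  have [measurable]: "p \<in> borel_measurable borel" by (rule bounded_tendstoD[OF p])
  have [measurable]: "K \<in> borel_measurable borel" by (rule finite_moment_measurable[OF K])
  have iK: "integrable lborel (\<lambda>u. (1 + \<bar>u\<bar>) * norm (K u))" using K by (simp add: finite_moment_def)
  \<comment> \<open>\<open>p\<close> confines the integrand to \<open>u \<ge> 0\<close> and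
    \<open>E\<close> to \<open>u \<le> z\<close>, so the convolution runs over a compact interval.
    With |z| as right end the length is at most 1 + |z| for every \<open>z\<close>; for negative
    \<open>z\<close> the integrand is 0.\<close>
  have b: "norm (E (z - u) * p u) \<le> (C * D) * indicator {0..\<bar>z\<bar>} u" for z u
    using mult_mono[OF C(2)[of "z - u"] D(2)[of u]] C D E0[of "z - u"] p0[of u]
    by (auto simp: norm_mult indicator_def)
  have ib: "integrable lborel (\<lambda>u. (C * D) * indicator {0..\<bar>z\<bar>} u :: real)" for z :: real
    by (intro integrable_mult_right integrable_real_indicator) auto
  have iEp: "integrable lborel (\<lambda>u. E (z - u) * p u)" for z
    by (rule Bochner_Integration.integrable_bound[OF ib[of z]])
       (auto intro!: AE_I2 order_trans[OF b] simp del: norm_mult)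
  have nb: "(LINT u|lborel. norm (E (z - u) * p u)) \<le> (C * D) * (1 + \<bar>z\<bar>)" for z
  proof -
    have "(LINT u|lborel. norm (E (z - u) * p u)) \<le> (LINT u|lborel. (C * D) * indicator {0..\<bar>z\<bar>} u)"
      by (rule Bochner_Integration.integral_mono[OF integrable_norm[OF iEp] ib b])
    also have "\<dots> \<le> (C * D) * (1 + \<bar>z\<bar>)"
      using C D by (simp add: mult_left_mono)
    finally show ?thesis .
  qed
  show "linear_growth (lconv E p)" unfolding linear_growth_def
  proof (intro conjI exI[of _ "C * D"] allI)
    show "norm (lconv E p y) \<le> (C * D) * (1 + \<bar>y\<bar>)" for y
      unfolding lconv_def by (rule order_trans[OF integral_norm_bound nb])
  qed (use C D measurable_lconv[of E p] in auto)
  let ?F = "\<lambda>(v, u). E (y - v - u) * p u * K v"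
  have "integrable (lborel \<Otimes>\<^sub>M lborel) ?F"
  proof (rule lborel_pair.Fubini_integrable)
    show "integrable lborel (\<lambda>v. LINT u|lborel. norm (?F (v, u)))"
    proof (rule Bochner_Integration.integrable_bound[OF integrable_mult_right[OF iK, of "C * D * (1 + \<bar>y\<bar>)"]])
      show "AE v in lborel. norm (LINT u|lborel. norm (?F (v, u))) \<le>
              norm (C * D * (1 + \<bar>y\<bar>) * ((1 + \<bar>v\<bar>) * norm (K v)))"
      proof (intro AE_I2)
        fix v :: real
        have "norm (LINT u|lborel. norm (?F (v, u))) = (LINT u|lborel. norm (?F (v, u)))"
          by (simp add: integral_nonneg_AE)
        also have "\<dots> = (LINT u|lborel. norm (E (y - v - u) * p u)) * norm (K v)"
          by (simp add: norm_mult)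
        also have "\<dots> \<le> (C * D) * (1 + \<bar>y - v\<bar>) * norm (K v)"
          by (intro mult_right_mono nb) auto
        also have "\<dots> \<le> (C * D) * ((1 + \<bar>y\<bar>) * (1 + \<bar>v\<bar>)) * norm (K v)"
          using C D by (intro mult_right_mono mult_left_mono one_plus_abs_diff_le) auto
        also have "\<dots> = C * D * (1 + \<bar>y\<bar>) * ((1 + \<bar>v\<bar>) * norm (K v))" by simp
        also have "\<dots> \<le> norm (C * D * (1 + \<bar>y\<bar>) * ((1 + \<bar>v\<bar>) * norm (K v)))" by simp
        finally show "norm (LINT u|lborel. norm (?F (v, u))) \<le>
              norm (C * D * (1 + \<bar>y\<bar>) * ((1 + \<bar>v\<bar>) * norm (K v)))" .
      qed
    qed measurable
    show "AE v in lborel. integrable lborel (\<lambda>u. ?F (v, u))"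
      using iEp by (auto intro!: AE_I2)
  qed measurable
  hence "(LINT u|lborel. LINT v|lborel. E (y - v - u) * p u * K v) = (LINT v|lborel. LINT u|lborel. E (y - v - u) * p u * K v)"
    by (rule lborel_pair.Fubini_integral[of "\<lambda>v u. E (y - v - u) * p u * K v"])
  moreover have "(LINT v|lborel. LINT u|lborel. E (y - v - u) * p u * K v) = lconv (lconv E p) K y"
    unfolding lconv_def by (simp flip: integral_mult_left_zero)
  moreover have "(LINT u|lborel. LINT v|lborel. E (y - v - u) * p u * K v) = lconv p (lconv E K) y"
  proof -
    have "(LINT u|lborel. LINT v|lborel. E (y - v - u) * p u * K v) = (LINT u|lborel. p u * lconv E K (y - u))"
    proof (rule Bochner_Integration.integral_cong[OF refl])
      fix u
      have "E (y - v - u) * p u * K v = p u * (E (y - u - v) * K v)" for v by (simp add: algebra_simps)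
      thus "(LINT v|lborel. E (y - v - u) * p u * K v) = p u * lconv E K (y - u)"
        unfolding lconv_def by (simp only: integral_mult_right_zero)
    qed
    also have "\<dots> = (LINT u|lborel. p (y - u) * lconv E K u)"
      using lborel_integral_real_affine[of "-1" "\<lambda>u. p u * lconv E K (y - u)" y] by simp
    finally show ?thesis unfolding lconv_def[of p] .
  qed
  ultimately show "lconv (lconv E p) K y = lconv p (lconv E K) y" by simp
qed

section \<open>The averaged identity\<close>

text \<open>The box is half-open so that 0 \<le> w - v < 1 means that v lies in (w - 1, w]; the
  measure of that set is exactly an increment of the distribution function, atoms included.\<close>

lemma lconv_measure_box:
  fixes \<mu> :: "real \<Rightarrow> real"
  assumes sets_m[measurable_cong]: "sets m = sets borel"
    and m: "\<And>y. emeasure m {..y} = ennreal (\<mu> y)"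
    and \<mu>0: "\<And>y. \<mu> y \<ge> 0"
    and E: "bounded_tendsto E 0" and E0: "\<And>y. y < 0 \<Longrightarrow> E y = 0"
  shows "lconv (\<lambda>y. LINT v|m. E (y - v)) (indicator {0..<1}) y =
         lconv E (\<lambda>w. of_real (\<mu> w - \<mu> (w - 1))) y"
proof -
  obtain C where C: "C \<ge> 0" "\<And>y. norm (E y) \<le> C" using bounded_tendstoD[OF E] by auto
  have [measurable]: "E \<in> borel_measurable borel" by (rule bounded_tendstoD[OF E])
  interpret m: sigma_finite_measure m
  proof
    show "\<exists>A. countable A \<and> A \<subseteq> sets m \<and> \<Union> A = space m \<and> (\<forall>a\<in>A. emeasure m a \<noteq> \<infinity>)"
      by (intro exI[of _ "range (\<lambda>n::nat. {..real n})"])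
         (use real_arch_simple sets_eq_imp_space_eq[OF sets_m] in \<open>auto simp: m sets_m\<close>)
  qed
  interpret ml: pair_sigma_finite m lborel ..
  let ?\<phi> = "indicator {0..<1} :: real \<Rightarrow> complex"
  let ?F = "\<lambda>v t. E (y - t - v) * ?\<phi> t"
  let ?G = "\<lambda>v w. E (y - w) * ?\<phi> (w - v)"
  \<comment> \<open>The translation \<open>w = t + v\<close>, stated for arbitrary \<open>f\<close>
    because it is needed for the integral and for the integral of the norm.\<close>
  have sh: "(LINT t|lborel. f (?F v t)) = (LINT w|lborel. f (?G v w))" for v and f :: "complex \<Rightarrow> 'b::{banach,second_countable_topology}"
    using lborel_integral_real_affine[of 1 "\<lambda>t. f (?F v t)" "-v"] by (simp add: diff_diff_eq2 add.commute)
  have mfin: "emeasure m {..y} < \<infinity>" by (simp add: m)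
  have iC: "integrable m (\<lambda>v. C * indicator {..y} v :: real)"
    using mfin by (intro integrable_mult_right integrable_real_indicator) (auto simp: sets_m)
  \<comment> \<open>As \<open>t \<ge> 0\<close>, a non-zero \<open>E (y - t - v)\<close> forces
    \<open>v \<le> y\<close>, a set of finite measure; this justifies both applications of
    Fubini.\<close>
  have bF: "norm (?F v t) \<le> C * indicator {0..<1} t * indicator {..y} v" for v t
    using C E0[of "y - t - v"] by (auto simp: indicator_def norm_mult)
  have iFt: "integrable lborel (?F v)" for v
    by (rule Bochner_Integration.integrable_bound[of lborel "\<lambda>t. C * indicator {0..<1} t"])
       (use C in \<open>auto simp: norm_mult abs_mult intro!: AE_I2 integrable_mult_right integrable_real_indicator mult_mono split: split_indicator\<close>)
  have ib: "integrable lborel (\<lambda>t :: real. C * indicator {0..<1} t * indicator {..y} v :: real)" for v :: real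
    by (intro integrable_mult_left integrable_mult_right integrable_real_indicator) auto
  have nF: "(LINT t|lborel. norm (?F v t)) \<le> C * indicator {..y} v" for v
  proof -
    have "(LINT t|lborel. norm (?F v t)) \<le> (LINT t|lborel. C * indicator {0..<1::real} t * indicator {..y} v)"
      by (intro Bochner_Integration.integral_mono integrable_norm iFt ib bF)
    also have "\<dots> = C * indicator {..y} v" by simp
    finally show ?thesis .
  qed
  have "integrable (m \<Otimes>\<^sub>M lborel) (\<lambda>(v, t). ?F v t)"
  proof (rule ml.Fubini_integrable)
    show "integrable m (\<lambda>v. LINT t|lborel. norm ((\<lambda>(v, t). ?F v t) (v, t)))"
    proof (rule Bochner_Integration.integrable_bound[OF iC])
      show "AE v in m. norm (LINT t|lborel. norm ((\<lambda>(v, t). ?F v t) (v, t))) \<le> norm (C * indicator {..y} v :: real)"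
        using nF C by (intro AE_I2) (simp add: integral_nonneg_AE abs_mult)
    qed measurable
    show "AE v in m. integrable lborel (\<lambda>t. (\<lambda>(v, t). ?F v t) (v, t))" using iFt by simp
  qed measurable
  hence "(LINT t|lborel. LINT v|m. ?F v t) = (LINT v|m. LINT t|lborel. ?F v t)"
    by (rule ml.Fubini_integral)
  also have "\<dots> = (LINT v|m. LINT w|lborel. ?G v w)" by (simp only: sh[of "\<lambda>x. x"])
  also have "\<dots> = (LINT w|lborel. LINT v|m. ?G v w)"
  proof (rule ml.Fubini_integral[symmetric], rule ml.Fubini_integrable)
    show "integrable m (\<lambda>v. LINT t|lborel. norm ((\<lambda>(v, t). ?G v t) (v, t)))"
    proof (rule Bochner_Integration.integrable_bound[OF iC])
      show "AE v in m. norm (LINT t|lborel. norm ((\<lambda>(v, t). ?G v t) (v, t))) \<le> norm (C * indicator {..y} v :: real)"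
        using nF C unfolding sh[of norm] by (intro AE_I2) (simp add: integral_nonneg_AE abs_mult)
    qed measurable
    have "integrable lborel (?G v)" for v
      using lborel_integrable_real_affine[OF iFt[of v], of 1 "-v"] by (simp add: diff_diff_eq2 add.commute)
    thus "AE v in m. integrable lborel (\<lambda>w. (\<lambda>(v, t). ?G v t) (v, w))" by simp
  qed measurable
  also have "(\<lambda>w. LINT v|m. ?G v w) = (\<lambda>w. E (y - w) * of_real (\<mu> w - \<mu> (w - 1)))"
  proof
    fix w
    have "measure m {w - 1<..w} = \<mu> w - \<mu> (w - 1)"
    proof -
      have "{w - 1<..w} = {..w} - {..w - 1}" by auto
      thus ?thesis using m[of w] m[of "w - 1"] \<mu>0
        by (subst \<open>{w - 1<..w} = _\<close>, subst measure_Diff) (auto simp: sets_m measure_def)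
    qed
    moreover have "(LINT v|m. ?\<phi> (w - v)) = of_real (measure m {w - 1<..w})"
    proof -
      have fin: "emeasure m {w - 1<..w} < \<infinity>"
      proof -
        have "emeasure m {w - 1<..w} \<le> emeasure m {..w}" by (rule emeasure_mono) (auto simp: sets_m)
        also have "\<dots> < \<infinity>" by (simp add: m)
        finally show ?thesis .
      qed
      have "?\<phi> (w - v) = of_real (indicator {w - 1<..w} v)" for v by (auto simp: indicator_def)
      hence "(LINT v|m. ?\<phi> (w - v)) = of_real (LINT v|m. indicator {w - 1<..w} v)" by simp
      also have "(LINT v|m. indicator {w - 1<..w} v) = measure m {w - 1<..w}"
        by (simp add: sets_eq_imp_space_eq[OF sets_m])
      finally show ?thesis .
    qed
    ultimately show "(LINT v|m. ?G v w) = E (y - w) * of_real (\<mu> w - \<mu> (w - 1))" by simp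
  qed
  finally show ?thesis unfolding lconv_def by simp
qed

lemma box_kernel:
  shows finite_moment_box: "finite_moment (indicator {0..<1})"
    and integral_box: "(LINT u|lborel. indicator {0..<1 :: real} u) = (1::complex)"
proof -
  have "integrable lborel (\<lambda>u :: real. 2 * indicator {0..<1} u :: real)"
    by (intro integrable_mult_right integrable_real_indicator) auto
  hence "integrable lborel (\<lambda>u. (1 + \<bar>u\<bar>) * norm (indicator {0..<1} u :: complex))"
    by (rule Bochner_Integration.integrable_bound) (auto simp: indicator_def)
  thus "finite_moment (indicator {0..<1})" by (simp add: finite_moment_def)
  have "(LINT u|lborel. indicator {0..<1 :: real} u) = complex_of_real (LINT u|lborel. indicator {0..<1 :: real} u)"
    by (simp only: integral_complex_of_real[symmetric] of_real_indicator)
  thus "(LINT u|lborel. indicator {0..<1 :: real} u) = (1::complex)" by simp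
qed

text \<open>The average of \<open>f\<close> by the box, \<open>L\<close> and \<open>K\<close> is
  computed twice. On the side of \<open>f\<close>, each averaging multiplies by the integral of its
  kernel up to an error tending to 0. On the side of the identity, \<open>K\<close> sends
  \<open>y * E y\<close> to 0, and the measure term tends to the integral of
  \<open>lconv E L\<close> times that of \<open>K\<close>. The factor coming from \<open>K\<close>
  is common to both sides and cancels.\<close>

lemma averaged_identity_limit:
  fixes \<mu> :: "real \<Rightarrow> real"
  assumes sets_m[measurable_cong]: "sets m = sets borel"
    and m: "\<And>y. emeasure m {..y} = ennreal (\<mu> y)"
    and \<mu>0: "\<And>y. \<mu> y \<ge> 0" and \<mu>neg: "\<And>y. y < 0 \<Longrightarrow> \<mu> y = 0"
    and \<mu>C: "\<And>y u. \<bar>\<mu> y - \<mu> (y - u)\<bar> \<le> C\<^sub>0 * (1 + \<bar>u\<bar>)"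
    and \<mu>lim: "\<And>u. ((\<lambda>y. \<mu> y - \<mu> (y - u)) \<longlongrightarrow> u) at_top"
    and E: "bounded_tendsto E 0" and E0: "\<And>y. y < 0 \<Longrightarrow> E y = 0"
    and K: "finite_moment K" "finite_moment L" "(LINT u|lborel. K u) \<noteq> 0" "(LINT u|lborel. L u) \<noteq> 0"
    and EK: "((\<lambda>y. of_real y * lconv E K y) \<longlongrightarrow> 0) at_top"
    and EL: "integrable lborel (lconv E L)"
    and R: "bounded_tendsto R 0" and R0: "\<And>y. y < 0 \<Longrightarrow> R y = 0"
    and id: "\<And>y. y \<ge> 0 \<Longrightarrow> of_real (a * (\<mu> y - y + 1)) = of_real y * E y - (LINT v|m. E (y - v)) + R y"
  shows "((\<lambda>y. complex_of_real (a * (\<mu> y - y + 1))) \<longlongrightarrow> 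
            - ((LINT y|lborel. lconv E L y) / (LINT u|lborel. L u))) at_top"
proof -
  let ?\<phi> = "indicator {0..<1} :: real \<Rightarrow> complex"
  let ?k = "LINT u|lborel. K u" and ?l = "LINT u|lborel. L u" and ?B = "LINT y|lborel. lconv E L y"
  have \<phi>: "finite_moment ?\<phi>" by (rule finite_moment_box)
  obtain C where C: "C \<ge> 0" "\<And>y. norm (E y) \<le> C" using bounded_tendstoD[OF E] by auto
  have Em[measurable]: "E \<in> borel_measurable borel" by (rule bounded_tendstoD[OF E])
  have C0: "C\<^sub>0 \<ge> 0" using \<mu>C[of 0 0] by simp
  have sp[simp]: "space m = UNIV" using sets_eq_imp_space_eq[OF sets_m] by simp
  interpret m: sigma_finite_measure m
  proof
    show "\<exists>A. countable A \<and> A \<subseteq> sets m \<and> \<Union> A = space m \<and> (\<forall>a\<in>A. emeasure m a \<noteq> \<infinity>)"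
      by (intro exI[of _ "range (\<lambda>n::nat. {..real n})"])
         (use real_arch_simple in \<open>auto simp: m sets_m\<close>)
  qed
  have "mono \<mu>"
  proof
    fix x y :: real assume "x \<le> y"
    hence "emeasure m {..x} \<le> emeasure m {..y}" by (intro emeasure_mono) (auto simp: sets_m)
    thus "\<mu> x \<le> \<mu> y" by (simp add: m \<mu>0)
  qed
  hence [measurable]: "\<mu> \<in> borel_measurable borel" by (rule borel_measurable_mono)
  \<comment> \<open>The cut-off at 0 makes the identity hold on the whole line, as convolution
    requires: for negative \<open>y\<close> every term on the right vanishes.\<close>
  define f where "f y = (if y \<ge> 0 then complex_of_real (a * (\<mu> y - y + 1)) else 0)" for y
  define Em where "Em y = (LINT v|m. E (y - v))" for y
  define p where "p w = complex_of_real (\<mu> w - \<mu> (w - 1))" for w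
  have [measurable]: "f \<in> borel_measurable borel" "Em \<in> borel_measurable borel" "p \<in> borel_measurable borel"
    unfolding f_def Em_def p_def by measurable
  have iE: "integrable m (\<lambda>v. E (y - v))"
    and nE: "norm (Em y) \<le> C * \<mu> y" for y
  proof -
    have i: "integrable m (\<lambda>v. C * indicator {..y} v :: real)"
      by (intro integrable_mult_right integrable_real_indicator) (auto simp: sets_m m)
    have b: "norm (E (y - v)) \<le> C * indicator {..y} v" for v
      using C E0[of "y - v"] by (auto simp: indicator_def)
    show *: "integrable m (\<lambda>v. E (y - v))"
      by (rule Bochner_Integration.integrable_bound[OF i]) (use b C in \<open>auto simp: abs_mult\<close>)
    have "norm (Em y) \<le> (LINT v|m. C * indicator {..y} v)"
      unfolding Em_def by (rule Bochner_Integration.integral_norm_bound_integral[OF * i b])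
    also have "\<dots> = C * \<mu> y" by (simp add: measure_def m \<mu>0)
    finally show "norm (Em y) \<le> C * \<mu> y" .
  qed
  have Emneg: "Em y = 0" if "y < 0" for y using nE[of y] \<mu>neg[OF that] by simp
  have \<mu>lg: "\<mu> y \<le> 2 * C\<^sub>0 * (1 + \<bar>y\<bar>)" for y
  proof -
    \<comment> \<open>The second point is -1, to the left of the support, so the increment bound
      becomes a growth bound.\<close>
    have "\<mu> y = \<mu> y - \<mu> (y - (y + 1))" by (simp add: \<mu>neg)
    also have "\<dots> \<le> C\<^sub>0 * (1 + \<bar>y + 1\<bar>)" using \<mu>C[of y "y + 1"] by linarith
    also have "\<dots> \<le> C\<^sub>0 * (2 * (1 + \<bar>y\<bar>))" by (intro mult_left_mono C0) (simp add: abs_if)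
    finally show ?thesis by (simp add: algebra_simps)
  qed
  have lgEm: "linear_growth Em"
    unfolding linear_growth_def
  proof (intro conjI exI[of _ "C * (2 * C\<^sub>0)"] allI)
    show "norm (Em y) \<le> C * (2 * C\<^sub>0) * (1 + \<bar>y\<bar>)" for y
      using order_trans[OF nE mult_left_mono[OF \<mu>lg[of y] C(1)]] by (simp add: mult.assoc)
  qed (use C C0 in auto)
  have f_eq: "f y = of_real y * E y - Em y + R y" for y
    using id[of y] Emneg[of y] R0[of y] E0[of y] by (auto simp: f_def Em_def)
  have lg1: "linear_growth (\<lambda>y. of_real y * E y)" by (rule linear_growth_times_bounded[OF E])
  have lgR: "linear_growth R" by (rule bounded_tendsto_imp_linear_growth[OF R])
  have lgf: "linear_growth f"
    using linear_growth_add[OF linear_growth_diff[OF lg1 lgEm] lgR] unfolding f_eq[symmetric] .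

  \<comment> \<open>The extra 2 pays for the linear term and for the summand 1, which survives when
    the cut-off at 0 falls between the two arguments.\<close>
  have f_slow: "norm (f y - f (y - u)) \<le> (\<bar>a\<bar> * (C\<^sub>0 + 2)) * (1 + \<bar>u\<bar>)" for y u
  proof -
    define r where "r = C\<^sub>0 * (1 + \<bar>u\<bar>)"
    have r: "\<bar>\<mu> y - \<mu> (y - u)\<bar> \<le> r" unfolding r_def by (rule \<mu>C)
    have r0: "r \<ge> 0" using C0 by (simp add: r_def)
    define s where "s z = (if z \<ge> 0 then \<mu> z - z + 1 else 0)" for z
    have "\<bar>s y - s (y - u)\<bar> \<le> r + 2 * (1 + \<bar>u\<bar>)"
      using r \<mu>neg[of y] \<mu>neg[of "y - u"] r0 by (auto simp: s_def abs_if split: if_splits)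
    hence "\<bar>a\<bar> * \<bar>s y - s (y - u)\<bar> \<le> \<bar>a\<bar> * ((C\<^sub>0 + 2) * (1 + \<bar>u\<bar>))"
      by (intro mult_left_mono) (auto simp: r_def algebra_simps)
    moreover have "f y - f (y - u) = of_real (a * (s y - s (y - u)))"
      by (auto simp: f_def s_def algebra_simps)
    ultimately show ?thesis by (simp only: norm_of_real abs_mult mult.assoc)
  qed
  \<comment> \<open>The increments of \<mu> tend to \<open>u\<close>, and the linear term
    \<open>- y\<close> cancels exactly that.\<close>
  have f_lim: "((\<lambda>y. f y - f (y - u)) \<longlongrightarrow> 0) at_top" for u
  proof -
    have "((\<lambda>y. complex_of_real (a * ((\<mu> y - \<mu> (y - u)) - u))) \<longlongrightarrow> of_real (a * (u - u))) at_top"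
      by (intro tendsto_intros \<mu>lim)
    moreover have "eventually (\<lambda>y. complex_of_real (a * ((\<mu> y - \<mu> (y - u)) - u)) = f y - f (y - u)) at_top"
      using eventually_ge_at_top[of "max 0 u"] by eventually_elim (auto simp: f_def algebra_simps)
    ultimately show ?thesis by (simp add: filterlim_cong)
  qed
  have slow: "bounded_tendsto (\<lambda>y. lconv f H y - (LINT u|lborel. H u) * f y) 0" if "finite_moment H" for H
    by (rule bounded_tendsto_slow_lconv[OF _ f_slow f_lim that]) measurable
  define d1 where "d1 y = lconv f ?\<phi> y - f y" for y
  define d2 where "d2 y = lconv f L y - ?l * f y" for y
  define d3 where "d3 y = lconv f K y - ?k * f y" for y
  have d1: "bounded_tendsto d1 0" using slow[OF \<phi>] unfolding d1_def integral_box by simp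
  have d2: "bounded_tendsto d2 0" using slow[OF K(2)] unfolding d2_def .
  have d3: "bounded_tendsto d3 0" using slow[OF K(1)] unfolding d3_def .
  note lg = bounded_tendsto_imp_linear_growth
  note iL = finite_moment_integrable[OF K(2)] and iK = finite_moment_integrable[OF K(1)]
  \<comment> \<open>The kernels are peeled off one at a time; each leaves an error that the
    remaining convolutions keep in the class of bounded functions tending to 0.\<close>
  have 1: "lconv (lconv (lconv f ?\<phi>) L) K y = lconv (lconv d1 L) K y + lconv d2 K y + ?l * d3 y + ?l * ?k * f y" for y
  proof -
    have e: "lconv f ?\<phi> = (\<lambda>y. d1 y + f y)" by (simp add: d1_def)
    have "lconv (lconv f ?\<phi>) L = (\<lambda>y. lconv d1 L y + lconv f L y)"
      unfolding e by (rule ext) (rule lconv_add[OF lg[OF d1] lgf K(2)])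
    also have "\<dots> = (\<lambda>y. lconv d1 L y + (d2 y + ?l * f y))" by (simp add: d2_def)
    finally have "lconv (lconv (lconv f ?\<phi>) L) K y = lconv (\<lambda>y. lconv d1 L y + (d2 y + ?l * f y)) K y" by simp
    also have "\<dots> = lconv (lconv d1 L) K y + lconv (\<lambda>y. d2 y + ?l * f y) K y"
      by (rule lconv_add[OF linear_growth_lconv[OF lg[OF d1] K(2)]
          linear_growth_add[OF lg[OF d2] linear_growth_cmult[OF lgf]] K(1)])
    also have "lconv (\<lambda>y. d2 y + ?l * f y) K y = lconv d2 K y + lconv (\<lambda>y. ?l * f y) K y"
      by (rule lconv_add[OF lg[OF d2] linear_growth_cmult[OF lgf] K(1)])
    also have "lconv (\<lambda>y. ?l * f y) K y = ?l * (d3 y + ?k * f y)"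
      unfolding lconv_cmult by (simp add: d3_def)
    finally show ?thesis by (simp add: algebra_simps)
  qed

  have "((\<lambda>w. complex_of_real (\<mu> w - \<mu> (w - 1))) \<longlongrightarrow> of_real 1) at_top"
    by (intro tendsto_of_real \<mu>lim)
  moreover have "norm (p w) \<le> C\<^sub>0 * 2" for w
    using \<mu>C[of w 1] by (simp only: p_def norm_of_real) simp
  ultimately have p: "bounded_tendsto p 1"
    unfolding bounded_tendsto_def p_def[symmetric] by auto
  have pneg: "p y = 0" if "y < 0" for y using that by (simp add: p_def \<mu>neg)
  \<comment> \<open>Here the measure is traded for the bounded function \<open>p\<close>, which
    tends to 1; after that \<open>E\<close> can be regrouped with \<open>L\<close>.\<close>
  have Emp: "lconv Em ?\<phi> = lconv E p"
    unfolding Em_def[abs_def] p_def[abs_def] by (rule ext, rule lconv_measure_box[OF sets_m m \<mu>0 E E0])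
  define g where "g = lconv (\<lambda>y. of_real y * E y) K"
  have g: "bounded_tendsto g 0" unfolding g_def by (rule bounded_tendsto_lconv_times[OF E E0 K(1) EK])
  have 2: "lconv (lconv (lconv f ?\<phi>) L) K y =
     lconv (lconv g ?\<phi>) L y - lconv (lconv p (lconv E L)) K y + lconv (lconv (lconv R ?\<phi>) L) K y" for y
  proof -
    let ?h = "\<lambda>y. of_real y * E y :: complex"
    let ?A = "lconv ?h ?\<phi>" and ?R = "lconv R ?\<phi>"
    note lgA = linear_growth_lconv[OF lg1 \<phi>] and lgE = linear_growth_lconv_half_line[OF E E0 p pneg K(2)]
      and lgR' = linear_growth_lconv[OF lgR \<phi>]
    have e1: "lconv f ?\<phi> = (\<lambda>y. ?A y - lconv E p y + ?R y)"
    proof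
      fix y
      have "lconv f ?\<phi> y = lconv (\<lambda>y. ?h y - Em y + R y) ?\<phi> y" unfolding f_eq[symmetric] ..
      also have "\<dots> = lconv (\<lambda>y. ?h y - Em y) ?\<phi> y + ?R y"
        by (rule lconv_add[OF linear_growth_diff[OF lg1 lgEm] lgR \<phi>])
      also have "lconv (\<lambda>y. ?h y - Em y) ?\<phi> y = ?A y - lconv Em ?\<phi> y"
        by (rule lconv_diff[OF lg1 lgEm \<phi>])
      finally show "lconv f ?\<phi> y = ?A y - lconv E p y + ?R y" unfolding Emp .
    qed
    have e2: "lconv (lconv f ?\<phi>) L = (\<lambda>y. lconv ?A L y - lconv p (lconv E L) y + lconv ?R L y)"
    proof
      fix y
      have "lconv (lconv f ?\<phi>) L y = lconv (\<lambda>y. ?A y - lconv E p y) L y + lconv ?R L y"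
        unfolding e1 by (rule lconv_add[OF linear_growth_diff[OF lgA lgE] lgR' K(2)])
      also have "lconv (\<lambda>y. ?A y - lconv E p y) L y = lconv ?A L y - lconv (lconv E p) L y"
        by (rule lconv_diff[OF lgA lgE K(2)])
      also have "lconv (lconv E p) L y = lconv p (lconv E L) y"
        by (rule lconv_half_line_assoc[OF E E0 p pneg K(2)])
      finally show "lconv (lconv f ?\<phi>) L y = lconv ?A L y - lconv p (lconv E L) y + lconv ?R L y"
        .
    qed
    note lg2 = linear_growth_lconv[OF lgA K(2)] lg[OF bounded_tendsto_lconv[OF p EL]]
    have "lconv (lconv (lconv f ?\<phi>) L) K y = 
        lconv (\<lambda>y. lconv ?A L y - lconv p (lconv E L) y) K y + lconv (lconv ?R L) K y"
      unfolding e2 by (rule lconv_add[OF linear_growth_diff[OF lg2] linear_growth_lconv[OF lgR' K(2)] K(1)])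
    also have "lconv (\<lambda>y. lconv ?A L y - lconv p (lconv E L) y) K y = lconv (lconv ?A L) K y - lconv (lconv p (lconv E L)) K y"
      by (rule lconv_diff[OF lg2 K(1)])
    \<comment> \<open>\<open>K\<close> was applied last; two exchanges bring it next to
      \<open>y * E y\<close>, where its hypothesis applies.\<close>
    also have "lconv (lconv (lconv ?h ?\<phi>) L) K y = lconv (lconv (lconv ?h ?\<phi>) K) L y"
      by (rule lconv_commute[OF linear_growth_lconv[OF lg1 \<phi>] K(2) K(1)])
    also have "lconv (lconv ?h ?\<phi>) K = lconv g ?\<phi>"
      unfolding g_def by (rule ext) (rule lconv_commute[OF lg1 \<phi> K(1)])
    finally show ?thesis .
  qed

  note i\<phi> = finite_moment_integrable[OF \<phi>]
  note lim = bounded_tendstoD(2)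
  \<comment> \<open>Equating the two evaluations isolates \<open>?l * ?k * f y\<close>. Only the
    term with \<open>p\<close> may have a non-zero limit, namely \<open>?B * ?k\<close>.\<close>
  have "((\<lambda>y. lconv (lconv g ?\<phi>) L y - lconv (lconv p (lconv E L)) K y + lconv (lconv (lconv R ?\<phi>) L) K y
      - lconv (lconv d1 L) K y - lconv d2 K y - ?l * d3 y) \<longlongrightarrow>
      0 * (LINT u|lborel. ?\<phi> u) * ?l - 1 * ?B * ?k + 0 * (LINT u|lborel. ?\<phi> u) * ?l * ?k - 0 * ?l * ?k - 0 * ?k - ?l * 0) at_top"
    by (intro tendsto_diff tendsto_add tendsto_mult_left lim[OF d3]
        lim[OF bounded_tendsto_lconv[OF bounded_tendsto_lconv[OF g i\<phi>] iL]]
        lim[OF bounded_tendsto_lconv[OF bounded_tendsto_lconv[OF p EL] iK]]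
        lim[OF bounded_tendsto_lconv[OF bounded_tendsto_lconv[OF bounded_tendsto_lconv[OF R i\<phi>] iL] iK]]
        lim[OF bounded_tendsto_lconv[OF bounded_tendsto_lconv[OF d1 iL] iK]]
        lim[OF bounded_tendsto_lconv[OF d2 iK]])
  moreover have "lconv (lconv g ?\<phi>) L y - lconv (lconv p (lconv E L)) K y + lconv (lconv (lconv R ?\<phi>) L) K y
      - lconv (lconv d1 L) K y - lconv d2 K y - ?l * d3 y = ?l * ?k * f y" for y
    unfolding 2[symmetric] 1 by simp
  ultimately have "((\<lambda>y. ?l * ?k * f y) \<longlongrightarrow> - (?B * ?k)) at_top" by simp
  from tendsto_divide[OF this tendsto_const, of "?l * ?k"] have "(f \<longlongrightarrow> - (?B / ?l)) at_top"
    using K by simp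
  moreover have "eventually (\<lambda>y. f y = complex_of_real (a * (\<mu> y - y + 1))) at_top"
    using eventually_ge_at_top[of 0] by eventually_elim (simp add: f_def)
  ultimately show ?thesis by (rule Lim_transform_eventually)
qed

section \<open>Slow variation\<close>

lemma set_integrable_const_bounded:
  fixes c :: real and A :: "real set"
  assumes "A \<in> sets borel" "bounded A"
  shows "set_integrable lborel A (\<lambda>_. c)"
  unfolding set_integrable_def using emeasure_bounded_finite[OF assms(2)] assms(1)
  by (auto intro!: integrable_real_indicator)

text \<open>With \<open>H = N \<circ> exp\<close> and x = exp y, \<open>G\<close> is N(x)/x and
  \<open>I\<close> is the integral of N(t)/t^2 over [1, x]. As a primitive of \<open>G\<close> the
  function \<open>I\<close> is monotone and continuous, so regularity is established for
  \<open>I\<close> first and then passed to \<open>G\<close>.\<close>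

locale exp_density =
  fixes H G I :: "real \<Rightarrow> real"
  assumes mono_H: "mono H" and H_neg: "\<And>y. y < 0 \<Longrightarrow> H y = 0" and H_pos: "\<And>y. y \<ge> 0 \<Longrightarrow> H y > 0"
  defines "G \<equiv> \<lambda>y. exp (- y) * H y"
  defines "I \<equiv> \<lambda>y. LINT u:{0..y}|lborel. G u"
begin

lemma H_nonneg: "H y \<ge> 0"
  using H_neg[of y] H_pos[of y] by (cases "y < 0") auto

lemma measurable_G [measurable]: "G \<in> borel_measurable borel"
  using borel_measurable_mono[OF mono_H] unfolding G_def by measurable

lemma G_nonneg: "G y \<ge> 0" and G_pos: "y \<ge> 0 \<Longrightarrow> G y > 0" and G_neg: "y < 0 \<Longrightarrow> G y = 0"
  using H_nonneg H_pos H_neg by (auto simp: G_def)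

lemma G_le_H:
  assumes "y \<le> z" 
  shows "G y \<le> H z"
proof (cases "y < 0")
  case True thus ?thesis using G_neg H_nonneg by simp
next
  case False
  have "exp (- y) * H y \<le> 1 * H z" using False assms mono_H H_nonneg
    by (intro mult_mono) (auto simp: monoD)
  thus ?thesis by (simp add: G_def)
qed

lemma G_set_integrable: 
  assumes "A \<in> sets borel" "A \<subseteq> {y..z}"
  shows "set_integrable lborel A G"
proof -
  have "set_integrable lborel {y..z} G"
    unfolding set_integrable_def
  proof (rule Bochner_Integration.integrable_bound)
    show "integrable lborel (\<lambda>u. indicator {y..z} u *\<^sub>R H z)"
      using set_integrable_const_bounded[of "{y..z}" "H z"] by (simp add: set_integrable_def)
  qed (use G_le_H G_nonneg H_nonneg in \<open>auto simp: indicator_def\<close>)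
  thus ?thesis using assms by (rule_tac set_integrable_subset) auto
qed

lemma I_diff:
  assumes "0 \<le> y" "y \<le> z"
  shows "I z - I y = (LINT u:{y<..z}|lborel. G u)"
proof -
  have "{0..z} = {0..y} \<union> {y<..z}" using assms by auto
  hence "I z = (LINT u:{0..y}|lborel. G u) + (LINT u:{y<..z}|lborel. G u)"
    unfolding I_def
    by (simp, intro set_integral_Un G_set_integrable[of _ 0 z]) (use assms in auto)
  thus ?thesis by (simp add: I_def)
qed

lemma I_mono:
  assumes "0 \<le> y" "y \<le> z"
  shows "I y \<le> I z"
proof -
  have "0 \<le> (LINT u:{y<..z}|lborel. G u)"
    unfolding set_lebesgue_integral_def using G_nonneg by (intro integral_nonneg_AE) auto
  thus ?thesis using I_diff[OF assms] by simp
qed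

lemma I_pos:
  assumes "y > 0"
  shows "I y > 0"
proof -
  have "0 < y * (exp (- y) * H 0)" using assms H_pos[of 0] by simp
  also have "\<dots> = (LINT u:{0..y}|lborel. exp (- y) * H 0)" using assms by (simp add: set_lebesgue_integral_def)
  also have "\<dots> \<le> I y" unfolding I_def
  proof (rule set_integral_mono)
    show "set_integrable lborel {0..y} G" by (rule G_set_integrable) auto
    show "set_integrable lborel {0..y} (\<lambda>u. exp (- y) * H 0)"
      by (rule set_integrable_const_bounded) auto
    show "exp (- y) * H 0 \<le> G u" if "u \<in> {0..y}" for u
      unfolding G_def using that monoD[OF mono_H, of 0 u] H_nonneg by (intro mult_mono) auto
  qed
  finally show ?thesis .
qed

lemma I_increment:
  assumes "0 < Y" "Y \<le> y" "y \<le> z" and ub: "\<And>u. u \<ge> Y \<Longrightarrow> u * G u \<le> 2 * I u"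
  shows "I z - I y \<le> 2 * (z - y) * I z / y"
proof -
  have "I z - I y = (LINT u:{y<..z}|lborel. G u)" using assms by (intro I_diff) auto
  also have "\<dots> \<le> (LINT u:{y<..z}|lborel. 2 * I z / y)"
  proof (rule set_integral_mono)
    show "set_integrable lborel {y<..z} G" by (rule G_set_integrable[of _ y z]) auto
    show "set_integrable lborel {y<..z} (\<lambda>u. 2 * I z / y)"
      by (rule set_integrable_const_bounded) (auto intro: bounded_subset[of "{y..z}"])
    show "G u \<le> 2 * I z / y" if "u \<in> {y<..z}" for u
    proof -
      have "y * G u \<le> u * G u" using that G_nonneg by (intro mult_right_mono) auto
      also have "\<dots> \<le> 2 * I u" using that assms by (intro ub) auto
      also have "\<dots> \<le> 2 * I z" using that assms I_mono[of u z] by auto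
      finally show ?thesis using assms by (simp add: field_simps)
    qed
  qed
  also have "\<dots> = 2 * (z - y) * I z / y" using assms by (simp add: set_lebesgue_integral_def)
  finally show ?thesis .
qed

text \<open>A discrete Gronwall argument: a unit step gives I(z + 1) \<le> z / (z - 2) * I(z), and
  the product of these factors telescopes to (y + n - 1)(y + n - 2) / ((y - 1)(y - 2)).
  \<open>Y \<ge> 4\<close> keeps the denominators positive.\<close>

lemma I_growth_nat:
  assumes Y: "Y \<ge> 4" "Y \<le> y" and ub: "\<And>u. u \<ge> Y \<Longrightarrow> u * G u \<le> 2 * I u"
  shows "I (y + real n) * ((y - 1) * (y - 2)) \<le> I y * ((y + real n - 1) * (y + real n - 2))"
proof (induction n)
  case (Suc n)
  let ?z = "y + real n"
  have z: "?z \<ge> 4" using Y by simp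
  have "I (?z + 1) - I ?z \<le> 2 * ((?z + 1) - ?z) * I (?z + 1) / ?z"
    using Y by (intro I_increment[of Y] ub) auto
  hence "I (?z + 1) * (?z - 2) \<le> ?z * I ?z" using z by (simp add: field_simps)
  hence "I (?z + 1) * (?z - 2) * ((y - 1) * (y - 2)) \<le> ?z * I ?z * ((y - 1) * (y - 2))"
    using Y by (intro mult_right_mono) auto
  also have "\<dots> = ?z * (I ?z * ((y - 1) * (y - 2)))" by simp
  also have "\<dots> \<le> ?z * (I y * ((?z - 1) * (?z - 2)))" using z by (intro mult_left_mono Suc.IH) auto
  finally have "(I (?z + 1) * ((y - 1) * (y - 2))) * (?z - 2) \<le> (I y * (?z * (?z - 1))) * (?z - 2)"
    by (simp add: ac_simps)
  hence "I (?z + 1) * ((y - 1) * (y - 2)) \<le> I y * (?z * (?z - 1))" using z by simp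
  thus ?case by (simp add: algebra_simps)
qed simp

text \<open>The factor 2 in the hypothesis has become the exponent 2. As G(z) is comparable with
  I(z)/z, quadratic growth of \<open>I\<close> means linear growth of the quotients G(z)/G(y), just
  what a first moment can absorb.\<close>

lemma I_growth:
  assumes Y: "Y \<ge> 4" "Y \<le> y" "0 \<le> h" and ub: "\<And>u. u \<ge> Y \<Longrightarrow> u * G u \<le> 2 * I u"
  shows "I (y + h) * y^2 \<le> 3 * I y * (y + h)^2"
proof -
  define n where "n = nat \<lceil>h\<rceil>"
  have n: "h \<le> real n" "real n \<le> h + 1" using Y(3) by (auto simp: n_def)
  have I0: "I y \<ge> 0" "I (y + h) \<ge> 0" using I_pos[of y] I_pos[of "y + h"] Y by auto
  \<comment> \<open>8 is the least factor that works from y = 4 on, with equality at 4; the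
    resulting 8/3 is rounded up to 3.\<close>
  have "3 * y^2 \<le> 8 * ((y - 1) * (y - 2))"
  proof -
    have "0 \<le> (y - 4) * (5 * y - 4)" using Y by (intro mult_nonneg_nonneg) auto
    thus ?thesis by (simp add: algebra_simps power2_eq_square)
  qed
  hence "I (y + h) * (3 * y^2) \<le> I (y + h) * (8 * ((y - 1) * (y - 2)))"
    by (intro mult_left_mono I0)
  also have "\<dots> = 8 * (I (y + h) * ((y - 1) * (y - 2)))" by simp
  also have "\<dots> \<le> 8 * (I (y + real n) * ((y - 1) * (y - 2)))"
    using Y n I_mono[of "y + h" "y + real n"] by (intro mult_left_mono mult_right_mono) auto
  also have "\<dots> \<le> 8 * (I y * ((y + real n - 1) * (y + real n - 2)))"
    by (intro mult_left_mono I_growth_nat[OF Y(1,2) ub]) auto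
  \<comment> \<open>Rounding \<open>h\<close> up to \<open>n\<close> costs at most 1, which the
    shifts by 1 and 2 in the telescoped product compensate.\<close>
  also have "\<dots> \<le> 8 * (I y * ((y + h) * (y + h)))"
    using Y n I0 by (intro mult_left_mono mult_mono) auto
  finally have "3 * (I (y + h) * y^2) \<le> 8 * (I y * (y + h)^2)" by (simp add: power2_eq_square)
  moreover have "I y * (y + h)^2 \<ge> 0" using I0 by simp
  ultimately show ?thesis by linarith
qed

end

text \<open>Since \<open>I\<close> is a primitive of \<open>G\<close>, this is y I'/I -> 1 up to a
  multiple of \<open>G\<close>, negligible against y G: Karamata's criterion for regular variation
  of index 1. \<open>C\<close> may depend on \<open>\<delta>\<close> because the range in which the
  PNT has relative error \<open>\<delta>\<close> does.\<close>

locale slowly_varying_density = exp_density +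
  assumes rel: "\<And>\<delta>. \<delta> > 0 \<Longrightarrow> \<exists>C. \<forall>y\<ge>0. \<bar>y * G y - I y\<bar> \<le> \<delta> * I y + C * G y"
begin

text \<open>A bootstrap: the case \<delta> = 1 yields y G = O(I), and with this bound the term
  \<open>C * G\<close> belonging to a small \<delta> is O(I/y), hence o(I).\<close>

lemma ratio_tendsto: "((\<lambda>y. y * G y / I y) \<longlongrightarrow> 1) at_top"
proof -
  obtain C1 where C1: "\<And>y. y \<ge> 0 \<Longrightarrow> \<bar>y * G y - I y\<bar> \<le> 1 * I y + C1 * G y"
    using rel[of 1] by auto
  \<comment> \<open>From \<open>2 * C1\<close> on, half of \<open>y * G y\<close> absorbs
    \<open>C1 * G y\<close>; this doubles the 2 to 4.\<close>
  have b: "y * G y \<le> 4 * I y" if "y \<ge> max 1 (2 * C1)" for y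
  proof -
    have "C1 * G y \<le> y / 2 * G y" using that G_nonneg by (intro mult_right_mono) auto
    moreover have "y * G y - I y \<le> I y + C1 * G y" using C1[of y] that by auto
    ultimately show ?thesis by simp
  qed
  show ?thesis
  proof (rule tendstoI)
    fix e :: real assume e: "e > 0"
    obtain C2 where C2: "\<And>y. y \<ge> 0 \<Longrightarrow> \<bar>y * G y - I y\<bar> \<le> (e/2) * I y + C2 * G y"
      using rel[of "e/2"] e by auto
    show "eventually (\<lambda>y. dist (y * G y / I y) 1 < e) at_top"
      using eventually_ge_at_top[of "max 1 (2 * C1)"] eventually_gt_at_top[of "8 * \<bar>C2\<bar> / e"]
    proof eventually_elim
      case (elim y)
      have y: "y > 0" using elim by auto
      have I: "I y > 0" by (rule I_pos[OF y])
      have "C2 * G y \<le> \<bar>C2\<bar> * G y" using G_nonneg by (intro mult_right_mono) auto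
      also have "\<dots> \<le> \<bar>C2\<bar> * (4 * I y / y)" using b[OF elim(1)] y by (intro mult_left_mono) (auto simp: field_simps)
      also have "\<dots> = (4 * \<bar>C2\<bar> / y) * I y" by simp
      also have "\<dots> < (e/2) * I y" using elim(2) y e I by (intro mult_strict_right_mono) (auto simp: field_simps)
      finally have "\<bar>y * G y - I y\<bar> < e * I y" using C2[of y] y by (auto simp: field_simps)
      moreover have "y * G y / I y - 1 = (y * G y - I y) / I y" using I by (simp add: field_simps)
      ultimately show ?case using I by (simp add: dist_real_def field_simps)
    qed
  qed
qed

lemma obtain_two_sided:
  obtains Y where "Y \<ge> 4" "\<And>y. y \<ge> Y \<Longrightarrow> y * G y \<le> 2 * I y" "\<And>y. y \<ge> Y \<Longrightarrow> I y \<le> 2 * (y * G y)"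
proof -
  have "eventually (\<lambda>y. y * G y / I y < 2 \<and> y * G y / I y > 1/2) at_top"
    using order_tendstoD(2)[OF ratio_tendsto, of 2] order_tendstoD(1)[OF ratio_tendsto, of "1/2"]
    by (auto intro: eventually_conj)
  then obtain Y where Y: "\<And>y. y \<ge> Y \<Longrightarrow> y * G y / I y < 2 \<and> y * G y / I y > 1/2"
    by (auto simp: eventually_at_top_linorder)
  show ?thesis
  proof (rule that[of "max 4 Y"])
    show "y * G y \<le> 2 * I y" "I y \<le> 2 * (y * G y)" if "y \<ge> max 4 Y" for y
      using Y[of y] I_pos[of y] that by (auto simp: field_simps)
  qed auto
qed

lemma G_shift_bound:
  obtains C Y where "C \<ge> 0" "Y > 0" "\<And>y u. y \<ge> Y \<Longrightarrow> G (y - u) \<le> C * (1 + \<bar>u\<bar>) * G y"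
proof -
  obtain Y where Y: "Y \<ge> 4" and ub: "\<And>y. y \<ge> Y \<Longrightarrow> y * G y \<le> 2 * I y"
    and lb: "\<And>y. y \<ge> Y \<Longrightarrow> I y \<le> 2 * (y * G y)" by (rule obtain_two_sided) blast
  \<comment> \<open>For arguments below \<open>Y\<close>, where nothing is known about the
    regularity of \<open>G\<close>: it is at most \<open>H Y\<close> there, and the comparison with
    \<open>G y\<close> goes through \<open>I Y \<le> I y \<le> 2 * (y * G y)\<close>.\<close>
  define D where "D = 2 * H Y * Y / I Y"
  have D0: "D \<ge> 0" using H_nonneg[of Y] I_pos[of Y] Y by (simp add: D_def)
  show ?thesis
  proof (rule that[of "12 + D" Y])
    fix y u assume y: "y \<ge> Y"
    have y0: "y > 0" using y Y by simp
    \<comment> \<open>Right shifts need the growth bound for \<open>I\<close>, which produces 12 = 2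
      * 3 * 2; left shifts staying above \<open>Y\<close> need only its monotonicity; left shifts
      past \<open>Y\<close> use \<open>D\<close>. In each case a quotient of arguments turns into
      the factor 1 + |u|.\<close>
    consider "u < 0" | "u \<ge> 0" "y - u \<ge> Y" | "u \<ge> 0" "y - u < Y" by linarith
    hence "G (y - u) \<le> 12 * ((1 + \<bar>u\<bar>) * G y) \<or> G (y - u) \<le> D * ((1 + \<bar>u\<bar>) * G y)"
    proof cases
      case 1
      let ?z = "y - u"
      have z: "?z > 0" "?z \<ge> y" using y0 1 by auto
      have "I ?z * y^2 \<le> 3 * I y * ?z^2" using I_growth[OF Y y _ ub, of "-u"] 1 by simp
      also have "\<dots> \<le> 3 * (2 * (y * G y)) * ?z^2"
        using lb[OF y] by (intro mult_right_mono) auto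
      finally have *: "I ?z * y^2 \<le> 6 * y * G y * ?z^2" by simp
      have "(?z * G ?z) * y^2 \<le> (2 * I ?z) * y^2" using ub[of ?z] z y by (intro mult_right_mono) auto
      also have "\<dots> \<le> 12 * y * G y * ?z^2" using * by simp
      finally have "(y * ?z) * (G ?z * y) \<le> (y * ?z) * (12 * G y * ?z)" by (simp add: power2_eq_square ac_simps)
      hence "G ?z * y \<le> 12 * G y * ?z" using y0 z by simp
      also have "\<dots> \<le> 12 * G y * (y * (1 + \<bar>u\<bar>))"
      proof (rule mult_left_mono)
        have "1 * \<bar>u\<bar> \<le> y * \<bar>u\<bar>" using y Y by (intro mult_right_mono) auto
        thus "y - u \<le> y * (1 + \<bar>u\<bar>)" using 1 by (simp add: algebra_simps)
      qed (use G_nonneg in auto)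
      finally have "G ?z * y \<le> (12 * ((1 + \<bar>u\<bar>) * G y)) * y" by (simp add: ac_simps)
      thus ?thesis using y0 by simp
    next
      case 2
      let ?z = "y - u"
      have z: "?z \<ge> 1" using 2 Y by simp
      have "?z * G ?z \<le> 2 * I ?z" using 2 by (intro ub)
      also have "\<dots> \<le> 2 * I y" using 2 z I_mono[of ?z y] by simp
      also have "\<dots> \<le> 4 * y * G y" using lb[OF y] by simp
      also have "\<dots> \<le> 4 * (?z * (1 + \<bar>u\<bar>)) * G y"
      proof (intro mult_right_mono mult_left_mono G_nonneg)
        have "1 * u \<le> ?z * u" using z 2 by (intro mult_right_mono) auto
        thus "y \<le> ?z * (1 + \<bar>u\<bar>)" using 2 by (simp add: algebra_simps)
      qed auto
      finally have "?z * G ?z \<le> ?z * (4 * ((1 + \<bar>u\<bar>) * G y))" by (simp add: ac_simps)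
      hence "G ?z \<le> 4 * ((1 + \<bar>u\<bar>) * G y)" using z by simp
      also have "\<dots> \<le> 12 * ((1 + \<bar>u\<bar>) * G y)" using G_nonneg[of y] by (intro mult_right_mono) auto
      finally show ?thesis ..
    next
      case 3
      have IY: "I Y > 0" using Y I_pos by simp
      have "G (y - u) * I Y \<le> H Y * I Y" using 3 G_le_H IY by (intro mult_right_mono) auto
      also have "\<dots> \<le> H Y * (2 * (y * G y))"
        using lb[OF y] I_mono[of Y y] y Y H_nonneg by (intro mult_left_mono) auto
      also have "\<dots> \<le> H Y * (2 * ((Y * (1 + \<bar>u\<bar>)) * G y))"
      proof (intro mult_left_mono mult_right_mono G_nonneg H_nonneg)
        have "1 * u \<le> Y * u" using Y 3 by (intro mult_right_mono) auto
        thus "y \<le> Y * (1 + \<bar>u\<bar>)" using 3 by (simp add: algebra_simps)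
      qed auto
      also have "\<dots> = (D * ((1 + \<bar>u\<bar>) * G y)) * I Y" using IY by (simp add: D_def)
      finally show ?thesis using IY by simp
    qed
    moreover have "0 \<le> 12 * ((1 + \<bar>u\<bar>) * G y)" "0 \<le> D * ((1 + \<bar>u\<bar>) * G y)"
      using G_nonneg D0 by auto
    moreover have "(12 + D) * (1 + \<bar>u\<bar>) * G y = 12 * ((1 + \<bar>u\<bar>) * G y) + D * ((1 + \<bar>u\<bar>) * G y)"
      by (simp add: algebra_simps)
    ultimately show "G (y - u) \<le> (12 + D) * (1 + \<bar>u\<bar>) * G y" by linarith
  qed (use D0 Y in auto)
qed

lemma I_shift_tendsto_nonneg:
  assumes "h \<ge> 0"
  shows "((\<lambda>y. I (y - h) / I y) \<longlongrightarrow> 1) at_top"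
proof -
  obtain Y where Y: "Y \<ge> 4" and ub: "\<And>y. y \<ge> Y \<Longrightarrow> y * G y \<le> 2 * I y" by (rule obtain_two_sided) blast
  have lim: "((\<lambda>y. 1 - 2 * h / (y - h)) \<longlongrightarrow> 1) at_top" by real_asymp
  show ?thesis
  proof (rule tendsto_sandwich[OF _ _ lim tendsto_const])
    show "eventually (\<lambda>y. 1 - 2 * h / (y - h) \<le> I (y - h) / I y) at_top"
      using eventually_ge_at_top[of "Y + h"]
    proof eventually_elim
      case (elim y)
      have "I y > 0" using elim Y assms by (intro I_pos) auto
      moreover have "I y - I (y - h) \<le> 2 * (y - (y - h)) * I y / (y - h)"
        using elim Y assms by (intro I_increment[of Y] ub) auto
      ultimately show ?case by (simp add: field_simps)
    qed
    show "eventually (\<lambda>y. I (y - h) / I y \<le> 1) at_top"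
      using eventually_ge_at_top[of "1 + h"]
    proof eventually_elim
      case (elim y)
      thus ?case using I_pos[of y] I_mono[of "y - h" y] assms by simp
    qed
  qed
qed

lemma I_shift_tendsto: "((\<lambda>y. I (y - u) / I y) \<longlongrightarrow> 1) at_top"
proof (cases "u \<ge> 0")
  case True
  thus ?thesis by (rule I_shift_tendsto_nonneg)
next
  case False
  hence "((\<lambda>y. I (y - - u) / I y) \<longlongrightarrow> 1) at_top" by (intro I_shift_tendsto_nonneg) auto
  from tendsto_shift_at_top[OF this, of u] have "((\<lambda>y. I y / I (y - u)) \<longlongrightarrow> 1) at_top" by simp
  from tendsto_inverse[OF this] show ?thesis by simp
qed

text \<open>Slow variation passes from \<open>I\<close> to \<open>G\<close> because G(y) is
  asymptotic to I(y)/y and both I(y - u)/I(y) and y/(y - u) tend to 1.\<close>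

lemma G_shift_tendsto: "((\<lambda>y. G (y - u) / G y) \<longlongrightarrow> 1) at_top"
proof -
  have "((\<lambda>y. ((y - u) * G (y - u) / I (y - u)) * (I (y - u) / I y) * inverse (y * G y / I y) * (y / (y - u))) \<longlongrightarrow> 1 * 1 * inverse 1 * 1) at_top"
    by (intro tendsto_mult tendsto_inverse tendsto_shift_at_top[OF ratio_tendsto] I_shift_tendsto ratio_tendsto)
       (simp, real_asymp)
  moreover have "eventually (\<lambda>y. ((y - u) * G (y - u) / I (y - u)) * (I (y - u) / I y) * inverse (y * G y / I y) * (y / (y - u)) = G (y - u) / G y) at_top"
    using eventually_gt_at_top[of "max 0 u"]
  proof eventually_elim
    case (elim y)
    thus ?case using I_pos[of y] I_pos[of "y - u"] G_pos[of y] by (simp add: field_simps)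
  qed
  ultimately show ?thesis by (simp add: filterlim_cong)
qed

text \<open>Slow variation replaces a Wiener theorem: \<open>G * K\<close> is asymptotic to the integral of \<open>K\<close> times \<open>G\<close>,
  so the limit of \<open>G * K\<close> determines that of \<open>G\<close>.\<close>

lemma G_tendsto:
  assumes K: "finite_moment K" "(LINT u|lborel. K u) \<noteq> 0"
    and E: "\<And>y. E y = (if y \<ge> 0 then G y - a else 0)"
    and lim: "((\<lambda>y. lconv (\<lambda>y. of_real (E y)) K y) \<longlongrightarrow> 0) at_top" and "a > 0"
  shows "(G \<longlongrightarrow> a) at_top"
proof -
  let ?k = "LINT u|lborel. K u"
  obtain C Y where C: "C \<ge> 0" and Y: "Y > 0" and bd: "\<And>y u. y \<ge> Y \<Longrightarrow> G (y - u) \<le> C * (1 + \<bar>u\<bar>) * G y"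
    by (rule G_shift_bound) blast
  have [measurable]: "K \<in> borel_measurable borel" using K by (simp add: finite_moment_def)
  have i: "integrable lborel (\<lambda>u. C * ((1 + \<bar>u\<bar>) * norm (K u)))"
    using K by (auto simp: finite_moment_def)
  have b: "norm (of_real (G (y - u) / G y) * K u) \<le> C * ((1 + \<bar>u\<bar>) * norm (K u))" if "y \<ge> Y" for y u
  proof -
    have "G (y - u) / G y \<le> C * (1 + \<bar>u\<bar>)" using bd[OF that, of u] G_pos[of y] that Y by (simp add: field_simps)
    hence "\<bar>G (y - u) / G y\<bar> * norm (K u) \<le> (C * (1 + \<bar>u\<bar>)) * norm (K u)"
      using G_nonneg by (intro mult_right_mono) auto
    thus ?thesis by (simp only: norm_mult norm_of_real mult.assoc)
  qed
  have int: "integrable lborel (\<lambda>u. of_real (G (y - u) / G y) * K u)" if "y \<ge> Y" for y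
    by (rule Bochner_Integration.integrable_bound[OF i])
       (use order_trans[OF b[OF that] abs_ge_self] in \<open>auto intro!: AE_I2 simp del: norm_mult\<close>)
  have L1: "((\<lambda>y. LINT u|lborel. of_real (G (y - u) / G y) * K u) \<longlongrightarrow> (LINT u|lborel. of_real 1 * K u)) at_top"
  proof (rule integral_dominated_convergence_at_top[where w = "\<lambda>u. C * ((1 + \<bar>u\<bar>) * norm (K u))"])
    show "AE u in lborel. ((\<lambda>y. of_real (G (y - u) / G y) * K u) \<longlongrightarrow> of_real 1 * K u) at_top"
      by (intro AE_I2 tendsto_mult tendsto_const tendsto_of_real G_shift_tendsto)
    show "eventually (\<lambda>y. AE u in lborel. norm (of_real (G (y - u) / G y) * K u) \<le> C * ((1 + \<bar>u\<bar>) * norm (K u))) at_top"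
      using eventually_ge_at_top[of Y] by eventually_elim (intro AE_I2 b)
  qed (use i in auto)
  \<comment> \<open>\<open>E\<close> is \<open>G\<close> minus the step \<open>S\<close>.
    \<open>G\<close> is not yet known to be bounded, so it enters only through the quotients G(y -
    u)/G(y), while \<open>S\<close> is convolved directly.\<close>
  define S where "S y = complex_of_real (if y \<ge> 0 then a else 0)" for y :: real
  have "eventually (\<lambda>y. S y = of_real a) at_top"
    using eventually_ge_at_top[of 0] by eventually_elim (simp add: S_def)
  hence "(S \<longlongrightarrow> of_real a) at_top" by (rule tendsto_eventually)
  moreover have "S \<in> borel_measurable borel" unfolding S_def by measurable
  ultimately have S: "bounded_tendsto S (of_real a)"
    unfolding bounded_tendsto_def by (auto simp: S_def intro!: exI[of _ "\<bar>a\<bar>"])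
  have L2: "((\<lambda>y. lconv S K y + lconv (\<lambda>y. of_real (E y)) K y) \<longlongrightarrow> of_real a * ?k + 0) at_top"
    by (intro tendsto_add lim bounded_tendstoD(2)[OF bounded_tendsto_lconv[OF S finite_moment_integrable[OF K(1)]]])
  have eq: "lconv S K y + lconv (\<lambda>y. of_real (E y)) K y = (LINT u|lborel. of_real (G (y - u) / G y) * K u) * of_real (G y)" 
    if "y \<ge> Y" for y
  proof -
    have G: "G y > 0" using that Y G_pos by simp
    have "lconv (\<lambda>y. of_real (E y)) K y = (LINT u|lborel. of_real (G y) * (of_real (G (y - u) / G y) * K u) - S (y - u) * K u)"
      unfolding lconv_def using G by (intro Bochner_Integration.integral_cong) (auto simp: E S_def G_neg algebra_simps)
    also have "\<dots> = of_real (G y) * (LINT u|lborel. of_real (G (y - u) / G y) * K u) - lconv S K y"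
      unfolding lconv_def
      by (subst Bochner_Integration.integral_diff[OF integrable_mult_right[OF int[OF that]]
            linear_growth_integrable[OF bounded_tendsto_imp_linear_growth[OF S] K(1)]])
         (simp only: integral_mult_right_zero)
    finally show ?thesis by simp
  qed
  have L3: "((\<lambda>y. (LINT u|lborel. of_real (G (y - u) / G y) * K u) * of_real (G y)) \<longlongrightarrow> of_real a * ?k) at_top"
    by (rule Lim_transform_eventually[OF L2[unfolded add_0_right]], rule eventually_mono[OF eventually_ge_at_top[of Y] eq])
  have L1': "((\<lambda>y. LINT u|lborel. of_real (G (y - u) / G y) * K u) \<longlongrightarrow> ?k) at_top" using L1 by simp
  \<comment> \<open>The averaged quotient tends to the integral of \<open>K\<close>, which is
    non-zero, so it can be divided out of the product in \<open>L3\<close>.\<close>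
  have "eventually (\<lambda>y. (LINT u|lborel. of_real (G (y - u) / G y) * K u) \<noteq> 0) at_top"
    using tendsto_imp_eventually_ne[OF L1' K(2)] .
  hence "eventually (\<lambda>y. ((LINT u|lborel. of_real (G (y - u) / G y) * K u) * of_real (G y)) / (LINT u|lborel. of_real (G (y - u) / G y) * K u) = complex_of_real (G y)) at_top"
    by eventually_elim simp
  from Lim_transform_eventually[OF tendsto_divide[OF L3 L1' K(2)] this]
  have "((\<lambda>y. complex_of_real (G y)) \<longlongrightarrow> of_real a) at_top" using K(2) by simp
  thus ?thesis by (simp only: tendsto_of_real_iff)
qed

end

section \<open>Fourier uniqueness and the Chebyshev identity\<close>

text \<open>Levy's uniqueness theorem concerns probability measures, so both measures are scaled by
  their common mass, read off from the characteristic functions at 0; mass 0 has to be treated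
  apart.\<close>

lemma finite_measure_eqI_char:
  assumes "finite_measure M" "finite_measure M'"
    and sM[measurable_cong]: "sets M = sets borel" and sM'[measurable_cong]: "sets M' = sets borel"
    and char: "\<And>t. char M t = char M' t"
  shows "M = M'"
proof -
  interpret M: finite_measure M by fact
  interpret M': finite_measure M' by fact
  have sp[simp]: "space M = UNIV" "space M' = UNIV"
    using sets_eq_imp_space_eq[OF sM] sets_eq_imp_space_eq[OF sM'] by auto
  define T where "T = measure M UNIV"
  have T': "measure M' UNIV = T" using char[of 0] by (simp add: char_def T_def)
  have eT: "emeasure M UNIV = ennreal T" "emeasure M' UNIV = ennreal T"
    using M.emeasure_eq_measure[of UNIV] M'.emeasure_eq_measure[of UNIV] T' by (auto simp: T_def)
  show ?thesis
  proof (cases "T = 0")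
    case True
    show ?thesis
    proof (rule measure_eqI)
      fix A assume "A \<in> sets M"
      hence "emeasure M A \<le> emeasure M UNIV" "emeasure M' A \<le> emeasure M' UNIV"
        by (auto intro!: emeasure_mono simp: sM sM')
      thus "emeasure M A = emeasure M' A" using True eT by simp
    qed (simp add: sM sM')
  next
    case False
    hence T: "T > 0" by (simp add: T_def zero_less_measure_iff order_le_less) 
    let ?d = "\<lambda>M. density M (\<lambda>_. ennreal (1 / T))"
    have rd: "real_distribution (?d Q)" if "sets Q = sets borel" "emeasure Q UNIV = ennreal T" for Q :: "real measure"
    proof -
      note [measurable_cong] = that(1)
      have [simp]: "space Q = UNIV" using sets_eq_imp_space_eq[OF that(1)] by simp
      have "emeasure (?d Q) UNIV = ennreal (1 / T) * emeasure Q UNIV"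
        using that by (simp add: emeasure_density nn_integral_cmult)
      also have "\<dots> = 1" using T by (simp add: that flip: ennreal_mult')
      finally have "prob_space (?d Q)" by (intro prob_spaceI) simp
      thus ?thesis unfolding real_distribution_def real_distribution_axioms_def using that by simp
    qed
    have ch: "char (?d Q) t = of_real (1 / T) * char Q t" if "sets Q = sets borel" for Q t
    proof -
      note [measurable_cong] = that
      show ?thesis unfolding char_def using T
        by (subst integral_density) (auto simp: scaleR_conv_of_real)
    qed
    have "?d M = ?d M'"
      by (rule Levy_uniqueness) (auto intro!: rd ext simp: sM sM' eT ch char)
    hence "density (?d M) (\<lambda>_. ennreal T) = density (?d M') (\<lambda>_. ennreal T)" by simp
    thus ?thesis using T by (simp add: density_density_eq density_1 flip: ennreal_mult')
  qed
qed

lemma char_convolution: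
  assumes "finite_measure M" "finite_measure M'"
    and sM[measurable_cong]: "sets M = sets borel" and sM'[measurable_cong]: "sets M' = sets borel"
  shows "char (convolution M M') t = char M t * char M' t"
proof -
  interpret M: finite_measure M by fact
  interpret M': finite_measure M' by fact
  interpret pair_sigma_finite M M' ..
  interpret P: finite_measure "M \<Otimes>\<^sub>M M'" by (rule finite_measure_pair_measure) fact+
  have i: "integrable (M \<Otimes>\<^sub>M M') (\<lambda>(x, y). iexp (t * (x + y)))"
    by (rule P.integrable_const_bound[of _ 1]) (auto simp: case_prod_beta)
  have "char (convolution M M') t = (CLINT z|M \<Otimes>\<^sub>M M'. (case z of (x, y) \<Rightarrow> iexp (t * (x + y))))"
    unfolding char_def convolution_def by (subst integral_distr) (auto simp: case_prod_unfold)
  also have "\<dots> = (CLINT x|M. CLINT y|M'. iexp (t * (x + y)))"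
    using integral_fst'[OF i] by simp
  also have "\<dots> = (CLINT x|M. iexp (t * x) * (CLINT y|M'. iexp (t * y)))"
    by (simp add: distrib_left exp_add)
  also have "\<dots> = char M t * char M' t" by (simp add: char_def)
  finally show ?thesis .
qed

text \<open>The remainder is estimated outright by |exp(ix) - 1 - ix| \<le> x^2/2, which makes it
  O(h^2) at the price of a second moment. Hence the moments of order up to 2 that are carried along
  below.\<close>

lemma has_vector_derivative_fourier_integral:
  fixes w :: "real \<Rightarrow> real"
  assumes s[measurable_cong]: "sets M = sets borel" and [measurable]: "w \<in> borel_measurable borel"
    and w: "\<And>k. k \<le> 2 \<Longrightarrow> integrable M (\<lambda>u. u ^ k * w u)"
  shows "((\<lambda>t. CLINT u|M. of_real (w u) * iexp (t * u)) has_vector_derivative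
           (CLINT u|M. of_real (w u) * (\<i> * of_real u * iexp (t * u)))) (at t)"
proof -
  let ?f = "\<lambda>t. CLINT u|M. of_real (w u) * iexp (t * u)"
  let ?D = "CLINT u|M. of_real (w u) * (\<i> * of_real u * iexp (t * u))"
  define C where "C = (LINT u|M. \<bar>w u\<bar> * u\<^sup>2)"
  have i0: "integrable M (\<lambda>u. complex_of_real (w u) * iexp (t * u))" for t
    by (rule Bochner_Integration.integrable_bound[OF w[of 0]]) (auto simp: norm_mult)
  have i1: "integrable M (\<lambda>u. complex_of_real (w u) * (\<i> * of_real u * iexp (t * u)))"
    by (rule Bochner_Integration.integrable_bound[OF w[of 1]]) (auto simp: norm_mult abs_mult)
  have i2: "integrable M (\<lambda>u. \<bar>w u\<bar> * u\<^sup>2)"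
    by (rule Bochner_Integration.integrable_bound[OF w[of 2]]) (auto simp: abs_mult)
  have main: "norm (?f (t + h) - ?f t - h *\<^sub>R ?D) \<le> h\<^sup>2 * C" for h
  proof -
    have eq: "?f (t + h) - ?f t - h *\<^sub>R ?D =
       (CLINT u|M. of_real (w u) * iexp (t * u) * (iexp (h * u) - 1 - \<i> * of_real (h * u)))"
    proof -
      have "?f (t + h) - ?f t - h *\<^sub>R ?D = (CLINT u|M. of_real (w u) * iexp ((t + h) * u) - of_real (w u) * iexp (t * u)
         - h *\<^sub>R (of_real (w u) * (\<i> * of_real u * iexp (t * u))))"
        by (subst Bochner_Integration.integral_diff[OF Bochner_Integration.integrable_diff[OF i0[of "t + h"] i0[of t]]
              integrable_scaleR_right[OF i1]],
            subst Bochner_Integration.integral_diff[OF i0[of "t + h"] i0[of t]],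
            subst integral_scaleR_right, rule refl)
      also have "\<dots> = (CLINT u|M. of_real (w u) * iexp (t * u) * (iexp (h * u) - 1 - \<i> * of_real (h * u)))"
        by (intro Bochner_Integration.integral_cong refl)
           (simp add: distrib_right distrib_left exp_add scaleR_conv_of_real algebra_simps)
      finally show ?thesis .
    qed
    have b: "norm (of_real (w u) * iexp (t * u) * (iexp (h * u) - 1 - \<i> * of_real (h * u))) \<le> h\<^sup>2 * (\<bar>w u\<bar> * u\<^sup>2)" for u
    proof -
      have "norm (iexp (h * u) - 1 - \<i> * of_real (h * u)) \<le> \<bar>h * u\<bar>\<^sup>2 / 2"
        using iexp_approx1[of "h * u" 1] by (simp add: diff_diff_eq numeral_2_eq_2)
      also have "\<dots> \<le> h\<^sup>2 * u\<^sup>2" by (simp add: power_mult_distrib)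
      finally have "\<bar>w u\<bar> * norm (iexp (h * u) - 1 - \<i> * of_real (h * u)) \<le> \<bar>w u\<bar> * (h\<^sup>2 * u\<^sup>2)"
        by (rule mult_left_mono) simp
      thus ?thesis by (simp add: norm_mult ac_simps)
    qed
    have "norm (CLINT u|M. of_real (w u) * iexp (t * u) * (iexp (h * u) - 1 - \<i> * of_real (h * u))) \<le>
       (LINT u|M. h\<^sup>2 * (\<bar>w u\<bar> * u\<^sup>2))"
    proof (rule Bochner_Integration.integral_norm_bound_integral[OF _ _ b])
      show "integrable M (\<lambda>u. of_real (w u) * iexp (t * u) * (iexp (h * u) - 1 - \<i> * of_real (h * u)))"
        by (rule Bochner_Integration.integrable_bound[OF integrable_mult_right[OF i2, of "h\<^sup>2"]])
           (measurable, unfold real_norm_def, intro AE_I2, rule order_trans[OF b abs_ge_self])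
    qed (intro integrable_mult_right i2)
    thus ?thesis unfolding eq by (simp add: C_def)
  qed
  show ?thesis unfolding has_vector_derivative_def has_derivative_at
  proof (intro conjI bounded_linear_scaleR_left)
    have "((\<lambda>h. \<bar>h\<bar> * C) \<longlongrightarrow> \<bar>0\<bar> * C) (at 0)" by (intro tendsto_intros)
    hence l: "((\<lambda>h. \<bar>h\<bar> * C) \<longlongrightarrow> 0) (at 0)" by simp
    show "((\<lambda>h. norm (?f (t + h) - ?f t - h *\<^sub>R ?D) / norm h) \<longlongrightarrow> 0) (at 0)"
    proof (rule tendsto_sandwich[OF _ _ tendsto_const l])
      show "\<forall>\<^sub>F h in at 0. norm (?f (t + h) - ?f t - h *\<^sub>R ?D) / norm h \<le> \<bar>h\<bar> * C"
        unfolding eventually_at_filter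
      proof (intro always_eventually allI impI)
        fix h :: real assume "h \<noteq> 0"
        thus "norm (?f (t + h) - ?f t - h *\<^sub>R ?D) / norm h \<le> \<bar>h\<bar> * C"
          using main[of h] by (simp add: field_simps power2_eq_square abs_mult_self_eq)
      qed
    qed auto
  qed
qed

text \<open>Logarithmic differentiation of the zeta function along a vertical line, followed by
  Fourier uniqueness, turns the exponential relation into Chebyshev's convolution identity.\<close>

lemma chebyshev_identity_measure:
  fixes n \<pi> :: "real measure" and \<sigma> :: real
  assumes sn[measurable_cong]: "sets n = sets borel" and sp[measurable_cong]: "sets \<pi> = sets borel"
    and "sigma_finite_measure n"
    and n0: "AE u in n. u \<ge> 0" and p0: "AE u in \<pi>. u \<ge> 0"
    and int: "\<And>k. k \<le> 2 \<Longrightarrow> integrable n (\<lambda>u. u ^ k * exp (- \<sigma> * u))"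
             "\<And>k. k \<le> 2 \<Longrightarrow> integrable \<pi> (\<lambda>u. u ^ k * exp (- \<sigma> * u))"
    and zeta: "\<And>t. (CLINT u|n. of_real (exp (- \<sigma> * u)) * iexp (t * u)) =
                 exp (CLINT u|\<pi>. of_real (exp (- \<sigma> * u)) * iexp (t * u))"
    and [measurable]: "f \<in> borel_measurable borel"
  shows "(\<integral>\<^sup>+u. ennreal u * f u \<partial>n) = (\<integral>\<^sup>+v. \<integral>\<^sup>+u. f (u + v) \<partial>n \<partial>(density \<pi> ennreal))"
proof -
  interpret n: sigma_finite_measure n by fact
  let ?e = "\<lambda>u. exp (- \<sigma> * u)"
  \<comment> \<open>The tilt by exp(- \<sigma> u) makes the measures finite, so that characteristic
    functions are available. \<open>C\<close>, \<open>A\<close> and \<open>B\<close> are the tilts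
    of dN, log dN and d\<psi> = log dPi.\<close>
  define A where "A = density n (\<lambda>u. ennreal (u * ?e u))"
  define B where "B = density \<pi> (\<lambda>u. ennreal (u * ?e u))"
  define C where "C = density n (\<lambda>u. ennreal (?e u))"
  have sets[measurable_cong]: "sets A = sets borel" "sets B = sets borel" "sets C = sets borel"
    by (auto simp: A_def B_def C_def sn sp)
  have nn: "AE u in n. 0 \<le> u * ?e u" "AE u in \<pi>. 0 \<le> u * ?e u"
    using n0 p0 by (auto elim!: eventually_mono)
  have fin: "finite_measure A" "finite_measure B" "finite_measure C"
    unfolding A_def B_def C_def
    using int(1)[of 1] int(2)[of 1] int(1)[of 0] nn
    by (auto intro!: finite_measureI simp: emeasure_density nn_integral_eq_integral)
  have cA: "char A t = (CLINT u|n. of_real (?e u) * (of_real u * iexp (t * u)))" for t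
    unfolding A_def char_def by (subst integral_density) (use nn in \<open>auto simp: scaleR_conv_of_real ac_simps\<close>)
  have cB: "char B t = (CLINT u|\<pi>. of_real (?e u) * (of_real u * iexp (t * u)))" for t
    unfolding B_def char_def by (subst integral_density) (use nn in \<open>auto simp: scaleR_conv_of_real ac_simps\<close>)
  have cC: "char C t = (CLINT u|n. of_real (?e u) * iexp (t * u))" for t
    unfolding C_def char_def by (subst integral_density) (auto simp: scaleR_conv_of_real)
  have char: "char A t = char C t * char B t" for t
  proof -
    let ?Z = "\<lambda>t. CLINT u|n. of_real (?e u) * iexp (t * u)" and ?L = "\<lambda>t. CLINT u|\<pi>. of_real (?e u) * iexp (t * u)"
    have d1: "(?Z has_vector_derivative (CLINT u|n. of_real (?e u) * (\<i> * of_real u * iexp (t * u)))) (at t)"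
      by (rule has_vector_derivative_fourier_integral[OF sn _ int(1)]) auto
    have d2: "(?L has_vector_derivative (CLINT u|\<pi>. of_real (?e u) * (\<i> * of_real u * iexp (t * u)))) (at t)"
      by (rule has_vector_derivative_fourier_integral[OF sp _ int(2)]) auto
    \<comment> \<open>Z = exp L gives Z' = L' Z along the vertical line; the factor i produced by
      both derivatives cancels.\<close>
    have "((exp \<circ> ?L) has_vector_derivative (CLINT u|\<pi>. of_real (?e u) * (\<i> * of_real u * iexp (t * u))) * exp (?L t)) (at t)"
      by (rule field_vector_diff_chain_at[OF d2 DERIV_exp])
    hence "(?Z has_vector_derivative (CLINT u|\<pi>. of_real (?e u) * (\<i> * of_real u * iexp (t * u))) * ?Z t) (at t)"
      by (simp only: o_def zeta)
    from vector_derivative_unique_at[OF d1 this]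
    have "(CLINT u|n. of_real (?e u) * (\<i> * of_real u * iexp (t * u))) =
       (CLINT u|\<pi>. of_real (?e u) * (\<i> * of_real u * iexp (t * u))) * ?Z t" .
    moreover have "of_real (?e u) * (\<i> * of_real u * iexp (t * u)) = \<i> * (of_real (?e u) * (of_real u * iexp (t * u)))" for u
      by simp
    ultimately have "\<i> * char A t = (\<i> * char B t) * char C t"
      unfolding cA cB cC by (simp only: integral_mult_right_zero)
    thus ?thesis by simp
  qed
  have "A = convolution C B"
    by (rule finite_measure_eqI_char)
       (auto intro!: fin convolution_finite simp: sets char char_convolution[OF fin(3,2) sets(3,2)])
  \<comment> \<open>Testing against exp(\<sigma> u) f(u) undoes the tilt: this weight is
    multiplicative in u + v and so cancels the tilts of \<open>C\<close> and \<open>B\<close>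
    separately. With non-negative integrals no finiteness condition on \<open>f\<close>
    arises.\<close>
  hence "(\<integral>\<^sup>+u. ennreal (exp (\<sigma> * u)) * f u \<partial>A) = (\<integral>\<^sup>+u. \<integral>\<^sup>+v. ennreal (exp (\<sigma> * (u + v))) * f (u + v) \<partial>B \<partial>C)"
    by (simp add: nn_integral_convolution[OF fin(3,2) sets(2,3)])
  also have "\<dots> = (\<integral>\<^sup>+v. \<integral>\<^sup>+u. ennreal (exp (\<sigma> * (u + v))) * f (u + v) \<partial>C \<partial>B)"
  proof -
    interpret B: finite_measure B by (rule fin)
    interpret C: finite_measure C by (rule fin)
    interpret pair_sigma_finite C B ..
    show ?thesis by (rule Fubini'[symmetric]) measurable
  qed
  also have "\<dots> = (\<integral>\<^sup>+v. ennreal (v * ?e v) * (\<integral>\<^sup>+u. ennreal (?e u) * (ennreal (exp (\<sigma> * (u + v))) * f (u + v)) \<partial>n) \<partial>\<pi>)"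
  proof -
    interpret C: finite_measure C by (rule fin)
    have "(\<lambda>v. \<integral>\<^sup>+u. ennreal (exp (\<sigma> * (u + v))) * f (u + v) \<partial>C) \<in> borel_measurable borel" by measurable
    moreover have "(\<integral>\<^sup>+u. ennreal (exp (\<sigma> * (u + v))) * f (u + v) \<partial>C) = 
        (\<integral>\<^sup>+u. ennreal (?e u) * (ennreal (exp (\<sigma> * (u + v))) * f (u + v)) \<partial>n)" for v
      unfolding C_def by (subst nn_integral_density) auto
    ultimately show ?thesis unfolding B_def by (subst nn_integral_density) auto
  qed
  also have "\<dots> = (\<integral>\<^sup>+v. ennreal v * (\<integral>\<^sup>+u. f (u + v) \<partial>n) \<partial>\<pi>)"
  proof (intro nn_integral_cong)
    fix v
    have "ennreal (?e u) * (ennreal (exp (\<sigma> * (u + v))) * f (u + v)) = ennreal (exp (\<sigma> * v)) * f (u + v)" for u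
    proof -
      have "?e u * exp (\<sigma> * (u + v)) = exp (\<sigma> * v)"
        by (simp add: exp_add[symmetric]) (simp add: algebra_simps)
      thus ?thesis by (simp only: mult.assoc[symmetric] ennreal_mult'[symmetric] exp_ge_zero)
    qed
    hence *: "(\<integral>\<^sup>+u. ennreal (?e u) * (ennreal (exp (\<sigma> * (u + v))) * f (u + v)) \<partial>n) = ennreal (exp (\<sigma> * v)) * (\<integral>\<^sup>+u. f (u + v) \<partial>n)"
      by (simp add: nn_integral_cmult)
    show "ennreal (v * ?e v) * (\<integral>\<^sup>+u. ennreal (?e u) * (ennreal (exp (\<sigma> * (u + v))) * f (u + v)) \<partial>n) = ennreal v * (\<integral>\<^sup>+u. f (u + v) \<partial>n)"
    proof -
      have "v * ?e v * exp (\<sigma> * v) = v" by (simp add: mult.assoc exp_add[symmetric])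
      hence "ennreal (v * ?e v) * ennreal (exp (\<sigma> * v)) = ennreal v"
        by (simp only: ennreal_mult''[symmetric] exp_ge_zero)
      thus ?thesis using * by (simp only: mult.assoc[symmetric])
    qed
  qed
  finally have 1: "(\<integral>\<^sup>+u. ennreal (exp (\<sigma> * u)) * f u \<partial>A) = (\<integral>\<^sup>+v. ennreal v * (\<integral>\<^sup>+u. f (u + v) \<partial>n) \<partial>\<pi>)" .
  have "(\<integral>\<^sup>+u. ennreal (exp (\<sigma> * u)) * f u \<partial>A) = (\<integral>\<^sup>+u. ennreal u * f u \<partial>n)"
    unfolding A_def
  proof (subst nn_integral_density, measurable, intro nn_integral_cong)
    fix u
    show "ennreal (u * ?e u) * (ennreal (exp (\<sigma> * u)) * f u) = ennreal u * f u"
    proof -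
      have "u * ?e u * exp (\<sigma> * u) = u" by (simp add: mult.assoc exp_add[symmetric])
      hence "ennreal (u * ?e u) * ennreal (exp (\<sigma> * u)) = ennreal u"
        by (simp only: ennreal_mult''[symmetric] exp_ge_zero)
      thus ?thesis by (simp only: mult.assoc[symmetric])
    qed
  qed
  moreover have "(\<integral>\<^sup>+v. \<integral>\<^sup>+u. f (u + v) \<partial>n \<partial>(density \<pi> ennreal)) = (\<integral>\<^sup>+v. ennreal v * (\<integral>\<^sup>+u. f (u + v) \<partial>n) \<partial>\<pi>)"
  proof -
    have "(\<lambda>v. \<integral>\<^sup>+u. f (u + v) \<partial>n) \<in> borel_measurable borel"
      by measurable
    thus ?thesis by (subst nn_integral_density) auto
  qed
  ultimately show ?thesis using 1 by simp
qed

section \<open>Stieltjes measures in the logarithmic variable\<close>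

lemma interval_measure_eqI:
  assumes s: "sets M = sets borel" and mono: "mono F" and rc: "\<And>x. continuous (at_right x) F"
    and eq: "\<And>x. emeasure M {..x} = ennreal (F x)" and F0: "\<And>x. F x \<ge> 0"
  shows "M = interval_measure F"
proof (rule measure_eqI_generator_eq[where E = "range (\<lambda>(a, b). {a<..b::real})" and \<Omega> = UNIV
      and A = "\<lambda>i::nat. {- real i<..real i}"])
  have Ioc: "emeasure M {a<..b} = ennreal (if a \<le> b then F b - F a else 0)" for a b
  proof (cases "a \<le> b")
    case True
    have "emeasure M ({..b} - {..a}) = emeasure M {..b} - emeasure M {..a}"
      using True by (intro emeasure_Diff) (auto simp: s eq)
    moreover have "{..b} - {..a} = {a<..b}" using True by auto
    ultimately show ?thesis using True F0 by (simp add: eq ennreal_minus)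
  qed auto
  show "X \<in> range (\<lambda>(a, b). {a<..b::real}) \<Longrightarrow> emeasure M X = emeasure (interval_measure F) X" for X
    using Ioc emeasure_interval_measure_Ioc_eq[of F] mono rc by (auto simp: monoD)
  show "Int_stable (range (\<lambda>(a, b). {a<..b::real}))"
    by (auto simp: Int_stable_def image_iff intro!: exI)
  show "(\<Union>i. {- real i<..real i}) = UNIV"
  proof -
    have "\<exists>i. - real i < x \<and> x \<le> real i" for x
    proof -
      obtain i where "\<bar>x\<bar> < real i" using reals_Archimedean2 by blast
      thus ?thesis by (intro exI[of _ i]) auto
    qed
    thus ?thesis by auto
  qed
  show "emeasure M {- real i<..real i} \<noteq> \<infinity>" for i by (simp add: Ioc)
  show "sets M = sigma_sets UNIV (range (\<lambda>(a, b). {a<..b::real}))"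
    "sets (interval_measure F) = sigma_sets UNIV (range (\<lambda>(a, b). {a<..b::real}))"
    by (auto simp: s borel_sigma_sets_Ioc)
qed auto

lemma emeasure_interval_measure_atMost:
  assumes mono: "mono F" and rc: "\<And>x. continuous (at_right x) F" and F0: "\<And>x. x < c \<Longrightarrow> F x = 0"
  shows "emeasure (interval_measure F) {..x} = ennreal (F x)"
proof (rule emeasure_interval_measure_Iic)
  have "eventually (\<lambda>x. F x = 0) at_bot"
    using eventually_gt_at_bot[of c] F0 by (auto elim: eventually_mono simp: eventually_at_bot_dense)
  thus "(F \<longlongrightarrow> 0) at_bot" by (rule tendsto_eventually)
qed (use mono rc in \<open>auto simp: monoD\<close>)

lemma interval_measure_atMost_null:
  assumes mono: "mono F" and rc: "\<And>x. continuous (at_right x) F" and F0: "\<And>x. x < c \<Longrightarrow> F x = 0"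
    and x: "F x = 0"
  shows "AE t in interval_measure F. x < t"
proof (rule AE_I')
  show "{..x} \<in> null_sets (interval_measure F)"
    by (intro null_setsI) (auto simp: emeasure_interval_measure_atMost[OF mono rc F0] x)
qed auto

lemma interval_measure_lessThan_null:
  assumes mono: "mono F" and rc: "\<And>x. continuous (at_right x) F" and F0: "\<And>x. x < c \<Longrightarrow> F x = 0"
  shows "AE t in interval_measure F. c \<le> t"
proof -
  have "AE t in interval_measure F. \<forall>n::nat. c - 1 / Suc n < t"
    unfolding AE_all_countable by (intro allI interval_measure_atMost_null[OF mono rc F0] F0) auto
  thus ?thesis
  proof eventually_elim
    case (elim t)
    show ?case
    proof (rule ccontr)
      assume "\<not> c \<le> t"
      then obtain n where "inverse (real (Suc n)) < c - t" using reals_Archimedean[of "c - t"] by auto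
      with elim[rule_format, of n] show False by (simp add: inverse_eq_divide)
    qed
  qed
qed

lemma continuous_at_right_o_exp:
  fixes F :: "real \<Rightarrow> real"
  assumes "\<And>x. continuous (at_right x) F"
  shows "continuous (at_right x) (F \<circ> exp)"
proof -
  have "filterlim exp (at_right (exp x)) (at_right x)"
    unfolding filterlim_at
    by (auto simp: eventually_at_filter intro!: tendsto_intros)
  moreover have "(F \<longlongrightarrow> F (exp x)) (at_right (exp x))" using assms[of "exp x"] by (simp add: continuous_within)
  ultimately show ?thesis unfolding continuous_within o_def by (rule filterlim_compose[rotated])
qed

lemma distr_ln_interval_measure:
  assumes mono: "mono F" and rc: "\<And>x. continuous (at_right x) F" and F0: "\<And>x. x < 1 \<Longrightarrow> F x = 0"
  shows "distr (interval_measure F) borel ln = interval_measure (F \<circ> exp)"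
proof (rule interval_measure_eqI)
  have pos: "AE t in interval_measure F. 1 \<le> t" by (rule interval_measure_lessThan_null[OF mono rc F0])
  show "emeasure (distr (interval_measure F) borel ln) {..x} = ennreal ((F \<circ> exp) x)" for x
  proof -
    have "emeasure (distr (interval_measure F) borel ln) {..x} = emeasure (interval_measure F) (ln -` {..x})"
      by (subst emeasure_distr) auto
    \<comment> \<open>The two sets agree on [1, \<infinity>), which carries the measure; for t \<le>
      0 \<open>ln\<close> has only conventional values.\<close>
    also have "\<dots> = emeasure (interval_measure F) {..exp x}"
    proof (rule emeasure_eq_AE)
      show "AE t in interval_measure F. (t \<in> ln -` {..x}) = (t \<in> {..exp x})"
        using pos
      proof eventually_elim
        case (elim t)
        thus ?case using exp_le_cancel_iff[of "ln t" x] by simp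
      qed
      show "ln -` {..x} \<in> sets (interval_measure F)"
        using measurable_sets[OF borel_measurable_ln[OF measurable_ident], of "{..x}"] by simp
    qed auto
    finally show ?thesis by (simp add: emeasure_interval_measure_atMost[OF mono rc F0])
  qed
  show "(F \<circ> exp) x \<ge> 0" for x
    using F0[of "min 0 (exp x)"] monoD[OF mono, of "min 0 (exp x)" "exp x"] by simp
qed (auto intro!: continuous_at_right_o_exp rc monoI monoD[OF mono])

text \<open>Fubini on the triangle 0 \<le> u \<le> v \<le> y, with h(y) - h(u) written as the
  integral of h', so that \<open>F\<close> may jump. The domain \<open>{..y}\<close> includes a
  possible atom at 0, hence there is no boundary term at 0.\<close>

lemma interval_measure_parts:
  fixes F h h' :: "real \<Rightarrow> real"
  assumes mono: "mono F" and rc: "\<And>x. continuous (at_right x) F" and F0: "\<And>x. x < 0 \<Longrightarrow> F x = 0"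
    and h: "\<And>x. (h has_real_derivative h' x) (at x)" and h': "continuous_on UNIV h'" and y: "0 \<le> y"
  shows "(LINT u:{..y}|interval_measure F. h u) = h y * F y - (LINT v:{0..y}|lborel. h' v * F v)"
    and "set_integrable (interval_measure F) {..y} h"
proof -
  let ?M = "interval_measure F"
  interpret M: sigma_finite_measure ?M by (rule sigma_finite_interval_measure) (use mono rc in \<open>auto simp: monoD\<close>)
  interpret P: pair_sigma_finite ?M lborel ..
  have [measurable]: "h' \<in> borel_measurable borel" using h' by (rule borel_measurable_continuous_onI)
  have ch: "continuous_on UNIV h" using h by (auto intro!: DERIV_continuous_on)
  have [measurable]: "h \<in> borel_measurable borel" using ch by (rule borel_measurable_continuous_onI)
  have F_nonneg: "F x \<ge> 0" for x using monoD[OF mono, of "min x (-1)" x] F0[of "min x (-1)"] by simp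
  have pos: "AE t in ?M. 0 \<le> t" by (rule interval_measure_lessThan_null[OF mono rc F0])
  have em: "emeasure ?M {..x} = ennreal (F x)" for x by (rule emeasure_interval_measure_atMost[OF mono rc F0])
  have bd: "\<exists>D. \<forall>v\<in>{0..y}. \<bar>k v\<bar> \<le> D" if "continuous_on UNIV k" for k :: "real \<Rightarrow> real"
  proof -
    have "bounded (k ` {0..y})"
      by (intro compact_imp_bounded compact_continuous_image continuous_on_subset[OF that]) auto
    thus ?thesis by (simp add: bounded_iff)
  qed
  obtain D where D: "\<And>v. v \<in> {0..y} \<Longrightarrow> \<bar>h' v\<bar> \<le> D" using bd[OF h'] by blast
  obtain D2 where D2: "\<And>v. v \<in> {0..y} \<Longrightarrow> \<bar>h v\<bar> \<le> D2" using bd[OF ch] by blast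
  have i1: "integrable ?M (indicator {..y} :: real \<Rightarrow> real)" by (rule integrable_real_indicator) (auto simp: em)
  have ih: "integrable ?M (\<lambda>u. indicator {..y} u * h u)"
  proof (rule Bochner_Integration.integrable_bound[OF integrable_mult_right[OF i1, of D2]])
    show "AE u in ?M. norm (indicator {..y} u * h u) \<le> norm (D2 * indicator {..y} u)"
      using pos by eventually_elim (use D2 in \<open>force simp: indicator_def\<close>)
  qed auto
  thus "set_integrable ?M {..y} h" by (simp add: set_integrable_def)
  define g where "g u v = indicator {0..y} u * (indicator {u..y} v * h' v)" for u v :: real
  have [measurable]: "case_prod g \<in> borel_measurable (borel \<Otimes>\<^sub>M borel)"
  proof -
    have "case_prod g = (\<lambda>(u, v). if 0 \<le> u \<and> u \<le> v \<and> v \<le> y then h' v else 0)"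
      by (auto simp: g_def fun_eq_iff)
    thus ?thesis by simp
  qed
  have gb: "norm (g u v) \<le> D * (indicator {..y} u * indicator {0..y} v)" for u v
  proof -
    have "D \<ge> 0" using D[of 0] y by simp
    thus ?thesis using D by (auto simp: g_def indicator_def)
  qed
  have i2: "integrable (?M \<Otimes>\<^sub>M lborel) (\<lambda>(u, v). D * (indicator {..y} u * indicator {0..y} v))"
  proof (rule P.Fubini_integrable)
    show "integrable ?M (\<lambda>u. LINT v|lborel. norm (case (u, v) of (u, v) \<Rightarrow> D * (indicator {..y} u * indicator {0..y} v)))"
      using y i1 by (simp add: abs_mult)
    show "AE u in ?M. integrable lborel (\<lambda>v. case (u, v) of (u, v) \<Rightarrow> D * (indicator {..y} u * indicator {0..y} v))"
      using y by (auto intro!: AE_I2 integrable_mult_right integrable_real_indicator)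
  qed measurable
  have ig: "integrable (?M \<Otimes>\<^sub>M lborel) (case_prod g)"
  proof (rule Bochner_Integration.integrable_bound[OF i2])
    show "AE x in ?M \<Otimes>\<^sub>M lborel. norm (case_prod g x) \<le> norm (case x of (u, v) \<Rightarrow> D * (indicator {..y} u * indicator {0..y} v))"
      using order_trans[OF gb abs_ge_self] by (intro AE_I2) (auto split: prod.split)
  qed measurable
  have "(LINT v|lborel. LINT u|?M. g u v) = (LINT u|?M. LINT v|lborel. g u v)"
    by (rule P.Fubini_integral[OF ig])
  also have "(LINT u|?M. LINT v|lborel. g u v) = (LINT u|?M. indicator {..y} u * (h y - h u))"
  proof (rule integral_cong_AE)
    show "AE u in ?M. (LINT v|lborel. g u v) = indicator {..y} u * (h y - h u)"
      using pos
    proof eventually_elim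
      case (elim u)
      show ?case
      proof (cases "u \<le> y")
        case True
        have "(LBINT v. indicator {u..y} v *\<^sub>R h' v) = h y - h u"
          by (rule integral_FTC_Icc[OF True]) (use h h' in \<open>auto simp: has_real_derivative_iff_has_vector_derivative
             intro: has_vector_derivative_at_within continuous_on_subset\<close>)
        thus ?thesis using True elim by (simp add: g_def)
      qed (simp add: g_def)
    qed
  qed measurable
  also have "\<dots> = h y * F y - (LINT u:{..y}|?M. h u)"
  proof -
    have "measure ?M {..y} = F y" by (simp add: measure_def em F_nonneg)
    moreover have "(LINT u|?M. indicator {..y} u * (h y - h u)) = (LINT u|?M. h y * indicator {..y} u - indicator {..y} u * h u)"
      by (simp add: algebra_simps)
    ultimately show ?thesis using i1 ih by (simp add: set_lebesgue_integral_def)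
  qed
  also have "(LINT v|lborel. LINT u|?M. g u v) = (LINT v:{0..y}|lborel. h' v * F v)"
    unfolding set_lebesgue_integral_def
  proof (rule Bochner_Integration.integral_cong[OF refl])
    fix v
    have "(LINT u|?M. g u v) = (LINT u|?M. (indicator {0..y} v * h' v) * indicator {..v} u)"
    proof (rule integral_cong_AE)
      show "AE u in ?M. g u v = (indicator {0..y} v * h' v) * indicator {..v} u"
        using pos by eventually_elim (auto simp: g_def indicator_def)
    qed measurable
    also have "\<dots> = (indicator {0..y} v * h' v) * F v"
      by (simp add: measure_def em F_nonneg)
    finally show "(LINT u|?M. g u v) = indicator {0..y} v *\<^sub>R (h' v * F v)" by simp
  qed
  finally show "(LINT u:{..y}|?M. h u) = h y * F y - (LINT v:{0..y}|lborel. h' v * F v)" by simp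
qed

section \<open>Chebyshev's psi as a distribution function\<close>

lemma psi_measure:
  assumes mono: "mono P" and rc: "\<And>x. continuous (at_right x) P" and P0: "\<And>x. x < 1 \<Longrightarrow> P x = 0"
  shows mono_psi: "mono (psi P)" and continuous_psi: "continuous (at_right x) (psi P)"
    and psi_le_1: "z \<le> 1 \<Longrightarrow> psi P z = 0"
    and nn_integral_psi: "ennreal (psi P x) = (\<integral>\<^sup>+t. ennreal (indicator {1<..x} t * ln t) \<partial>interval_measure P)"
proof -
  let ?M = "interval_measure P"
  have em: "emeasure ?M {..x} = ennreal (P x)" for x by (rule emeasure_interval_measure_atMost[OF mono rc P0])
  have int: "integrable ?M (\<lambda>t. indicator {1<..x} t * ln t)" for x
  proof (rule Bochner_Integration.integrable_bound)
    show "integrable ?M (\<lambda>t. \<bar>x\<bar> * indicator {..x} t)"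
      by (intro integrable_mult_right integrable_real_indicator) (auto simp: em)
    show "AE t in ?M. norm (indicator {1<..x} t * ln t) \<le> norm (\<bar>x\<bar> * indicator {..x} t)"
    proof (intro AE_I2)
      fix t :: real
      have "ln t \<le> t" if "1 < t" using that ln_le_minus_one[of t] by simp
      thus "norm (indicator {1<..x} t * ln t) \<le> norm (\<bar>x\<bar> * indicator {..x} t)"
        by (cases "1 < t \<and> t \<le> x") auto
    qed
  qed auto
  have eq: "psi P x = (LINT t|?M. indicator {1<..x} t * ln t)" for x
    by (simp add: psi_def set_lebesgue_integral_def)
  show "mono (psi P)"
    unfolding eq[abs_def] by (intro monoI Bochner_Integration.integral_mono int) (auto simp: indicator_def)
  show "psi P z = 0" if "z \<le> 1" using that by (simp add: psi_def set_lebesgue_integral_def)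
  show "ennreal (psi P x) = (\<integral>\<^sup>+t. ennreal (indicator {1<..x} t * ln t) \<partial>?M)"
    unfolding eq by (rule nn_integral_eq_integral[symmetric, OF int]) (auto simp: indicator_def)
  show "continuous (at_right x) (psi P)"
    unfolding continuous_within
  proof (rule tendsto_at_right_sequentially[of _ "x + 1"])
    fix S :: "nat \<Rightarrow> real"
    assume S: "\<And>n. x < S n" "\<And>n. S n < x + 1" "decseq S" "S \<longlonglongrightarrow> x"
    show "(\<lambda>n. psi P (S n)) \<longlonglongrightarrow> psi P x"
      unfolding eq
    proof (rule integral_dominated_convergence[where w = "\<lambda>t. indicator {1<..x + 1} t * ln t"])
      show "AE t in ?M. (\<lambda>n. indicator {1<..S n} t * ln t) \<longlonglongrightarrow> indicator {1<..x} t * ln t"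
      proof (intro AE_I2 tendsto_eventually)
        fix t
        show "eventually (\<lambda>n. indicator {1<..S n} t * ln t = indicator {1<..x} t * ln t) sequentially"
        proof (cases "t \<le> x")
          case True
          thus ?thesis using S(1) by (intro always_eventually) (auto simp: indicator_def intro: order_trans less_imp_le)
        next
          case False
          hence "eventually (\<lambda>n. S n < t) sequentially" by (intro order_tendstoD(2)[OF S(4)]) auto
          thus ?thesis using False by (auto elim!: eventually_mono simp: indicator_def)
        qed
      qed
      show "AE t in ?M. norm (indicator {1<..S n} t * ln t) \<le> indicator {1<..x + 1} t * ln t" for n
        using S(2)[of n] by (intro AE_I2) (auto simp: indicator_def)
    qed (auto intro: int)
  qed auto
qed

text \<open>This is d\<psi> = log t dPi(t): in the logarithmic variable log t is the identity, so
  the density \<open>ennreal\<close> is u itself, truncated at 0. Both measures have the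
  distribution function \<open>psi P \<circ> exp\<close>, and \<open>P 1 = 0\<close> excludes mass
  at t \<le> 1.\<close>

lemma interval_measure_psi_exp:
  assumes mono: "mono P" and rc: "\<And>x. continuous (at_right x) P" and P0: "\<And>x. x < 1 \<Longrightarrow> P x = 0" and P1: "P 1 = 0"
  shows "interval_measure (psi P \<circ> exp) = density (interval_measure (P \<circ> exp)) ennreal"
proof (rule interval_measure_eqI[symmetric])
  note psi = psi_measure[OF mono rc P0]
  have d: "distr (interval_measure P) borel ln = interval_measure (P \<circ> exp)"
    by (rule distr_ln_interval_measure[OF mono rc P0])
  have pos: "AE t in interval_measure P. 1 < t" by (rule interval_measure_atMost_null[OF mono rc P0 P1])
  show "emeasure (density (interval_measure (P \<circ> exp)) ennreal) {..x} = ennreal ((psi P \<circ> exp) x)" for x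
  proof -
    have "emeasure (density (interval_measure (P \<circ> exp)) ennreal) {..x} = 
        (\<integral>\<^sup>+t. ennreal (ln t) * indicator {..x} (ln t) \<partial>interval_measure P)"
    proof -
      have "emeasure (density (interval_measure (P \<circ> exp)) ennreal) {..x} =
          (\<integral>\<^sup>+u. ennreal u * indicator {..x} u \<partial>distr (interval_measure P) borel ln)"
        by (subst d) (rule emeasure_density, auto)
      also have "\<dots> = (\<integral>\<^sup>+t. ennreal (ln t) * indicator {..x} (ln t) \<partial>interval_measure P)"
        by (rule nn_integral_distr) auto
      finally show ?thesis .
    qed
    also have "\<dots> = (\<integral>\<^sup>+t. ennreal (indicator {1<..exp x} t * ln t) \<partial>interval_measure P)"
    proof (rule nn_integral_cong_AE)
      show "AE t in interval_measure P. ennreal (ln t) * indicator {..x} (ln t) = ennreal (indicator {1<..exp x} t * ln t)"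
        using pos
      proof eventually_elim
        case (elim t)
        have "ln t \<le> x \<longleftrightarrow> t \<le> exp x" using elim exp_le_cancel_iff[of "ln t" x] by simp
        thus ?case using elim by (auto simp: indicator_def)
      qed
    qed
    finally show ?thesis by (simp add: psi(4))
  qed
  show "mono (psi P \<circ> exp)" using psi(1) by (auto simp: mono_def)
  show "(psi P \<circ> exp) x \<ge> 0" for x
    using psi(3)[of "min 0 (exp x)"] monoD[OF psi(1), of "min 0 (exp x)" "exp x"] by simp
qed (auto intro!: continuous_at_right_o_exp psi_measure[OF mono rc P0])

section \<open>Generalized number systems\<close>

lemma generalized_number_system_chebyshev:
  assumes gns: "generalized_number_system N P" and [measurable]: "f \<in> borel_measurable borel"
  shows "(\<integral>\<^sup>+u. ennreal u * f u \<partial>interval_measure (N \<circ> exp)) =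
         (\<integral>\<^sup>+v. \<integral>\<^sup>+u. f (u + v) \<partial>interval_measure (N \<circ> exp) \<partial>interval_measure (psi P \<circ> exp))"
proof -
  have N: "mono N" "\<And>x. continuous (at_right x) N" "\<And>x. x < 1 \<Longrightarrow> N x = 0"
    and P: "mono P" "\<And>x. continuous (at_right x) P" "\<And>x. x < 1 \<Longrightarrow> P x = 0" "P 1 = 0"
    using gns by (auto simp: generalized_number_system_def)
  obtain \<sigma>0 where \<sigma>0: "\<And>s. Re s > \<sigma>0 \<Longrightarrow> set_integrable (interval_measure N) {1..} (zeta_integrand s)"
      "\<And>s. Re s > \<sigma>0 \<Longrightarrow> set_integrable (interval_measure P) {1<..} (zeta_integrand s)"
      "\<And>s. Re s > \<sigma>0 \<Longrightarrow> (LINT x:{1..}|interval_measure N. zeta_integrand s x) =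
          exp (LINT x:{1<..}|interval_measure P. zeta_integrand s x)"
    using gns unfolding generalized_number_system_def by blast
  \<comment> \<open>Two of the three units pay for the factors u^k with k \<le> 2, by u \<le> exp u;
    the third keeps \<sigma> - 2 inside the open half-plane.\<close>
  define \<sigma> where "\<sigma> = \<sigma>0 + 3"
  have zi: "zeta_integrand s x = exp (- s * of_real (ln x))" if "x > 0" for s x
    using that by (simp add: zeta_integrand_def powr_def Ln_of_real)
  \<comment> \<open>N(1) = 1 is an atom at 1, hence the closed half-line; Pi(1) = 0 gives the open
    one. These are the domains of the two integrals in the definition.\<close>
  have Npos: "AE x in interval_measure N. 1 \<le> x" by (rule interval_measure_lessThan_null[OF N])
  have Ppos: "AE x in interval_measure P. 1 < x" by (rule interval_measure_atMost_null[OF P])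
  have pow: "u ^ k * exp (- \<sigma> * u) \<le> exp (- (\<sigma> - 2) * u)" if "u \<ge> 0" "k \<le> 2" for u k
  proof -
    have "u \<le> exp u" using exp_ge_add_one_self[of u] by linarith
    hence "u ^ k \<le> exp u ^ k" using that by (intro power_mono) auto
    also have "\<dots> \<le> exp u ^ 2" using that by (intro power_increasing) auto
    finally have "u ^ k * exp (- \<sigma> * u) \<le> exp u ^ 2 * exp (- \<sigma> * u)" by (rule mult_right_mono) simp
    also have "\<dots> = exp (- (\<sigma> - 2) * u)" by (simp add: exp_of_nat_mult[symmetric] exp_add[symmetric] algebra_simps)
    finally show ?thesis .
  qed
  have int: "integrable (interval_measure (F \<circ> exp)) (\<lambda>u. u ^ k * exp (- \<sigma> * u))"
    if F: "mono F" "\<And>x. continuous (at_right x) F" "\<And>x. x < 1 \<Longrightarrow> F x = 0"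
      and pos: "AE x in interval_measure F. x \<in> A" "A \<subseteq> {1..}"
      and si: "set_integrable (interval_measure F) A (zeta_integrand (of_real (\<sigma> - 2)))" and k: "k \<le> 2"
    for F A and k :: nat
  proof (subst distr_ln_interval_measure[OF F, symmetric], assumption, subst integrable_distr_eq, measurable)
    show "integrable (interval_measure F) (\<lambda>x. ln x ^ k * exp (- \<sigma> * ln x))"
    proof (rule Bochner_Integration.integrable_bound[OF si[unfolded set_integrable_def]])
      show "AE x in interval_measure F. norm (ln x ^ k * exp (- \<sigma> * ln x)) \<le>
         norm (indicator A x *\<^sub>R zeta_integrand (of_real (\<sigma> - 2)) x)"
        using pos(1)
      proof eventually_elim
        case (elim x)
        hence x: "x \<ge> 1" using pos(2) by auto
        have "norm (ln x ^ k * exp (- \<sigma> * ln x)) \<le> exp (- (\<sigma> - 2) * ln x)"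
          using pow[of "ln x" k] x k by (simp add: abs_mult)
        thus ?case using elim x by (simp add: zi)
      qed
    qed measurable
  qed
  \<comment> \<open>The sign of the imaginary part: for s = \<sigma> - i t the power x^(-s) is exp(-
    \<sigma> u) exp(i t u) with u = ln x.\<close>
  have tr: "(CLINT u|interval_measure (F \<circ> exp). of_real (exp (- \<sigma> * u)) * iexp (t * u)) =
      (LINT x:A|interval_measure F. zeta_integrand (Complex \<sigma> (- t)) x)"
    if F: "mono F" "\<And>x. continuous (at_right x) F" "\<And>x. x < 1 \<Longrightarrow> F x = 0"
      and pos: "AE x in interval_measure F. x \<in> A" "A \<subseteq> {1..}"
      and si: "set_integrable (interval_measure F) A (zeta_integrand (Complex \<sigma> (- t)))"
    for F A t
  proof -
    note [measurable] = borel_measurable_integrable[OF si[unfolded set_integrable_def]]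
    have "(CLINT u|interval_measure (F \<circ> exp). of_real (exp (- \<sigma> * u)) * iexp (t * u)) =
        (CLINT x|interval_measure F. of_real (exp (- \<sigma> * ln x)) * iexp (t * ln x))"
      by (subst distr_ln_interval_measure[OF F, symmetric], assumption, subst integral_distr) auto
    also have "\<dots> = (CLINT x|interval_measure F. indicator A x *\<^sub>R zeta_integrand (Complex \<sigma> (- t)) x)"
    proof (rule integral_cong_AE)
      show "AE x in interval_measure F. of_real (exp (- \<sigma> * ln x)) * iexp (t * ln x) =
          indicator A x *\<^sub>R zeta_integrand (Complex \<sigma> (- t)) x"
        using pos(1)
      proof eventually_elim
        case (elim x)
        hence x: "x \<ge> 1" using pos(2) by auto
        have "of_real (exp (- \<sigma> * ln x)) * iexp (t * ln x) = exp (of_real (- \<sigma> * ln x) + \<i> * of_real (t * ln x))"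
          by (simp only: exp_add exp_of_real)
        also have "of_real (- \<sigma> * ln x) + \<i> * of_real (t * ln x) = - Complex \<sigma> (- t) * of_real (ln x)"
          by (simp add: complex_eq_iff)
        finally show ?case using elim x by (simp add: zi)
      qed
    qed measurable
    finally show ?thesis by (simp add: set_lebesgue_integral_def)
  qed
  have s: "Re (of_real (\<sigma> - 2)) > \<sigma>0" "Re (Complex \<sigma> t) > \<sigma>0" for t by (auto simp: \<sigma>_def)
  have N': "AE x in interval_measure N. x \<in> {1..}" and P': "AE x in interval_measure P. x \<in> {1<..}"
    using Npos Ppos by auto
  have sub: "{1<..} \<subseteq> {1::real..}" by auto
  have ge0: "AE u in interval_measure (F \<circ> exp). 0 \<le> u" 
    if F: "mono F" "\<And>x. continuous (at_right x) F" "\<And>x. x < 1 \<Longrightarrow> F x = 0" for F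
    by (rule interval_measure_lessThan_null) (use F in \<open>auto intro!: continuous_at_right_o_exp simp: mono_def\<close>)
  show ?thesis
  proof (subst interval_measure_psi_exp[OF P], assumption, rule chebyshev_identity_measure)
    show "sigma_finite_measure (interval_measure (N \<circ> exp))"
      by (rule sigma_finite_interval_measure) (use N in \<open>auto intro!: continuous_at_right_o_exp simp: mono_def\<close>)
    show "integrable (interval_measure (N \<circ> exp)) (\<lambda>u. u ^ k * exp (- \<sigma> * u))" if "k \<le> 2" for k
      by (rule int[OF N(1-3) N' _ \<sigma>0(1)[OF s(1)] that]) auto
    show "integrable (interval_measure (P \<circ> exp)) (\<lambda>u. u ^ k * exp (- \<sigma> * u))" if "k \<le> 2" for k
      by (rule int[OF P(1-3) P' _ \<sigma>0(2)[OF s(1)] that]) auto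
    show "(CLINT u|interval_measure (N \<circ> exp). of_real (exp (- \<sigma> * u)) * iexp (t * u)) =
       exp (CLINT u|interval_measure (P \<circ> exp). of_real (exp (- \<sigma> * u)) * iexp (t * u))" for t
      by (simp only: tr[OF N(1-3) N' order_refl \<sigma>0(1)[OF s(2)]] tr[OF P(1-3) P' sub \<sigma>0(2)[OF s(2)]] \<sigma>0(3)[OF s(2)])
  qed (use ge0 N P in auto)
qed

section \<open>Chebyshev's identity and the prime number theorem in the logarithmic variable\<close>

locale chebyshev_pair = exp_density H G I for H G I :: "real \<Rightarrow> real" +
  fixes V :: "real \<Rightarrow> real"
  assumes rc_H: "\<And>x. continuous (at_right x) H"
    and mono_V: "mono V" and rc_V: "\<And>x. continuous (at_right x) V" and V_neg: "\<And>y. y < 0 \<Longrightarrow> V y = 0"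
    and cheb: "\<And>f. f \<in> borel_measurable borel \<Longrightarrow> (\<integral>\<^sup>+u. ennreal u * f u \<partial>interval_measure H) =
         (\<integral>\<^sup>+v. \<integral>\<^sup>+u. f (u + v) \<partial>interval_measure H \<partial>interval_measure V)"
    and pnt: "((\<lambda>y. exp (- y) * V y) \<longlongrightarrow> 1) at_top"
begin

abbreviation "n \<equiv> interval_measure H"
abbreviation "\<nu> \<equiv> interval_measure V"

definition "\<mu> y = (LINT u:{..y}|\<nu>. exp (- u))"
text \<open>In x = exp y this is 1/x times the integral of N(t)/t over [1, x], the term that remains
  when log t dN(t) is integrated by parts.\<close>

definition "J y = exp (- y) * (LINT u:{0..y}|lborel. H u)"

lemma V_nonneg: "V y \<ge> 0" using V_neg[of "min y (-1)"] monoD[OF mono_V, of "min y (-1)" y] by simp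

lemma emeasure_n: "emeasure n {..y} = ennreal (H y)" and emeasure_\<nu>: "emeasure \<nu> {..y} = ennreal (V y)"
  by (rule emeasure_interval_measure_atMost[OF mono_H rc_H H_neg], assumption)
     (rule emeasure_interval_measure_atMost[OF mono_V rc_V V_neg], assumption)

lemma AE_n: "AE u in n. 0 \<le> u" and AE_\<nu>: "AE u in \<nu>. 0 \<le> u"
  by (rule interval_measure_lessThan_null[OF mono_H rc_H H_neg], assumption)
     (rule interval_measure_lessThan_null[OF mono_V rc_V V_neg], assumption)

sublocale sn: sigma_finite_measure n
  by (rule sigma_finite_interval_measure) (use mono_H rc_H in \<open>auto simp: monoD\<close>)

sublocale s\<nu>: sigma_finite_measure \<nu>
  by (rule sigma_finite_interval_measure) (use mono_V rc_V in \<open>auto simp: monoD\<close>)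

lemma [measurable]: "H \<in> borel_measurable borel" "V \<in> borel_measurable borel"
  using mono_H mono_V by (auto intro: borel_measurable_mono)

lemma integrable_bounded_support:
  fixes f :: "real \<Rightarrow> real"
  assumes "f \<in> borel_measurable borel" "\<And>u. 0 \<le> u \<Longrightarrow> u \<le> y \<Longrightarrow> \<bar>f u\<bar> \<le> C" "\<And>u. u > y \<Longrightarrow> f u = 0"
  shows "integrable n f" "integrable \<nu> f"
proof -
  have "integrable n (\<lambda>u. C * indicator {..y} u)" "integrable \<nu> (\<lambda>u. C * indicator {..y} u)"
    by (auto intro!: integrable_mult_right integrable_real_indicator simp: emeasure_n emeasure_\<nu>)
  note * = this
  show "integrable n f"
    by (rule Bochner_Integration.integrable_bound[OF *(1)], use assms in measurable)
       (use AE_n assms(2,3) in \<open>fastforce simp: indicator_def elim!: eventually_mono\<close>)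
  show "integrable \<nu> f"
    by (rule Bochner_Integration.integrable_bound[OF *(2)], use assms in measurable)
       (use AE_\<nu> assms(2,3) in \<open>fastforce simp: indicator_def elim!: eventually_mono\<close>)
qed

lemma int_exp_n: "y \<ge> 0 \<Longrightarrow> (LINT u:{..y}|n. exp (- u)) = G y + I y"
proof -
  assume y: "y \<ge> 0"
  have "(LINT u:{..y}|n. exp (- u)) = exp (- y) * H y - (LINT v:{0..y}|lborel. - exp (- v) * H v)"
    by (rule interval_measure_parts(1)[OF mono_H rc_H H_neg _ _ y])
       (auto intro!: derivative_eq_intros continuous_intros)
  thus ?thesis by (simp add: G_def I_def set_lebesgue_integral_def)
qed

lemma \<mu>_parts: "y \<ge> 0 \<Longrightarrow> \<mu> y = exp (- y) * V y + (LINT u:{0..y}|lborel. exp (- u) * V u)"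
proof -
  assume y: "y \<ge> 0"
  have "\<mu> y = exp (- y) * V y - (LINT v:{0..y}|lborel. - exp (- v) * V v)"
    unfolding \<mu>_def
    by (rule interval_measure_parts(1)[OF mono_V rc_V V_neg _ _ y])
       (auto intro!: derivative_eq_intros continuous_intros)
  thus ?thesis by (simp add: set_lebesgue_integral_def)
qed

lemma nn_cheb: 
  assumes y: "y \<ge> 0"
  shows "(\<integral>\<^sup>+u. ennreal u * indicator {..y} u \<partial>n) = ennreal (y * H y - exp y * J y)" "y * H y - exp y * J y \<ge> 0"
proof -
  have 1: "(LINT u:{..y}|n. u) = y * H y - (LINT v:{0..y}|lborel. 1 * H v)"
    and 2: "set_integrable n {..y} (\<lambda>u. u)"
    by (rule interval_measure_parts[OF mono_H rc_H H_neg _ continuous_on_const y]; auto intro!: derivative_eq_intros)+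
  have eq: "y * H y - exp y * J y = (LINT u:{..y}|n. u)"
    unfolding 1 J_def by (simp add: exp_minus)
  have "(\<integral>\<^sup>+u. ennreal u * indicator {..y} u \<partial>n) = (\<integral>\<^sup>+u. ennreal (indicator {..y} u *\<^sub>R u) \<partial>n)"
    by (intro nn_integral_cong) (auto simp: indicator_def)
  also have "\<dots> = ennreal (LINT u:{..y}|n. u)"
    unfolding set_lebesgue_integral_def
    by (rule nn_integral_eq_integral) (use 2 AE_n in \<open>auto simp: set_integrable_def elim!: eventually_mono\<close>)
  finally show "(\<integral>\<^sup>+u. ennreal u * indicator {..y} u \<partial>n) = ennreal (y * H y - exp y * J y)" unfolding eq .
  show "y * H y - exp y * J y \<ge> 0" unfolding eq set_lebesgue_integral_def
    using AE_n by (intro integral_nonneg_AE) (auto elim!: eventually_mono)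
qed

lemma int_H_\<nu>: assumes y: "y \<ge> 0" shows "(LINT v|\<nu>. H (y - v)) = y * H y - exp y * J y"
proof -
  have "(\<integral>\<^sup>+v. ennreal (H (y - v)) \<partial>\<nu>) = (\<integral>\<^sup>+v. \<integral>\<^sup>+u. indicator {..y} (u + v) \<partial>n \<partial>\<nu>)"
  proof (intro nn_integral_cong)
    fix v
    have "(\<integral>\<^sup>+u. indicator {..y} (u + v) \<partial>n) = (\<integral>\<^sup>+u. indicator {..y - v} u \<partial>n)"
      by (intro nn_integral_cong) (auto simp: indicator_def)
    thus "ennreal (H (y - v)) = (\<integral>\<^sup>+u. indicator {..y} (u + v) \<partial>n)" by (simp add: emeasure_n)
  qed
  also have "\<dots> = ennreal (y * H y - exp y * J y)"
    using cheb[of "indicator {..y}"] nn_cheb(1)[OF y] by simp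
  finally show ?thesis
    using nn_cheb(2)[OF y] H_nonneg by (subst integral_eq_nn_integral) auto
qed

text \<open>The mass of dN * d\<psi> on [0, y] evaluated in the other order. This form accepts the
  PNT for \<open>V\<close>; the form \<open>int_H_\<nu>\<close> is the one into which
  \<open>G = a + E\<close> is inserted later.\<close>

lemma int_V_n: assumes y: "y \<ge> 0" shows "(LINT u|n. V (y - u)) = y * H y - exp y * J y"
proof -
  interpret pair_sigma_finite n \<nu> ..
  have "(\<integral>\<^sup>+u. ennreal (V (y - u)) \<partial>n) = (\<integral>\<^sup>+u. \<integral>\<^sup>+v. indicator {..y} (u + v) \<partial>\<nu> \<partial>n)"
  proof (intro nn_integral_cong)
    fix u
    have "(\<integral>\<^sup>+v. indicator {..y} (u + v) \<partial>\<nu>) = (\<integral>\<^sup>+v. indicator {..y - u} v \<partial>\<nu>)"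
      by (intro nn_integral_cong) (auto simp: indicator_def)
    thus "ennreal (V (y - u)) = (\<integral>\<^sup>+v. indicator {..y} (u + v) \<partial>\<nu>)" by (simp add: emeasure_\<nu>)
  qed
  also have "\<dots> = (\<integral>\<^sup>+v. \<integral>\<^sup>+u. indicator {..y} (u + v) \<partial>n \<partial>\<nu>)"
    by (rule Fubini'[symmetric]) measurable
  also have "\<dots> = ennreal (y * H y - exp y * J y)"
    using cheb[of "indicator {..y}"] nn_cheb(1)[OF y] by simp
  finally show ?thesis
    using nn_cheb(2)[OF y] V_nonneg by (subst integral_eq_nn_integral) auto
qed

lemma V_bounded: obtains W where "\<And>y. exp (- y) * V y \<le> W"
proof -
  have "eventually (\<lambda>y. exp (- y) * V y < 2) at_top" using pnt by (rule order_tendstoD) simp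
  then obtain U where U: "\<And>y. y \<ge> U \<Longrightarrow> exp (- y) * V y < 2" by (auto simp: eventually_at_top_linorder)
  show ?thesis
  proof (rule that)
    fix y
    show "exp (- y) * V y \<le> max 2 (V U)"
    proof (cases "y \<ge> U")
      case True thus ?thesis using U[of y] by simp
    next
      case False
      show ?thesis
      proof (cases "y < 0")
        case True thus ?thesis using V_neg V_nonneg by simp
      next
        case y: False
        have "exp (- y) * V y \<le> 1 * V U" using False y V_nonneg monoD[OF mono_V, of y U]
          by (intro mult_mono) auto
        thus ?thesis by simp
      qed
    qed
  qed
qed

text \<open>The additive constant covers the bounded range on which the PNT says nothing. Integrated
  against dN it becomes \<open>C * H y\<close>, which after scaling by exp(-y) is the admissible
  error \<open>C * G y\<close>.\<close>

lemma V_approx: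
  assumes "\<delta> > 0"
  obtains C where "C \<ge> 0" "\<And>z. z \<ge> 0 \<Longrightarrow> \<bar>V z - exp z\<bar> \<le> \<delta> * exp z + C"
proof -
  have "eventually (\<lambda>y. dist (exp (- y) * V y) 1 < \<delta>) at_top" using pnt assms by (rule tendstoD)
  then obtain U where U: "\<And>y. y \<ge> U \<Longrightarrow> dist (exp (- y) * V y) 1 < \<delta>" by (auto simp: eventually_at_top_linorder)
  show ?thesis
  proof (rule that[of "V U + exp U"])
    fix z :: real assume "z \<ge> 0"
    show "\<bar>V z - exp z\<bar> \<le> \<delta> * exp z + (V U + exp U)"
    proof (cases "z \<ge> U")
      case True
      have "V z - exp z = exp z * (exp (- z) * V z - 1)" by (simp add: exp_minus algebra_simps)
      hence "\<bar>V z - exp z\<bar> = exp z * \<bar>exp (- z) * V z - 1\<bar>" by (simp add: abs_mult)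
      also have "\<dots> \<le> exp z * \<delta>" using U[OF True] by (intro mult_left_mono) (auto simp: dist_real_def)
      finally show ?thesis using V_nonneg[of U] exp_ge_zero[of U] by (simp only: mult.commute[of "exp z"])
    next
      case False
      have "V z \<le> V U" "exp z \<le> exp U" using False monoD[OF mono_V, of z U] by auto
      moreover have "0 \<le> \<delta> * exp z" using assms by simp
      ultimately show ?thesis using V_nonneg[of z] exp_ge_zero[of z] by linarith
    qed
  qed (use V_nonneg in \<open>auto intro!: add_nonneg_nonneg\<close>)
qed

lemma J_nonneg: "J y \<ge> 0"
  unfolding J_def set_lebesgue_integral_def using H_nonneg by (intro mult_nonneg_nonneg integral_nonneg_AE) auto

text \<open>The integral is cut at y - U with U = 1/\<delta>. Before the cut the factor exp(u - y)
  is at most exp(-U) \<le> \<delta>, which gives \<open>\<delta> * I y\<close>; after it, on a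
  stretch of length at most U, monotonicity of \<open>H\<close> gives \<open>G y\<close>.\<close>

lemma J_bound:
  assumes "\<delta> > 0" "y \<ge> 0"
  shows "J y \<le> \<delta> * I y + (1 / \<delta>) * G y"
proof -
  define U where "U = 1 / \<delta>"
  have U: "U > 0" using assms by (simp add: U_def)
  have "exp (- U) \<le> \<delta>"
  proof -
    have "U \<le> exp U" using exp_ge_add_one_self[of U] by linarith
    thus ?thesis using assms by (simp add: U_def exp_minus field_simps)
  qed
  have sH: "set_integrable lborel {0..y} (\<lambda>u. exp (- y) * H u)"
    unfolding set_integrable_def
  proof (rule Bochner_Integration.integrable_bound[OF set_integrable_const_bounded[of "{0..y}" "H y", unfolded set_integrable_def]])
    show "AE x in lborel. norm (indicat_real {0..y} x *\<^sub>R (exp (- y) * H x)) \<le> norm (indicat_real {0..y} x *\<^sub>R H y)"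
    proof (intro AE_I2)
      fix x
      have "exp (- y) * H x \<le> 1 * H y" if "x \<in> {0..y}"
        using that assms monoD[OF mono_H, of x y] H_nonneg by (intro mult_mono) auto
      thus "norm (indicat_real {0..y} x *\<^sub>R (exp (- y) * H x)) \<le> norm (indicat_real {0..y} x *\<^sub>R H y)"
        using H_nonneg by (auto simp: indicator_def)
    qed
  qed auto
  have sI: "set_integrable lborel {0..y} G" by (rule G_set_integrable) auto
  have sU: "set_integrable lborel {0..y} (\<lambda>u. indicator {y - U..y} u * G y)"
  proof -
    have "set_integrable lborel ({0..y} \<inter> {y - U..y}) (\<lambda>u. G y)"
      by (rule set_integrable_const_bounded) auto
    thus ?thesis unfolding set_integrable_def indicator_inter_arith by (simp only: real_scaleR_def mult.assoc)
  qed
  have "J y = (LINT u:{0..y}|lborel. exp (- y) * H u)" by (simp add: J_def)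
  also have "\<dots> \<le> (LINT u:{0..y}|lborel. \<delta> * G u + indicator {y - U..y} u * G y)"
  proof (rule set_integral_mono[OF sH])
    show "set_integrable lborel {0..y} (\<lambda>u. \<delta> * G u + indicator {y - U..y} u * G y)"
      using sI sU by (intro set_integral_add set_integrable_mult_right) auto
    fix u assume u: "u \<in> {0..y}"
    show "exp (- y) * H u \<le> \<delta> * G u + indicator {y - U..y} u * G y"
    proof (cases "u \<ge> y - U")
      case True
      have "exp (- y) * H u \<le> G y" unfolding G_def using u monoD[OF mono_H, of u y] by auto
      moreover have "\<delta> * G u \<ge> 0" using assms G_nonneg by simp
      ultimately show ?thesis using True u by simp
    next
      case False
      have "exp (- y) * H u \<le> exp (- U - u) * H u" using False H_nonneg by (intro mult_right_mono) auto
      also have "\<dots> = exp (- U) * G u" by (simp add: G_def exp_diff exp_minus divide_inverse)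
      also have "\<dots> \<le> \<delta> * G u" using \<open>exp (- U) \<le> \<delta>\<close> G_nonneg by (intro mult_right_mono)
      finally show ?thesis using False by simp
    qed
  qed
  also have "\<dots> = \<delta> * I y + (LINT u:{0..y}|lborel. indicator {y - U..y} u * G y)"
    using sI sU by (subst set_integral_add) (auto simp: I_def)
  also have "(LINT u:{0..y}|lborel. indicator {y - U..y} u * G y) \<le> (LINT u:{y - U..y}|lborel. G y)"
    unfolding set_lebesgue_integral_def
  proof (rule Bochner_Integration.integral_mono)
    show "integrable lborel (\<lambda>u. indicat_real {0..y} u *\<^sub>R (indicat_real {y - U..y} u * G y))"
      using sU by (simp add: set_integrable_def)
    show "integrable lborel (\<lambda>u. indicat_real {y - U..y} u *\<^sub>R G y)"
      using set_integrable_const_bounded[of "{y - U..y}" "G y"] by (simp add: set_integrable_def)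
  qed (use G_nonneg in \<open>auto simp: indicator_def\<close>)
  also have "\<dots> = U * G y" using U by (simp add: set_lebesgue_integral_def)
  finally show ?thesis by (simp add: U_def)
qed

text \<open>Replacing V(z) by exp z in \<open>int_V_n\<close> and evaluating by
  \<open>int_exp_n\<close> turns the identity into y G - J = G + I + error, where \<open>J\<close>
  is itself small by \<open>J_bound\<close>.\<close>

lemma G_I_relation:
  assumes \<delta>: "\<delta> > 0"
  shows "\<exists>C. \<forall>y\<ge>0. \<bar>y * G y - I y\<bar> \<le> \<delta> * I y + C * G y"
proof -
  \<comment> \<open>Half of \<delta> is spent on the error in the PNT, the other half on
    \<open>J\<close>.\<close>
  obtain C where C: "C \<ge> 0" "\<And>z. z \<ge> 0 \<Longrightarrow> \<bar>V z - exp z\<bar> \<le> (\<delta>/2) * exp z + C"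
    using V_approx[of "\<delta>/2"] \<delta> by auto
  have main: "\<bar>y * G y - I y\<bar> \<le> \<delta> * I y + (1 + \<delta> + C + 2 / \<delta>) * G y" if y: "y \<ge> 0" for y
  proof -
    have iV: "integrable n (\<lambda>u. V (y - u))"
      by (rule integrable_bounded_support(1)[of _ y "V y"])
         (use V_nonneg V_neg monoD[OF mono_V, of "y - _" y] in auto)
    have ie: "integrable n (\<lambda>u. indicator {..y} u * exp (y - u))"
      by (rule integrable_bounded_support(1)[of _ y "exp y"]) auto
    have i1: "integrable n (\<lambda>u. indicator {..y} u * C)"
      by (rule integrable_bounded_support(1)[of _ y "\<bar>C\<bar>"]) auto
    have e: "(LINT u|n. indicator {..y} u * exp (y - u)) = exp y * (G y + I y)"
    proof -
      have "(LINT u|n. indicator {..y} u * exp (y - u)) = (LINT u|n. exp y * (indicator {..y} u *\<^sub>R exp (- u)))"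
        by (intro Bochner_Integration.integral_cong) (auto simp: exp_diff exp_minus divide_inverse)
      thus ?thesis using int_exp_n[OF y] by (simp add: set_lebesgue_integral_def)
    qed
    have "\<bar>(y * H y - exp y * J y) - exp y * (G y + I y)\<bar> =
        \<bar>LINT u|n. V (y - u) - indicator {..y} u * exp (y - u)\<bar>"
      using iV ie by (simp add: int_V_n[OF y] e)
    also have "\<dots> \<le> (LINT u|n. (\<delta>/2) * (indicator {..y} u * exp (y - u)) + indicator {..y} u * C)"
    proof -
      have "norm (LINT u|n. V (y - u) - indicator {..y} u * exp (y - u)) \<le>
         (LINT u|n. (\<delta>/2) * (indicator {..y} u * exp (y - u)) + indicator {..y} u * C)"
      proof (rule Bochner_Integration.integral_norm_bound_integral)
        show "norm (V (y - u) - indicator {..y} u * exp (y - u)) \<le> (\<delta>/2) * (indicator {..y} u * exp (y - u)) + indicator {..y} u * C" for u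
          using C(2)[of "y - u"] V_neg[of "y - u"] by (auto simp: indicator_def)
      qed (use iV ie i1 in auto)
      thus ?thesis by simp
    qed
    also have "\<dots> = (\<delta>/2) * (exp y * (G y + I y)) + C * H y"
      using ie i1 by (simp add: e measure_def emeasure_n H_nonneg)
    finally have "exp (- y) * \<bar>(y * H y - exp y * J y) - exp y * (G y + I y)\<bar> \<le> exp (- y) * ((\<delta>/2) * (exp y * (G y + I y)) + C * H y)"
      by (rule mult_left_mono) simp
    moreover have "exp (- y) * \<bar>(y * H y - exp y * J y) - exp y * (G y + I y)\<bar> = \<bar>y * G y - J y - (G y + I y)\<bar>"
    proof -
      have "exp (- y) * ((y * H y - exp y * J y) - exp y * (G y + I y)) = y * G y - J y - (G y + I y)"
        by (simp add: G_def algebra_simps exp_minus)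
      thus ?thesis by (metis abs_exp_cancel abs_mult)
    qed
    moreover have "exp (- y) * ((\<delta>/2) * (exp y * (G y + I y)) + C * H y) = (\<delta>/2) * (G y + I y) + C * G y"
      by (simp add: G_def algebra_simps exp_minus)
    moreover have "J y \<le> (\<delta>/2) * I y + (1 / (\<delta>/2)) * G y" using \<delta> y by (intro J_bound) auto
    moreover have "(\<delta>/2) * G y \<ge> 0" using \<delta> G_nonneg by simp
    ultimately have "\<bar>y * G y - I y\<bar> \<le> (\<delta>/2) * (G y + I y) + C * G y + G y + ((\<delta>/2) * I y + (1 / (\<delta>/2)) * G y) + (\<delta>/2) * G y"
      using J_nonneg[of y] G_nonneg[of y] by linarith
    also have "\<dots> = \<delta> * I y + (1 + \<delta> + C + 2 / \<delta>) * G y" by (simp add: field_simps)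
    finally show ?thesis .
  qed
  thus "\<exists>C. \<forall>y\<ge>0. \<bar>y * G y - I y\<bar> \<le> \<delta> * I y + C * G y" by blast
qed

sublocale slowly_varying_density H G I
  by unfold_locales (rule G_I_relation[unfolded I_def G_def])

end

section \<open>Kernels and the limit relation\<close>

lemma lebesgue_borel_version:
  fixes K :: "real \<Rightarrow> complex"
  assumes "K \<in> borel_measurable lebesgue"
  obtains L where "L \<in> borel_measurable borel" "AE x in lborel. K x = L x"
proof -
  have "(\<lambda>x. Re (K x)) \<in> borel_measurable lebesgue" "(\<lambda>x. Im (K x)) \<in> borel_measurable lebesgue"
    using assms by measurable
  from completion_ex_borel_measurable_real[OF this(1)] completion_ex_borel_measurable_real[OF this(2)]
  obtain f g where f: "f \<in> borel_measurable lborel" "AE x in lborel. Re (K x) = f x"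
    and g: "g \<in> borel_measurable lborel" "AE x in lborel. Im (K x) = g x" by auto
  show ?thesis
  proof (rule that[of "\<lambda>x. Complex (f x) (g x)"])
    have "(\<lambda>x. of_real (f x) + \<i> * of_real (g x)) \<in> borel_measurable borel" using f g by simp
    thus "(\<lambda>x. Complex (f x) (g x)) \<in> borel_measurable borel" by (simp add: Complex_eq)
    show "AE x in lborel. K x = Complex (f x) (g x)"
      using f(2) g(2) by eventually_elim (simp add: complex_eq_iff)
  qed
qed

text \<open>The Fubini arguments run on Borel functions, so the kernel is replaced by an almost
  everywhere equal Borel one. The weight (1 + |y|)^(1 + \<epsilon>) dominates 1 + |y|, whence the
  finite first moment.\<close>

lemma admissible_kernel_lborel:
  assumes K: "admissible_kernel K"
  obtains L where "finite_moment L" "AE x in lborel. K x = L x" "fourier K 0 = (LINT u|lborel. L u)"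
    "(LINT u|lborel. L u) \<noteq> 0"
proof -
  have Km: "K \<in> borel_measurable lebesgue" and K0: "fourier K 0 \<noteq> 0" using K by (auto simp: admissible_kernel_def)
  obtain \<epsilon> where \<epsilon>: "\<epsilon> > 0" and int: "integrable lebesgue (\<lambda>y. (1 + \<bar>y\<bar>) powr (1 + \<epsilon>) * norm (K y))"
    using K by (auto simp: admissible_kernel_def)
  obtain L where L[measurable]: "L \<in> borel_measurable borel" and KL: "AE x in lborel. K x = L x"
    by (rule lebesgue_borel_version[OF Km])
  have KL': "AE x in lebesgue. K x = L x" by (rule AE_completion[OF KL])
  have Lm[measurable]: "L \<in> borel_measurable lebesgue" using measurable_completion[of L lborel borel] by simp
  have "integrable lebesgue (\<lambda>y. (1 + \<bar>y\<bar>) * norm (L y))"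
  proof (rule Bochner_Integration.integrable_bound[OF int])
    show "AE y in lebesgue. norm ((1 + \<bar>y\<bar>) * norm (L y)) \<le> norm ((1 + \<bar>y\<bar>) powr (1 + \<epsilon>) * norm (K y))"
      using KL'
    proof eventually_elim
      case (elim y)
      have "(1 + \<bar>y\<bar>) powr 1 \<le> (1 + \<bar>y\<bar>) powr (1 + \<epsilon>)" using \<epsilon> by (intro powr_mono) auto
      hence "1 + \<bar>y\<bar> \<le> (1 + \<bar>y\<bar>) powr (1 + \<epsilon>)" by simp
      thus ?case unfolding elim by (simp add: abs_mult mult_right_mono)
    qed
    show "(\<lambda>y. (1 + \<bar>y\<bar>) * norm (L y)) \<in> borel_measurable lebesgue"
      by (rule measurable_completion) measurable
  qed
  hence "integrable lborel (\<lambda>y. (1 + \<bar>y\<bar>) * norm (L y))" by (subst (asm) integrable_completion) auto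
  hence fm: "finite_moment L" by (simp add: finite_moment_def)
  have "fourier K 0 = (LINT y|lebesgue. K y)" by (simp add: fourier_def)
  also have "\<dots> = (LINT y|lebesgue. L y)" by (rule integral_cong_AE) (use KL' Km Lm in auto)
  also have "\<dots> = (LINT y|lborel. L y)" by (rule integral_completion) simp
  finally show ?thesis using that[OF fm KL] K0 by simp
qed

text \<open>Equality holds at every \<open>y\<close>: \<open>K\<close> and \<open>L\<close> differ
  on a null set of the integration variable only. So pointwise limits carry over as well as
  integrals.\<close>

lemma conv_eq_lconv:
  assumes [measurable]: "E \<in> borel_measurable borel" "L \<in> borel_measurable borel" and KL: "AE x in lborel. K x = L x"
    and Km: "K \<in> borel_measurable lebesgue"
  shows "conv E K = lconv (\<lambda>y. of_real (E y)) L"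
proof
  fix y
  have [measurable]: "(\<lambda>u. complex_of_real (E (y - u))) \<in> borel_measurable lebesgue" "L \<in> borel_measurable lebesgue"
    using measurable_completion[of "\<lambda>u. complex_of_real (E (y - u))" lborel borel] measurable_completion[of L lborel borel] by auto
  note [measurable] = Km
  have "conv E K y = (LINT u|lebesgue. of_real (E (y - u)) * L u)"
    unfolding conv_def by (rule integral_cong_AE) (use AE_completion[OF KL] in auto)
  also have "\<dots> = lconv (\<lambda>y. of_real (E y)) L y"
    unfolding lconv_def by (rule integral_completion) simp
  finally show "conv E K y = lconv (\<lambda>y. of_real (E y)) L y" .
qed

section \<open>Asymptotics of \<mu>\<close>

context chebyshev_pair
begin

lemma \<mu>_neg: "y < 0 \<Longrightarrow> \<mu> y = 0"
  unfolding \<mu>_def set_lebesgue_integral_def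
  by (rule integral_eq_zero_AE) (use AE_\<nu> in \<open>auto elim!: eventually_mono\<close>)

text \<open>Integration by parts writes \<mu> as w plus the primitive of w, where w(u) = exp(-u)
  V(u) tends to 1. Increments of w tend to 0, those of the primitive to u, and one bound for w
  controls both.\<close>

lemma \<mu>_increment:
  obtains C where "\<And>y u. \<bar>\<mu> y - \<mu> (y - u)\<bar> \<le> C * (1 + \<bar>u\<bar>)"
  and "\<And>u. ((\<lambda>y. \<mu> y - \<mu> (y - u)) \<longlongrightarrow> u) at_top"
proof -
  define w where "w u = exp (- u) * V u" for u
  obtain W where W: "\<And>u. w u \<le> W" using V_bounded unfolding w_def by blast
  have w0: "w u \<ge> 0" for u using V_nonneg by (simp add: w_def)
  have W0: "W \<ge> 0" using order_trans[OF w0 W] .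
  have wneg: "u < 0 \<Longrightarrow> w u = 0" for u by (simp add: w_def V_neg)
  have [measurable]: "w \<in> borel_measurable borel" unfolding w_def by measurable
  have si: "set_integrable lborel A w" if "A \<in> sets borel" "bounded A" for A
    unfolding set_integrable_def
    by (rule Bochner_Integration.integrable_bound[OF set_integrable_const_bounded[OF that, of W, unfolded set_integrable_def]])
       (use that W w0 W0 in \<open>auto simp: indicator_def abs_of_nonneg\<close>)
  define S where "S y = (LINT u:{0..y}|lborel. w u)" for y
  have \<mu>: "\<mu> y = w y + S y" for y
  proof (cases "y < 0")
    case True thus ?thesis using \<mu>_neg by (simp add: wneg S_def set_lebesgue_integral_def)
  next
    case False thus ?thesis using \<mu>_parts[of y] by (simp add: w_def S_def)
  qed
  have S: "S y - S x = (LINT u:{x<..y}|lborel. w u)" if "x \<le> y" for x y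
  proof -
    have "S y = (LINT u:{0..x} \<union> {x<..y}|lborel. w u)"
      unfolding S_def set_lebesgue_integral_def using that wneg
      by (intro Bochner_Integration.integral_cong) (auto simp: indicator_def not_le)
    also have "\<dots> = S x + (LINT u:{x<..y}|lborel. w u)"
      unfolding S_def by (rule set_integral_Un) (auto intro!: si intro: bounded_subset[of "{x..y}"])
    finally show ?thesis by simp
  qed
  have S1: "\<bar>S y - S x\<bar> \<le> W * (y - x)" if "x \<le> y" for x y
  proof -
    have "0 \<le> S y - S x" unfolding S[OF that] set_lebesgue_integral_def
      using w0 by (intro integral_nonneg_AE) auto
    moreover have "S y - S x \<le> (LINT u:{x<..y}|lborel. W)" unfolding S[OF that]
      by (rule set_integral_mono)
         (auto intro!: si set_integrable_const_bounded W intro: bounded_subset[of "{x..y}"])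
    moreover have "(LINT u:{x<..y}|lborel. W) = W * (y - x)" using that by (simp add: set_lebesgue_integral_def)
    ultimately show ?thesis by linarith
  qed
  have wt: "(w \<longlongrightarrow> 1) at_top" using pnt unfolding w_def[abs_def] .
  \<comment> \<open>The increment is \<open>w\<close> convolved with the indicator of [0, u), so it
    tends to the length of that interval.\<close>
  have St: "((\<lambda>y. S y - S (y - u)) \<longlongrightarrow> u) at_top" if u: "u \<ge> 0" for u
  proof -
    have "bounded_tendsto (\<lambda>y. of_real (w y)) 1"
      unfolding bounded_tendsto_def using W w0 tendsto_of_real[OF wt]
      by (auto intro!: exI[of _ W] simp: abs_of_nonneg)
    moreover have "integrable lborel (indicator {0..<u} :: real \<Rightarrow> complex)"
    proof -
      have "integrable lborel (\<lambda>x. complex_of_real (indicator {0..<u} x))"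
        by (intro integrable_of_real integrable_real_indicator) (use u in auto)
      thus ?thesis by (simp only: of_real_indicator)
    qed
    ultimately have "bounded_tendsto (lconv (\<lambda>y. of_real (w y)) (indicator {0..<u})) (1 * (LINT x|lborel. indicator {0..<u} x))"
      by (rule bounded_tendsto_lconv)
    from bounded_tendstoD(2)[OF this]
    have l: "((\<lambda>y. lconv (\<lambda>y. of_real (w y)) (indicator {0..<u}) y) \<longlongrightarrow> (LINT x|lborel. indicator {0..<u} x)) at_top"
      by simp
    have "lconv (\<lambda>y. of_real (w y)) (indicator {0..<u}) y = of_real (S y - S (y - u))" for y
    proof -
      have "lconv (\<lambda>y. of_real (w y)) (indicator {0..<u}) y = (LINT x|lborel. complex_of_real (w (y - x) * indicator {0..<u} x))"
        unfolding lconv_def by (intro Bochner_Integration.integral_cong) (auto simp: indicator_def)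
      also have "\<dots> = of_real (LINT x|lborel. w (y - x) * indicator {0..<u} x)"
        by (rule integral_complex_of_real)
      also have "(LINT x|lborel. w (y - x) * indicator {0..<u} x) = (LINT x|lborel. w x * indicator {0..<u} (y - x))"
        using lborel_integral_real_affine[of "-1" "\<lambda>x. w x * indicator {0..<u} (y - x)" y] by simp
      also have "\<dots> = (LINT x:{y - u<..y}|lborel. w x)"
        unfolding set_lebesgue_integral_def by (intro Bochner_Integration.integral_cong) (auto simp: indicator_def)
      finally show ?thesis using u by (simp add: S)
    qed
    moreover have "(LINT x|lborel. indicator {0..<u} x) = complex_of_real u"
    proof -
      have "(LINT x|lborel. indicator {0..<u} x) = complex_of_real (LINT x|lborel. indicator {0..<u} x)"
        by (simp only: integral_complex_of_real[symmetric] of_real_indicator)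
      thus ?thesis using u by simp
    qed
    ultimately show ?thesis using l by (simp only: tendsto_of_real_iff)
  qed
  have St': "((\<lambda>y. S y - S (y - u)) \<longlongrightarrow> u) at_top" for u
  proof (cases "u \<ge> 0")
    case False
    hence "((\<lambda>y. S y - S (y - (- u))) \<longlongrightarrow> - u) at_top" by (intro St) auto
    from tendsto_minus[OF tendsto_shift_at_top[OF this, of u]] show ?thesis by simp
  qed (rule St)
  show ?thesis
  proof (rule that)
    show "\<bar>\<mu> y - \<mu> (y - u)\<bar> \<le> W * (1 + \<bar>u\<bar>)" for y u
    proof -
      have "\<bar>S y - S (y - u)\<bar> \<le> W * \<bar>u\<bar>"
        using S1[of "y - u" y] S1[of y "y - u"] by (cases "u \<ge> 0") (auto simp: abs_minus_commute)
      moreover have "\<bar>w y - w (y - u)\<bar> \<le> W" using W[of y] W[of "y - u"] w0[of y] w0[of "y - u"] by linarith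
      moreover have "\<mu> y - \<mu> (y - u) = (w y - w (y - u)) + (S y - S (y - u))" by (simp add: \<mu>)
      ultimately show ?thesis by (simp add: algebra_simps)
    qed
    show "((\<lambda>y. \<mu> y - \<mu> (y - u)) \<longlongrightarrow> u) at_top" for u
      unfolding \<mu> using tendsto_add[OF tendsto_diff[OF wt tendsto_shift_at_top[OF wt, of u]] St'[of u]]
      by (simp add: algebra_simps)
  qed
qed

text \<open>\<open>J\<close> is \<open>G\<close> convolved with exp(-u) on the half-line, a kernel
  of integral 1, and so inherits the limit of \<open>G\<close>.\<close>

lemma bounded_tendsto_J:
  assumes "(G \<longlongrightarrow> a) at_top"
  shows "bounded_tendsto (\<lambda>y. of_real (J y)) (of_real a)"
proof -
  obtain Y where Y: "\<And>y. y \<ge> Y \<Longrightarrow> G y < a + 1"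
    using order_tendstoD(2)[OF assms, of "a + 1"] by (auto simp: eventually_at_top_linorder)
  have "G y \<le> max (a + 1) (H Y)" for y
    using Y[of y] G_le_H[of y Y] by (cases "y \<ge> Y") auto
  hence G: "bounded_tendsto (\<lambda>y. of_real (G y)) (of_real a)"
    unfolding bounded_tendsto_def using G_nonneg tendsto_of_real[OF assms]
    by (auto intro!: exI[of _ "max (a + 1) (H Y)"] simp: abs_of_nonneg)
  define k where "k u = complex_of_real (indicator {0..} u * exp (- u))" for u :: real
  have hk: "has_bochner_integral lborel (\<lambda>u. indicator {0..} u * exp (- u)) (1::real)"
  proof -
    have "(\<integral>\<^sup>+x. ennreal (exp (- x)) * indicator {0..} x \<partial>lborel) = ennreal (0 - - exp (- 0))"
      by (rule nn_integral_FTC_atLeast[where F = "\<lambda>x. - exp (- x)"])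
         (auto intro!: derivative_eq_intros, real_asymp)
    moreover have "ennreal (exp (- x)) * indicator {0..} x = ennreal (indicator {0..} x * exp (- x))" for x :: real
      by (auto simp: indicator_def)
    ultimately show ?thesis by (intro has_bochner_integral_nn_integral) auto
  qed
  have ik: "integrable lborel k" and k1: "(LINT u|lborel. k u) = 1"
    unfolding k_def[abs_def] integral_complex_of_real
    using hk by (auto simp only: has_bochner_integral_iff of_real_1 intro!: integrable_of_real)
  have "lconv (\<lambda>y. of_real (G y)) k y = of_real (J y)" for y
  proof -
    have "lconv (\<lambda>y. of_real (G y)) k y = of_real (LINT u|lborel. G (y - u) * (indicator {0..} u * exp (- u)))"
      unfolding lconv_def k_def by (simp flip: of_real_mult)
    also have "(LINT u|lborel. G (y - u) * (indicator {0..} u * exp (- u))) = (LINT u|lborel. G u * (indicator {0..} (y - u) * exp (- (y - u))))"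
      using lborel_integral_real_affine[of "-1" "\<lambda>u. G u * (indicator {0..} (y - u) * exp (- (y - u)))" y] by simp
    also have "\<dots> = (LINT u|lborel. exp (- y) * (indicator {0..y} u *\<^sub>R H u))"
      by (intro Bochner_Integration.integral_cong) (auto simp: indicator_def G_def exp_diff exp_minus H_neg field_simps)
    finally show ?thesis by (simp add: J_def set_lebesgue_integral_def)
  qed
  hence "lconv (\<lambda>y. of_real (G y)) k = (\<lambda>y. of_real (J y))" by (rule ext)
  with bounded_tendsto_lconv[OF G ik] show ?thesis by (simp add: k1)
qed

lemma \<mu>_asymptotics:
  fixes E :: "real \<Rightarrow> real"
  assumes a: "a > 0" and E: "\<And>y. E y = (if y \<ge> 0 then G y - a else 0)"
    and K: "finite_moment K" "finite_moment L" "(LINT u|lborel. K u) \<noteq> 0" "(LINT u|lborel. L u) \<noteq> 0"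
    and EK: "((\<lambda>y. of_real y * lconv (\<lambda>y. of_real (E y)) K y) \<longlongrightarrow> 0) at_top"
    and EL: "integrable lborel (lconv (\<lambda>y. of_real (E y)) L)"
  shows "((\<lambda>y. complex_of_real (a * (\<mu> y - y + 1))) \<longlongrightarrow> 
            - ((LINT y|lborel. lconv (\<lambda>y. of_real (E y)) L y) / (LINT u|lborel. L u))) at_top"
proof -
  \<comment> \<open>The rate o(1/y) is first weakened to o(1) in order to find the limit of
    \<open>G\<close>; the full rate can be exploited once \<open>E\<close> is known to be bounded
    and to tend to 0.\<close>
  have EK0: "((\<lambda>y. lconv (\<lambda>y. of_real (E y)) K y) \<longlongrightarrow> 0) at_top"
  proof -
    have "((\<lambda>y. complex_of_real (1 / y)) \<longlongrightarrow> of_real 0) at_top" by (intro tendsto_of_real) real_asymp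
    from tendsto_mult[OF this EK] have "((\<lambda>y. complex_of_real (1 / y) * (of_real y * lconv (\<lambda>y. of_real (E y)) K y)) \<longlongrightarrow> 0) at_top" by simp
    moreover have "eventually (\<lambda>y. complex_of_real (1 / y) * (of_real y * lconv (\<lambda>y. of_real (E y)) K y) = lconv (\<lambda>y. of_real (E y)) K y) at_top"
      using eventually_gt_at_top[of 0] by eventually_elim simp
    ultimately show ?thesis by (rule Lim_transform_eventually)
  qed
  have Ga: "(G \<longlongrightarrow> a) at_top" by (rule G_tendsto[OF K(1,3) E EK0 a])
  have [measurable]: "E \<in> borel_measurable borel" unfolding E[abs_def] by measurable
  have Et: "(E \<longlongrightarrow> 0) at_top"
  proof -
    have "((\<lambda>y. G y - a) \<longlongrightarrow> a - a) at_top" by (intro tendsto_intros Ga)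
    moreover have "eventually (\<lambda>y. G y - a = E y) at_top"
      using eventually_ge_at_top[of 0] by eventually_elim (simp add: E)
    ultimately show ?thesis by (simp add: filterlim_cong)
  qed
  obtain C where "\<And>y. \<bar>E y\<bar> \<le> C"
  proof -
    obtain Y where Y: "\<And>y. y \<ge> Y \<Longrightarrow> G y < a + 1"
      using order_tendstoD(2)[OF Ga, of "a + 1"] by (auto simp: eventually_at_top_linorder)
    have "\<bar>E y\<bar> \<le> a + max (a + 1) (H Y)" for y
      using Y[of y] G_le_H[of y Y] G_nonneg[of y] a by (cases "y \<ge> Y") (auto simp: E)
    thus ?thesis by (rule that)
  qed
  note C = this
  have Eb: "bounded_tendsto (\<lambda>y. of_real (E y)) 0"
    unfolding bounded_tendsto_def using C tendsto_of_real[OF Et] by auto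
  obtain C\<^sub>0 where C0: "\<And>y u. \<bar>\<mu> y - \<mu> (y - u)\<bar> \<le> C\<^sub>0 * (1 + \<bar>u\<bar>)"
    and lim: "\<And>u. ((\<lambda>y. \<mu> y - \<mu> (y - u)) \<longlongrightarrow> u) at_top" by (rule \<mu>_increment) blast
  define m where "m = density \<nu> (\<lambda>u. ennreal (exp (- u)))"
  have sm: "sets m = sets borel" by (simp add: m_def)
  have ie: "integrable \<nu> (\<lambda>u. indicator {..y} u * exp (- u))" for y
    by (rule integrable_bounded_support(2)[of _ y 1]) auto
  have \<mu>0: "\<mu> y \<ge> 0" for y
    unfolding \<mu>_def set_lebesgue_integral_def by (intro integral_nonneg_AE) auto
  have em: "emeasure m {..y} = ennreal (\<mu> y)" for y
  proof -
    have "emeasure m {..y} = (\<integral>\<^sup>+u. ennreal (indicator {..y} u * exp (- u)) \<partial>\<nu>)"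
      unfolding m_def by (subst emeasure_density) (auto intro!: nn_integral_cong simp: indicator_def)
    also have "\<dots> = ennreal (LINT u|\<nu>. indicator {..y} u * exp (- u))"
      by (rule nn_integral_eq_integral[OF ie]) auto
    finally show ?thesis by (simp add: \<mu>_def set_lebesgue_integral_def)
  qed
  \<comment> \<open>Writing -J as r - a and moving \<open>a\<close> to the left produces the
    \<open>+ 1\<close> in the identity; \<open>r\<close> tends to 0 because \<open>J\<close> tends
    to \<open>a\<close>.\<close>
  define r where "r y = (if y \<ge> 0 then a - J y else 0)" for y
  have rb: "bounded_tendsto (\<lambda>y. of_real (r y)) 0"
  proof -
    have J: "bounded_tendsto (\<lambda>y. of_real (J y)) (of_real a)" by (rule bounded_tendsto_J[OF Ga])
    obtain D where D: "\<And>y. norm (complex_of_real (J y)) \<le> D" using bounded_tendstoD(3)[OF J] by blast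
    have "norm (complex_of_real (r y)) \<le> a + D" for y
      using D[of y] a order_trans[OF norm_ge_zero D[of y]] by (auto simp: r_def)
    moreover have "(r \<longlongrightarrow> 0) at_top"
    proof -
      have "(J \<longlongrightarrow> a) at_top" using bounded_tendstoD(2)[OF J] by (simp only: tendsto_of_real_iff)
      hence "((\<lambda>y. a - J y) \<longlongrightarrow> a - a) at_top" by (intro tendsto_intros)
      moreover have "eventually (\<lambda>y. a - J y = r y) at_top"
        using eventually_ge_at_top[of 0] by eventually_elim (simp add: r_def)
      ultimately show ?thesis by (simp add: filterlim_cong)
    qed
    hence "((\<lambda>y. complex_of_real (r y)) \<longlongrightarrow> of_real 0) at_top" by (rule tendsto_of_real)
    moreover have "(\<lambda>y. complex_of_real (r y)) \<in> borel_measurable borel"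
    proof -
      have "(\<lambda>y. Re (complex_of_real (J y))) \<in> borel_measurable borel"
        using bounded_tendstoD(1)[OF J] by measurable
      hence [measurable]: "J \<in> borel_measurable borel" by simp
      show ?thesis unfolding r_def by measurable
    qed
    ultimately show ?thesis unfolding bounded_tendsto_def by (auto intro!: exI[of _ "a + D"] simp del: norm_of_real)
  qed
  have id: "of_real (a * (\<mu> y - y + 1)) = of_real y * complex_of_real (E y) - (LINT v|m. of_real (E (y - v))) + of_real (r y)"
    if y: "y \<ge> 0" for y
  proof -
    have i1: "integrable \<nu> (\<lambda>v. H (y - v))"
      by (rule integrable_bounded_support(2)[of _ y "H y"])
         (use H_nonneg H_neg monoD[OF mono_H, of "y - _" y] in auto)
    have "(LINT v|m. E (y - v)) = (LINT v|\<nu>. exp (- v) * E (y - v))"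
      unfolding m_def by (subst integral_density) auto
    \<comment> \<open>Here exp(-v) G(y - v) = exp(-y) H(y - v), and \<open>a\<close> is subtracted
      for v \<le> y only, because \<open>E\<close> vanishes on the negatives.\<close>
    also have "\<dots> = (LINT v|\<nu>. exp (- y) * H (y - v) - a * (indicator {..y} v * exp (- v)))"
      by (intro Bochner_Integration.integral_cong refl)
         (auto simp: E G_def indicator_def exp_diff exp_minus H_neg field_simps)
    also have "\<dots> = exp (- y) * (y * H y - exp y * J y) - a * \<mu> y"
      using i1 ie[of y] int_H_\<nu>[OF y] by (simp add: \<mu>_def set_lebesgue_integral_def)
    also have "\<dots> = y * G y - J y - a * \<mu> y" by (simp add: G_def algebra_simps exp_minus)
    finally have "a * (\<mu> y - y + 1) = y * E y - (LINT v|m. E (y - v)) + r y"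
      using y by (simp add: E r_def algebra_simps)
    hence "complex_of_real (a * (\<mu> y - y + 1)) = of_real (y * E y - (LINT v|m. E (y - v)) + r y)" by (simp only:)
    thus ?thesis by simp
  qed
  show ?thesis
    by (rule averaged_identity_limit[OF sm em \<mu>0 \<mu>_neg C0 lim Eb _ K EK EL rb _ id])
       (auto simp: E r_def)
qed

end

theorem theorem3p1:
  fixes N P E :: "real \<Rightarrow> real" and a :: real
    and K1 K2 :: "real \<Rightarrow> complex" and b c :: complex
  assumes "generalized_number_system N P"
    and "psi P \<sim>[at_top] (\<lambda>x. x)"
    and "a > 0"
    and "\<And>x. x \<ge> 1 \<Longrightarrow> N x = a * x + x * E (ln x)"
    and "\<And>y. y < 0 \<Longrightarrow> E y = 0"
    and "admissible_kernel K1" and "admissible_kernel K2"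
    and "\<forall>\<^sub>F y in at_top. conv_exists E K1 y"
    and "conv E K1 \<in> o[at_top](\<lambda>y. 1 / complex_of_real y)"
    and "AE y in lebesgue. conv_exists E K2 y"
    and "integrable lebesgue (conv E K2)"
    and "b = inverse (fourier K2 0) * (LINT y|lebesgue. conv E K2 y)"
    and "c = - b / complex_of_real a - 1"
  shows "(\<lambda>x. complex_of_real (psi1 P x) - (complex_of_real (ln x) + c)) \<in> o[at_top](\<lambda>x. 1)"
proof -
  have N: "mono N" "\<And>x. continuous (at_right x) N" "\<And>x. x < 1 \<Longrightarrow> N x = 0" "N 1 = 1"
    and P: "mono P" "\<And>x. continuous (at_right x) P" "\<And>x. x < 1 \<Longrightarrow> P x = 0" "P 1 = 0"
    using assms(1) by (auto simp: generalized_number_system_def)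
  note psi = psi_measure[OF P(1-3)]
  interpret chebyshev_pair "N \<circ> exp" "\<lambda>y. exp (- y) * (N \<circ> exp) y" "\<lambda>y. LINT u:{0..y}|lborel. exp (- u) * (N \<circ> exp) u" "psi P \<circ> exp"
  proof unfold_locales
    show "mono (N \<circ> exp)" using N(1) by (auto simp: mono_def)
    show "(N \<circ> exp) y > 0" if "y \<ge> 0" for y using monoD[OF N(1), of 1 "exp y"] N(4) that by simp
    show "mono (psi P \<circ> exp)" using psi(1) by (auto simp: mono_def)
    show "continuous (at_right x) (N \<circ> exp)" for x by (rule continuous_at_right_o_exp[OF N(2)])
    show "continuous (at_right x) (psi P \<circ> exp)" for x
      by (rule continuous_at_right_o_exp) (rule psi(2), assumption)
    show "(psi P \<circ> exp) y = 0" if "y < 0" for y using that by (auto intro!: psi(3))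
    show "((\<lambda>y. exp (- y) * (psi P \<circ> exp) y) \<longlongrightarrow> 1) at_top"
    proof -
      have "((\<lambda>x. psi P x / x) \<longlongrightarrow> 1) at_top"
        by (rule asymp_equivD_strong[OF assms(2)]) (auto intro: eventually_mono[OF eventually_gt_at_top[of 0]])
      from filterlim_compose[OF this exp_at_top] show ?thesis by (simp add: exp_minus divide_inverse mult.commute)
    qed
  qed (use N generalized_number_system_chebyshev[OF assms(1)] in auto)
  obtain K where K: "finite_moment K" "AE x in lborel. K1 x = K x" "(LINT u|lborel. K u) \<noteq> 0"
    by (rule admissible_kernel_lborel[OF assms(6)])
  obtain L where L: "finite_moment L" "AE x in lborel. K2 x = L x" "fourier K2 0 = (LINT u|lborel. L u)" "(LINT u|lborel. L u) \<noteq> 0"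
    by (rule admissible_kernel_lborel[OF assms(7)])
  \<comment> \<open>The range x \<ge> 1 of the defining relation is y \<ge> 0, so \<open>E\<close>
    is determined everywhere, and Borel measurability follows from that of \<open>N\<close>.\<close>
  have E: "E y = (if y \<ge> 0 then exp (- y) * (N \<circ> exp) y - a else 0)" for y
    using assms(4)[of "exp y"] assms(5)[of y] by (auto simp: exp_minus field_simps)
  have Em: "E \<in> borel_measurable borel"
    unfolding E[abs_def] by measurable
  have cK: "conv E K1 = lconv (\<lambda>y. of_real (E y)) K"
    by (rule conv_eq_lconv[OF Em finite_moment_measurable[OF K(1)] K(2)]) (use assms(6) in \<open>simp add: admissible_kernel_def\<close>)
  have cL: "conv E K2 = lconv (\<lambda>y. of_real (E y)) L"
    by (rule conv_eq_lconv[OF Em finite_moment_measurable[OF L(1)] L(2)]) (use assms(7) in \<open>simp add: admissible_kernel_def\<close>)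
  have cLm: "lconv (\<lambda>y. of_real (E y)) L \<in> borel_measurable borel"
    using Em finite_moment_measurable[OF L(1)] by (intro measurable_lconv) auto
  have EK: "((\<lambda>y. of_real y * lconv (\<lambda>y. of_real (E y)) K y) \<longlongrightarrow> 0) at_top"
    using smalloD_tendsto[OF assms(9)[unfolded cK]] by (simp add: mult.commute)
  have EL: "integrable lborel (lconv (\<lambda>y. of_real (E y)) L)"
    using assms(11) cLm unfolding cL by (subst (asm) integrable_completion) auto
  have bL: "b = (LINT y|lborel. lconv (\<lambda>y. of_real (E y)) L y) / (LINT u|lborel. L u)"
  proof -
    have "(LINT y|lebesgue. conv E K2 y) = (LINT y|lborel. lconv (\<lambda>y. of_real (E y)) L y)"
      unfolding cL by (rule integral_completion) (use cLm in simp)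
    thus ?thesis by (simp add: assms(12) L(3) divide_inverse mult.commute)
  qed
  have "((\<lambda>y. complex_of_real (a * (\<mu> y - y + 1))) \<longlongrightarrow> - b) at_top"
    unfolding bL by (rule \<mu>_asymptotics[OF assms(3) E K(1) L(1) K(3) L(4) EK EL])
  from filterlim_compose[OF this ln_at_top]
  have 1: "((\<lambda>x. complex_of_real (a * (\<mu> (ln x) - ln x + 1))) \<longlongrightarrow> - b) at_top" .
  have "((\<lambda>x. complex_of_real (a * (\<mu> (ln x) - ln x + 1)) / of_real a - 1 - c) \<longlongrightarrow> - b / of_real a - 1 - c) at_top"
    using assms(3) by (intro tendsto_intros 1) auto
  hence 2: "((\<lambda>x. complex_of_real (a * (\<mu> (ln x) - ln x + 1)) / of_real a - 1 - c) \<longlongrightarrow> 0) at_top"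
    by (simp add: assms(13))
  have "eventually (\<lambda>x. complex_of_real (a * (\<mu> (ln x) - ln x + 1)) / of_real a - 1 - c =
      complex_of_real (psi1 P x) - (complex_of_real (ln x) + c)) at_top"
    using eventually_ge_at_top[of 1]
  proof eventually_elim
    case (elim x)
    have psi1: "psi P 1 = 0" by (rule psi(3)) auto
    \<comment> \<open>There is no atom at 1, so in the logarithmic variable the domain
      \<open>{1<..x}\<close> becomes \<open>{..ln x}\<close> up to a null set.\<close>
    have pos: "AE t in interval_measure (psi P). 1 < t"
      by (rule interval_measure_atMost_null[of _ 1]) (use psi psi1 in auto)
    have "psi1 P x = (LINT t|interval_measure (psi P). indicator {1<..x} t * (1 / t))"
      by (simp add: psi1_def set_lebesgue_integral_def)
    also have "\<dots> = (LINT t|interval_measure (psi P). indicator {..ln x} (ln t) * exp (- ln t))"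
    proof (rule integral_cong_AE)
      show "AE t in interval_measure (psi P). indicator {1<..x} t * (1 / t) = indicator {..ln x} (ln t) * exp (- ln t)"
        using pos by eventually_elim (use elim in \<open>auto simp: indicator_def exp_minus divide_inverse\<close>)
    qed measurable
    also have "\<dots> = (LINT u|distr (interval_measure (psi P)) borel ln. indicator {..ln x} u * exp (- u))"
      by (subst integral_distr) auto
    also have "distr (interval_measure (psi P)) borel ln = interval_measure (psi P \<circ> exp)"
      by (rule distr_ln_interval_measure) (use psi in auto)
    finally have "psi1 P x = \<mu> (ln x)" by (simp add: \<mu>_def set_lebesgue_integral_def)
    thus ?case using assms(3) by simp
  qed
  from Lim_transform_eventually[OF 2 this] show ?thesis
    by (intro smalloI_tendsto) auto
qed

end
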